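(* Let $p$ be an odd prime, $G$ a finite nested GVZ $p$-group, and $\chi\in\operatorname{Irr}(G)$ with $\chi(1)\neq 1$. Let $N=\ker(\chi)$. Then (1) $e_{\mathbb{Q}}(\chi)=\epsilon(Z(\chi),N)$; (2) $\mathbb{Q}G\,\epsilon(Z(\chi),N)\cong M_{|G/Z(\chi)|^{1/2}}\big(\mathbb{Q}(\zeta_{|Z(\chi)/N|})\big)$.
   Context: $\operatorname{Irr}(G)$ is the set of irreducible complex characters; $\ker(\chi)=\{g:\chi(g)=\chi(1)\}$, $Z(\chi)=\{g\in G:|\chi(g)|=\chi(1)\}$. $G$ is a GVZ-group if every $\chi\in\operatorname{Irr}(G)$ vanishes on $G\setminus Z(\chi)$; nested if the $Z(\chi)$, $\chi\in\operatorname{Irr}(G)$, are totally ordered by inclusion; a nested GVZ-group is both. For $\chi\in\operatorname{Irr}(G)$, $e(\chi)=\frac{\chi(1)}{|G|}\sum_{g\in G}\chi(g)g^{-1}$, and $e_{\mathbb{Q}}(\chi)=\sum_{\sigma\in\operatorname{Gal}(\mathbb{Q}(\chi)/\mathbb{Q})}e(\chi^\sigma)$, where $\mathbb{Q}(\chi)$ is the field generated by the values of $\chi$. For a finite subset $X$ of a group, $\widehat{X}=\frac{1}{|X|}\sum_{x\in X}x$. For a group $H$ and $N\trianglelefteq H$, $\epsilon(H,N)=\widehat{H}$ if $N=H$, and otherwise $\epsilon(H,N)=\prod_{D/N\in M(H/N)}(\widehat{N}-\widehat{D})$, where $M(H/N)$ is the set of minimal nontrivial normal subgroups $D/N$ of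 $H/N$ (with $N\le D\le H$); these are viewed as elements of $\mathbb{Q}G$ when $H\le G$. $\zeta_m$ is a primitive $m$-th root of unity and $M_k(K)$ the $k\times k$ matrix algebra over $K$. *)

theory Defs
  imports "HOL-Algebra.Coset" "Jordan_Normal_Form.Matrix" "HOL-Library.FuncSet"
begin

definition mat_trace :: "complex mat \<Rightarrow> complex" where
  "mat_trace A = (\<Sum>i<dim_row A. A $$ (i, i))"

definition is_rep :: "('a, 'b) monoid_scheme \<Rightarrow> nat \<Rightarrow> ('a \<Rightarrow> complex mat) \<Rightarrow> bool" where
  "is_rep G d \<rho> \<longleftrightarrow>
     (\<forall>g\<in>carrier G. \<rho> g \<in> carrier_mat d d) \<and>
     \<rho> \<one>\<^bsub>G\<^esub> = 1\<^sub>m d \<and>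
     (\<forall>g\<in>carrier G. \<forall>h\<in>carrier G. \<rho> (g \<otimes>\<^bsub>G\<^esub> h) = \<rho> g * \<rho> h)"

definition is_subspace :: "nat \<Rightarrow> complex vec set \<Rightarrow> bool" where
  "is_subspace d W \<longleftrightarrow> W \<subseteq> carrier_vec d \<and> 0\<^sub>v d \<in> W \<and>
     (\<forall>v\<in>W. \<forall>w\<in>W. v + w \<in> W) \<and> (\<forall>c. \<forall>v\<in>W. c \<cdot>\<^sub>v v \<in> W)"

definition irreducible_rep :: "('a, 'b) monoid_scheme \<Rightarrow> nat \<Rightarrow> ('a \<Rightarrow> complex mat) \<Rightarrow> bool" where
  "irreducible_rep G d \<rho> \<longleftrightarrow> is_rep G d \<rho> \<and> d > 0 \<and>
     (\<forall>W. is_subspace d W \<and> (\<forall>g\<in>carrier G. \<forall>w\<in>W. \<rho> g *\<^sub>v w \<in> W)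
          \<longrightarrow> W = {0\<^sub>v d} \<or> W = carrier_vec d)"

definition Irr :: "('a, 'b) monoid_scheme \<Rightarrow> ('a \<Rightarrow> complex) set" where
  "Irr G = {\<chi>. \<exists>d \<rho>. irreducible_rep G d \<rho> \<and>
              \<chi> = (\<lambda>g. if g \<in> carrier G then mat_trace (\<rho> g) else 0)}"

definition char_ker :: "('a, 'b) monoid_scheme \<Rightarrow> ('a \<Rightarrow> complex) \<Rightarrow> 'a set" where
  "char_ker G \<chi> = {g \<in> carrier G. \<chi> g = \<chi> \<one>\<^bsub>G\<^esub>}"

definition char_center :: "('a, 'b) monoid_scheme \<Rightarrow> ('a \<Rightarrow> complex) \<Rightarrow> 'a set" where
  "char_center G \<chi> = {g \<in> carrier G. complex_of_real (cmod (\<chi> g)) = \<chi> \<one>\<^bsub>G\<^esub>}"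

definition GVZ_group :: "('a, 'b) monoid_scheme \<Rightarrow> bool" where
  "GVZ_group G \<longleftrightarrow> (\<forall>\<chi>\<in>Irr G. \<forall>g \<in> carrier G - char_center G \<chi>. \<chi> g = 0)"

definition nested_group :: "('a, 'b) monoid_scheme \<Rightarrow> bool" where
  "nested_group G \<longleftrightarrow> (\<forall>\<chi>\<in>Irr G. \<forall>\<psi>\<in>Irr G.
      char_center G \<chi> \<subseteq> char_center G \<psi> \<or> char_center G \<psi> \<subseteq> char_center G \<chi>)"

definition p_group :: "nat \<Rightarrow> ('a, 'b) monoid_scheme \<Rightarrow> bool" where
  "p_group p G \<longleftrightarrow> (\<exists>n. card (carrier G) = p ^ n)"

section \<open>Group algebra: elements are functions carrier G \<rightarrow> complex, zero off the group\<close>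

definition grp_alg_mult :: "('a, 'b) monoid_scheme \<Rightarrow> ('a \<Rightarrow> complex) \<Rightarrow> ('a \<Rightarrow> complex) \<Rightarrow> ('a \<Rightarrow> complex)" where
  "grp_alg_mult G x y = (\<lambda>g. if g \<in> carrier G
      then (\<Sum>h\<in>carrier G. x h * y (inv\<^bsub>G\<^esub> h \<otimes>\<^bsub>G\<^esub> g)) else 0)"

definition grp_alg_one :: "('a, 'b) monoid_scheme \<Rightarrow> ('a \<Rightarrow> complex)" where
  "grp_alg_one G = (\<lambda>g. if g = \<one>\<^bsub>G\<^esub> then 1 else 0)"

definition rat_grp_alg :: "('a, 'b) monoid_scheme \<Rightarrow> ('a \<Rightarrow> complex) set" where
  "rat_grp_alg G = {x. (\<forall>g. g \<notin> carrier G \<longrightarrow> x g = 0) \<and> (\<forall>g. x g \<in> \<rat>)}"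

text \<open>Product over a finite family of (pairwise commuting) group algebra elements.\<close>
definition grp_alg_prod :: "('a, 'b) monoid_scheme \<Rightarrow> ('c \<Rightarrow> ('a \<Rightarrow> complex)) \<Rightarrow> 'c set \<Rightarrow> ('a \<Rightarrow> complex)" where
  "grp_alg_prod G f S = Finite_Set.fold (\<lambda>D acc. grp_alg_mult G acc (f D)) (grp_alg_one G) S"

definition hat :: "'a set \<Rightarrow> ('a \<Rightarrow> complex)" where
  "hat X = (\<lambda>g. if g \<in> X then 1 / of_nat (card X) else 0)"

text \<open>Minimal nontrivial normal subgroups D/N of H/N, given as the D with N < D <= H, D normal in H.\<close>
definition min_normal_over :: "('a, 'b) monoid_scheme \<Rightarrow> 'a set \<Rightarrow> 'a set \<Rightarrow> 'a set set" where
  "min_normal_over G H N = {D. N \<subset> D \<and> D \<subseteq> H \<and> D \<lhd> (G\<lparr>carrier := H\<rparr>) \<and>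
       \<not> (\<exists>E. N \<subset> E \<and> E \<subset> D \<and> E \<lhd> (G\<lparr>carrier := H\<rparr>))}"

definition eps :: "('a, 'b) monoid_scheme \<Rightarrow> 'a set \<Rightarrow> 'a set \<Rightarrow> ('a \<Rightarrow> complex)" where
  "eps G H N = (if N = H then hat H
     else grp_alg_prod G (\<lambda>D. (\<lambda>g. hat N g - hat D g)) (min_normal_over G H N))"

definition e_idem :: "('a, 'b) monoid_scheme \<Rightarrow> ('a \<Rightarrow> complex) \<Rightarrow> ('a \<Rightarrow> complex)" where
  "e_idem G \<chi> = (\<lambda>g. if g \<in> carrier G
      then \<chi> \<one>\<^bsub>G\<^esub> / of_nat (card (carrier G)) * \<chi> (inv\<^bsub>G\<^esub> g) else 0)"

definition is_subfield_C :: "complex set \<Rightarrow> bool" where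
  "is_subfield_C K \<longleftrightarrow> 0 \<in> K \<and> 1 \<in> K \<and> (\<forall>x\<in>K. \<forall>y\<in>K. x + y \<in> K \<and> x * y \<in> K) \<and>
      (\<forall>x\<in>K. - x \<in> K \<and> inverse x \<in> K)"

definition gen_subfield :: "complex set \<Rightarrow> complex set" where
  "gen_subfield S = \<Inter> {K. is_subfield_C K \<and> S \<subseteq> K}"

text \<open>Field automorphisms of a subfield K of C (= Gal(K/Q)), as extensional maps on K.\<close>
definition field_auts :: "complex set \<Rightarrow> (complex \<Rightarrow> complex) set" where
  "field_auts K = {\<sigma>. \<sigma> \<in> K \<rightarrow>\<^sub>E K \<and> bij_betw \<sigma> K K \<and> \<sigma> 1 = 1 \<and>
      (\<forall>x\<in>K. \<forall>y\<in>K. \<sigma> (x + y) = \<sigma> x + \<sigma> y \<and> \<sigma> (x * y) = \<sigma> x * \<sigma> y)}"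

definition char_field :: "('a, 'b) monoid_scheme \<Rightarrow> ('a \<Rightarrow> complex) \<Rightarrow> complex set" where
  "char_field G \<chi> = gen_subfield (\<chi> ` carrier G)"

definition e_Q :: "('a, 'b) monoid_scheme \<Rightarrow> ('a \<Rightarrow> complex) \<Rightarrow> ('a \<Rightarrow> complex)" where
  "e_Q G \<chi> = (\<lambda>g. \<Sum>\<sigma>\<in>field_auts (char_field G \<chi>). e_idem G (\<sigma> \<circ> \<chi>) g)"

definition mat_over :: "nat \<Rightarrow> complex set \<Rightarrow> complex mat set" where
  "mat_over k K = {M \<in> carrier_mat k k. \<forall>i<k. \<forall>j<k. M $$ (i, j) \<in> K}"

definition grp_alg_ideal :: "('a, 'b) monoid_scheme \<Rightarrow> ('a \<Rightarrow> complex) \<Rightarrow> ('a \<Rightarrow> complex) set" where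
  "grp_alg_ideal G e = {grp_alg_mult G x e | x. x \<in> rat_grp_alg G}"

text \<open>Ring isomorphism (hence Q-algebra isomorphism) of QG e onto M_k(K).\<close>
definition alg_iso_mat :: "('a, 'b) monoid_scheme \<Rightarrow> ('a \<Rightarrow> complex) \<Rightarrow> nat \<Rightarrow> complex set \<Rightarrow> bool" where
  "alg_iso_mat G e k K \<longleftrightarrow> (\<exists>f. bij_betw f (grp_alg_ideal G e) (mat_over k K) \<and>
     (\<forall>x\<in>grp_alg_ideal G e. \<forall>y\<in>grp_alg_ideal G e.
        f (\<lambda>g. x g + y g) = f x + f y \<and> f (grp_alg_mult G x y) = f x * f y))"

end

theory Submission
  imports Defs "Jordan_Normal_Form.Schur_Decomposition" "HOL-Number_Theory.Residues"
    "HOL-Computational_Algebra.Field_as_Ring" "HOL-Algebra.Group_Action" "HOL-Algebra.Multiplicative_Group"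
begin

text \<open>
  Let Z and N be the centre and kernel of \<chi>, let d = \<chi>(1), and let \<lambda> be the linear character of Z with
  \<chi> = d \<lambda> on Z. It embeds Z/N into the roots of unity, so Z/N is cyclic of order m = p^k, and \<chi>
  vanishes off Z, so d^2 = |G : Z| and e(\<chi>)(g) = \<lambda>(g^-1) / |Z| on Z. Summing over the Galois group of
  the p^k-th cyclotomic field turns these coefficients into Ramanujan sums, which are the coefficients
  of hat N - hat D, where D/N is the unique subgroup of order p of Z/N. The Galois group is the full
  unit group modulo p^k because an integer polynomial vanishing at a p^k-th root of unity has a
  value at 1 divisible by p, while the cyclotomic polynomial has value p there.

  For the second part it suffices to realise \<chi> over the cyclotomic field K: Fourier inversion then
  maps the rational group algebra onto the d x d matrices over K. As p is odd, a nonabelian p-group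
  with cyclic centre has a noncentral element x of order p that commutes with every element up to a
  central factor. Passing to an eigenspace of x and to its stabiliser keeps the character values in
  K; iterating (Roquette's argument) ends in a subgroup of index d with an eigenvector whose
  eigenvalues lie in K, and the translates of this eigenvector are a basis in which the
  representation is monomial over K.
\<close>

section \<open>Cyclotomic fields of prime power order\<close>

text \<open>The obstacle in the second part is the Schur index: a simple component of a rational
  group algebra is in general a matrix algebra over a division algebra, and its centre K and its
  dimension do not force that division algebra to be commutative. A model of the representation with
  entries in K settles this without Wedderburn theory, because the isomorphism can then be written
  down explicitly. The descent keeps all traces in K because each step uses only spectral
  projections of an element acting with order dividing p. Their coefficients are p-th roots of unity
  divided by p, and these lie in K because p divides the order of Z/N. The subrepresentations met on
  the way are encoded by idempotent d x d matrices E instead of subspaces, so the descent itself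
  needs no change of basis. The condition \<chi>(1) \<noteq> 1 enters by making Z/N nontrivial: only
  then is there a subgroup D/N of order p.\<close>

interpretation of_rat_poly_hom: map_poly_inj_idom_hom of_rat ..

section \<open>Integer polynomials vanishing at a root of unity of prime power order\<close>

lemma prime_dvd_binomial_sum:
  fixes x y :: "'a::comm_ring_1"
  assumes "prime p"
  shows "of_nat p dvd (x + y) ^ p - (x ^ p + y ^ p)"
proof -
  have p0: "p \<noteq> 0" using assms by (auto dest: prime_gt_0_nat)
  have eq: "{..p} = insert 0 (insert p {1..<p})" using p0 by auto
  have "(x + y) ^ p = (\<Sum>k\<le>p. of_nat (p choose k) * x ^ k * y ^ (p - k))"
    by (rule binomial_ring)
  also have "\<dots> = y ^ p + x ^ p + (\<Sum>k\<in>{1..<p}. of_nat (p choose k) * x ^ k * y ^ (p - k))"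
    unfolding eq using p0 by (subst sum.insert; simp)+
  finally have "(x + y) ^ p - (x ^ p + y ^ p) = (\<Sum>k\<in>{1..<p}. of_nat (p choose k) * x ^ k * y ^ (p - k))"
    by simp
  moreover have "of_nat p dvd (\<Sum>k\<in>{1..<p}. of_nat (p choose k) * x ^ k * y ^ (p - k))"
  proof (rule dvd_sum)
    fix k assume "k \<in> {1..<p}"
    then have "p dvd (p choose k)" by (intro dvd_choose_prime) (use assms in auto)
    then obtain c where c: "p choose k = p * c" by (elim dvdE)
    show "of_nat p dvd (of_nat (p choose k) * x ^ k * y ^ (p - k) :: 'a)"
      unfolding c by (simp add: mult.assoc)
  qed
  ultimately show ?thesis by simp
qed

lemma fermat_int:
  fixes a :: int
  assumes "prime p"
  shows "[a ^ p = a] (mod int p)"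
proof -
  define b where "b = nat (a mod int p)"
  have p0: "p > 0" using assms by (rule prime_gt_0_nat)
  have "[b ^ p = b] (mod p)"
  proof (cases "p dvd b")
    case True
    moreover have "p dvd b ^ p" using True p0 by (metis dvd_power dvd_trans)
    ultimately show ?thesis by (simp add: cong_def)
  next
    case False
    have "[b ^ (p - 1) * b = 1 * b] (mod p)"
      by (rule cong_scalar_right[OF fermat_theorem[OF assms False]])
    then show ?thesis using power_minus_mult[OF p0, of b] by simp
  qed
  then have "[int b ^ p = int b] (mod int p)" by (metis cong_int_iff of_nat_power)
  moreover have "[int b = a] (mod int p)" using p0 by (simp add: b_def cong_def)
  ultimately show ?thesis by (meson cong_pow cong_sym cong_trans)
qed

text \<open>Modulo p the p-th power is additive, so it can be taken term by term; on the
  coefficients it is the identity by Fermat's little theorem.\<close>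

lemma poly_frobenius:
  fixes f :: "int poly"
  assumes "prime p"
  shows "of_nat p dvd f ^ p - pcompose f (Polynomial.monom 1 p)"
proof (induction f)
  case 0
  then show ?case using assms by (auto simp: zero_power dest: prime_gt_0_nat)
next
  case (pCons a f)
  have e1: "pCons a f = [:a:] + [:0, 1:] * f" by simp
  have "(of_nat p :: int) dvd a ^ p - a"
  proof -
    have "[a ^ p = a] (mod int p)" by (rule fermat_int[OF assms])
    then show ?thesis by (simp add: cong_iff_dvd_diff)
  qed
  then have d1: "(of_nat p :: int poly) dvd [:a:] ^ p - [:a:]"
    by (simp add: of_nat_poly poly_const_pow)
  have d2: "(of_nat p :: int poly) dvd (pCons a f) ^ p - ([:a:] ^ p + ([:0, 1:] * f) ^ p)"
    unfolding e1 by (rule prime_dvd_binomial_sum[OF assms])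
  have X: "([:0, 1:] :: int poly) ^ p = Polynomial.monom 1 p" by (simp add: Polynomial.monom_altdef)
  have d3: "(of_nat p :: int poly) dvd Polynomial.monom 1 p * (f ^ p - pcompose f (Polynomial.monom 1 p))"
    using pCons.IH by simp
  have e2: "pcompose (pCons a f) (Polynomial.monom 1 p) = [:a:] + Polynomial.monom 1 p * pcompose f (Polynomial.monom 1 p)"
    by (simp add: pcompose_pCons)
  have e3: "(pCons a f) ^ p - pcompose (pCons a f) (Polynomial.monom 1 p) =
     ((pCons a f) ^ p - ([:a:] ^ p + ([:0, 1:] * f) ^ p)) + ([:a:] ^ p - [:a:]) +
      Polynomial.monom 1 p * (f ^ p - pcompose f (Polynomial.monom 1 p))"
    unfolding e2 power_mult_distrib X by (simp add: algebra_simps)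
  show ?case unfolding e3 by (intro dvd_add d1 d2 d3)
qed

text \<open>Meant for evaluation at a \<open>p ^ k\<close>-th root of unity, where the composed
  polynomial takes the value of f at 1. The induction step uses that a - b divides a^p -
  b^p.\<close>

lemma poly_frobenius_power:
  fixes f :: "int poly"
  assumes "prime p"
  shows "of_nat p dvd f ^ (p ^ k) - pcompose f (Polynomial.monom 1 (p ^ k))"
proof (induction k)
  case 0
  then show ?case by (simp add: pcompose_idR Polynomial.monom_altdef)
next
  case (Suc k)
  let ?g = "pcompose f (Polynomial.monom 1 (p ^ k))"
  have "f ^ (p ^ k) - ?g dvd (f ^ (p ^ k)) ^ p - ?g ^ p"
    by (simp add: power_diff_sumr2)
  with Suc have d1: "of_nat p dvd (f ^ (p ^ k)) ^ p - ?g ^ p" by (rule dvd_trans)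
  have d2: "of_nat p dvd ?g ^ p - pcompose ?g (Polynomial.monom 1 p)" by (rule poly_frobenius[OF assms])
  have "pcompose (Polynomial.monom 1 (p ^ k)) (Polynomial.monom 1 p) = (Polynomial.monom 1 (p ^ Suc k) :: int poly)"
    by (simp add: Polynomial.monom_altdef pcompose_hom.hom_power pcompose_pCons flip: power_mult)
  then have "pcompose ?g (Polynomial.monom 1 p) = pcompose f (Polynomial.monom 1 (p ^ Suc k))"
    by (simp flip: pcompose_assoc)
  with dvd_add[OF d1 d2] show ?case by (simp add: mult.commute flip: power_mult)
qed

text \<open>Multiplication by the value r of u at z maps each of 1, z, ..., z^(m-1) to an integer
  combination of these powers, exponents being read modulo m. Hence r is an eigenvalue of the
  integer matrix \<open>C\<close> and a root of its monic characteristic polynomial. The powers may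
  repeat when z has smaller order; the eigenvector \<open>w\<close> is nonzero anyway, as its first
  entry is 1.\<close>

lemma int_combination_roots_of_unity_algebraic_int:
  fixes z :: complex and u :: "int poly"
  assumes "z ^ m = 1" "m > 0"
  shows "algebraic_int (poly (of_int_poly u) z)"
proof -
  define r where "r = poly (of_int_poly u) z"
  define C where "C = mat m m (\<lambda>(i, j). \<Sum>l\<le>Polynomial.degree u. if (i + l) mod m = j then Polynomial.coeff u l else 0)"
  define w where "w = vec m (\<lambda>j. z ^ j)"
  have C: "C \<in> carrier_mat m m" by (simp add: C_def)
  have zmod: "z ^ n = z ^ (n mod m)" for n
    by (metis assms(1) div_mult_mod_eq mult.commute mult_1 power_add power_mult power_one)
  have r: "r = (\<Sum>l\<le>Polynomial.degree u. of_int (Polynomial.coeff u l) * z ^ l)"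
    by (simp add: r_def poly_altdef)
  have "of_int_hom.mat_hom C *\<^sub>v w = r \<cdot>\<^sub>v w"
  proof (rule eq_vecI)
    show "dim_vec (of_int_hom.mat_hom C *\<^sub>v w) = dim_vec (r \<cdot>\<^sub>v w)" by (simp add: C_def w_def)
    fix i assume "i < dim_vec (r \<cdot>\<^sub>v w)"
    then have i: "i < m" by (simp add: w_def)
    have "(of_int_hom.mat_hom C *\<^sub>v w) $ i = (\<Sum>j<m. of_int (C $$ (i, j)) * z ^ j)"
      using i by (simp add: C_def w_def scalar_prod_def lessThan_atLeast0)
    also have "\<dots> = (\<Sum>j<m. \<Sum>l\<le>Polynomial.degree u. if (i + l) mod m = j then of_int (Polynomial.coeff u l) * z ^ j else 0)"
      using i by (intro sum.cong refl) (auto simp: C_def sum_distrib_right intro!: sum.cong)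
    also have "\<dots> = (\<Sum>l\<le>Polynomial.degree u. \<Sum>j<m. if (i + l) mod m = j then of_int (Polynomial.coeff u l) * z ^ j else 0)"
      by (rule sum.swap)
    also have "\<dots> = (\<Sum>l\<le>Polynomial.degree u. of_int (Polynomial.coeff u l) * z ^ ((i + l) mod m))"
      using assms(2) by (intro sum.cong refl) simp
    also have "\<dots> = (\<Sum>l\<le>Polynomial.degree u. of_int (Polynomial.coeff u l) * z ^ (i + l))"
      by (simp flip: zmod)
    also have "\<dots> = r * z ^ i" unfolding r by (simp add: sum_distrib_right sum_distrib_left power_add mult_ac)
    finally show "(of_int_hom.mat_hom C *\<^sub>v w) $ i = (r \<cdot>\<^sub>v w) $ i" using i by (simp add: w_def)
  qed
  moreover have "w \<noteq> 0\<^sub>v m"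
  proof
    assume "w = 0\<^sub>v m"
    then have "w $ 0 = 0" using assms(2) by simp
    then show False using assms(2) by (simp add: w_def)
  qed
  ultimately have "eigenvalue (of_int_hom.mat_hom C) r"
    unfolding eigenvalue_def eigenvector_def using C by (intro exI[of _ w]) (auto simp: w_def)
  then have "poly (of_int_poly (char_poly C)) r = 0"
    using eigenvalue_root_char_poly[of "of_int_hom.mat_hom C" m r] C
    by (simp add: of_int_hom.char_poly_hom[OF C])
  moreover have "monic (char_poly C)" using degree_monic_char_poly[OF C] by simp
  ultimately show ?thesis unfolding r_def algebraic_int_altdef_ipoly by blast
qed

text \<open>At z the Frobenius congruence reads \<open>- poly f 1\<close> = p u(z) for an integer
  polynomial u. Thus u(z) is both rational and an algebraic integer, hence an ordinary integer. No
  ideal theory of cyclotomic integers is involved.\<close>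

lemma int_poly_prime_dvd_at_one:
  fixes z :: complex and f :: "int poly"
  assumes "prime p" "z ^ (p ^ k) = 1" "poly (of_int_poly f) z = 0"
  shows "int p dvd poly f 1"
proof -
  from poly_frobenius_power[OF assms(1), of f k] obtain u
    where u: "f ^ (p ^ k) - pcompose f (Polynomial.monom 1 (p ^ k)) = of_nat p * u" by (elim dvdE)
  have p0: "p > 0" using assms(1) by (rule prime_gt_0_nat)
  have "poly (of_int_poly (f ^ (p ^ k) - pcompose f (Polynomial.monom 1 (p ^ k)))) z =
        poly (of_int_poly f) z ^ (p ^ k) - poly (of_int_poly f) (z ^ (p ^ k))"
    by (simp add: of_int_poly_hom.hom_minus of_int_poly_hom.hom_power of_int_hom.map_poly_pcompose
        poly_pcompose poly_monom)
  also have "\<dots> = - of_int (poly f 1)"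
    using p0 unfolding assms(2,3) by (simp add: zero_power)
  finally have e: "of_nat p * poly (of_int_poly u) z = - of_int (poly f 1)"
    unfolding u by (simp add: of_int_poly_hom.hom_mult of_nat_poly of_int_hom.map_poly_hom_smult)
  then have "poly (of_int_poly u) z = - of_int (poly f 1) / of_nat p"
    using p0 by (simp add: field_simps)
  then have "poly (of_int_poly u) z \<in> \<rat>" by simp
  moreover have "algebraic_int (poly (of_int_poly u) z)"
    using int_combination_roots_of_unity_algebraic_int[OF assms(2)] p0 by simp
  ultimately have "poly (of_int_poly u) z \<in> \<int>" by (simp add: rational_algebraic_int_is_int)
  then obtain b where "poly (of_int_poly u) z = of_int b" by (elim Ints_cases)
  with e have "of_int (int p * b) = (of_int (- poly f 1) :: complex)" by simp
  then have "int p * b = - poly f 1" by (simp only: of_int_eq_iff)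
  then show ?thesis by (metis dvd_minus_iff dvd_triv_left)
qed

lemma rat_poly_common_denominator:
  fixes g :: "rat poly"
  shows "\<exists>c g1. c > 0 \<and> Polynomial.smult (of_int c) g = of_int_poly g1"
proof (induction g)
  case 0
  have "Polynomial.smult (of_int 1) 0 = (of_int_poly 0 :: rat poly)" by simp
  then show ?case by (intro exI[of _ 1] exI[of _ 0]) auto
next
  case (pCons a g)
  then obtain c g1 where c: "c > 0" "Polynomial.smult (of_int c) g = of_int_poly g1" by blast
  obtain x y where xy: "quotient_of a = (x, y)" by fastforce
  have y: "y > 0" using quotient_of_denom_pos[OF xy] .
  have a: "a = of_int x / of_int y" using quotient_of_div[OF xy] .
  have "Polynomial.smult (of_int (c * y)) (pCons a g) =
     pCons (of_int (c * x)) (Polynomial.smult (of_int y) (Polynomial.smult (of_int c) g))"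
    using y by (simp add: a mult.commute)
  also have "\<dots> = of_int_poly (pCons (c * x) (Polynomial.smult y g1))"
    unfolding c(2) by (simp add: of_int_hom.map_poly_hom_smult of_int_hom.map_poly_pCons_hom)
  finally show ?case using c(1) y by (intro exI[of _ "c * y"]) auto
qed

text \<open>If the conclusion failed, the cyclotomic polynomial would split as g h with g(z) = 0 and
  h(w) = 0; both g(1) and h(1) are then divisible by p, whereas its value at 1 is p.\<close>
lemma primitive_roots_conjugate_int:
  fixes z w :: complex and f :: "int poly"
  assumes p: "prime p" and k: "k > 0"
    and z: "z ^ (p ^ k) = 1" "z ^ (p ^ (k - 1)) \<noteq> 1"
    and w: "w ^ (p ^ k) = 1" "w ^ (p ^ (k - 1)) \<noteq> 1"
    and f: "poly (of_int_poly f) z = 0"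
  shows "poly (of_int_poly f) w = 0"
proof (rule ccontr)
  assume fw: "poly (of_int_poly f) w \<noteq> 0"
  define q where "q = p ^ (k - 1)"
  have pk: "p ^ k = q * p" using power_minus_mult[OF k, of p] by (simp add: q_def)
  \<comment> \<open>A geometric series with p terms in x^q, equal to (x^(p^k) - 1) / (x^q - 1): this
    is the cyclotomic polynomial in a form that shows its value p at 1.\<close>
  define Phi where "Phi = (\<Sum>i<p. Polynomial.monom (1::int) (q * i))"
  have ev: "poly (of_int_poly Phi) x = (\<Sum>i<p. (x ^ q) ^ i)" for x :: complex
    by (simp add: Phi_def of_int_poly_hom.hom_sum poly_sum poly_monom power_mult)
  have Phi0: "poly (of_int_poly Phi) x = 0" if "x ^ (p ^ k) = 1" "x ^ q \<noteq> 1" for x :: complex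
    using that unfolding ev by (subst geometric_sum) (auto simp: pk simp flip: power_mult)
  have Phi1: "poly Phi 1 = int p" by (simp add: Phi_def poly_sum poly_monom)
  let ?ev = "\<lambda>f x. poly (map_poly of_rat f) (x::complex)"
  have evi: "?ev (of_int_poly f) x = poly (of_int_poly f) x" for f x
    by (simp add: map_poly_map_poly o_def)
  define F :: "rat poly" where "F = of_int_poly f"
  define P :: "rat poly" where "P = of_int_poly Phi"
  define g where "g = gcd F P"
  obtain s t where st: "s * F + t * P = g" unfolding g_def using bezout_coefficients_fst_snd by blast
  have gz: "?ev g z = 0"
    unfolding st[symmetric] using f z Phi0[of z]
    by (simp add: of_rat_poly_hom.hom_add of_rat_poly_hom.hom_mult F_def P_def evi q_def)
  have gw: "?ev g w \<noteq> 0"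
  proof
    assume "?ev g w = 0"
    moreover have "g dvd F" by (simp add: g_def)
    ultimately have "?ev F w = 0" by (auto elim!: dvdE simp: of_rat_poly_hom.hom_mult)
    with fw show False by (simp add: F_def evi)
  qed
  obtain h where h: "P = g * h" using gcd_dvd2[of F P] unfolding g_def by (elim dvdE)
  have hw: "?ev h w = 0"
  proof -
    have "?ev P w = 0" using Phi0[of w] w by (simp add: P_def evi q_def)
    then show ?thesis using gw by (simp add: h of_rat_poly_hom.hom_mult)
  qed
  \<comment> \<open>The gcd splits \<open>Phi\<close> over the rationals only. Clearing denominators
    leaves an integer multiplier n, and taking n minimal replaces Gauss's lemma: p^2 divides n p,
    the value at 1, so p divides n; being prime, the constant p then divides one of the two factors,
    and cancelling it gives a smaller n.\<close>
  define split where "split = (\<lambda>n g1 h1. Polynomial.smult (int n) Phi = g1 * h1 \<and>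
      poly (of_int_poly g1) z = 0 \<and> poly (of_int_poly h1) w = 0)"
  have "\<exists>n. n > 0 \<and> (\<exists>g1 h1. split n g1 h1)"
  proof -
    obtain c g1 where c: "c > 0" "Polynomial.smult (of_int c) g = of_int_poly g1"
      using rat_poly_common_denominator by blast
    obtain d h1 where d: "d > 0" "Polynomial.smult (of_int d) h = of_int_poly h1"
      using rat_poly_common_denominator by blast
    have "(of_int_poly (Polynomial.smult (c * d) Phi) :: rat poly) = of_int_poly (g1 * h1)"
      unfolding of_int_poly_hom.hom_mult c(2)[symmetric] d(2)[symmetric]
      by (simp add: of_int_hom.map_poly_hom_smult h[unfolded P_def] mult.commute)
    then have "Polynomial.smult (c * d) Phi = g1 * h1" by (simp only: of_int_poly_hom.eq_iff)
    moreover have "poly (of_int_poly g1) z = 0"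
      unfolding evi[symmetric] c(2)[symmetric] using gz by (simp add: of_rat_hom.map_poly_hom_smult)
    moreover have "poly (of_int_poly h1) w = 0"
      unfolding evi[symmetric] d(2)[symmetric] using hw by (simp add: of_rat_hom.map_poly_hom_smult)
    ultimately have "split (nat (c * d)) g1 h1" using c(1) d(1) by (simp add: split_def)
    then show ?thesis using c(1) d(1) by (intro exI[of _ "nat (c * d)"]) auto
  qed
  then obtain n where n: "n > 0" "\<exists>g1 h1. split n g1 h1"
    and least: "\<And>n'. n' < n \<Longrightarrow> \<not> (n' > 0 \<and> (\<exists>g1 h1. split n' g1 h1))"
    using exists_least_iff[of "\<lambda>n. n > 0 \<and> (\<exists>g1 h1. split n g1 h1)"] by blast
  then obtain g1 h1 where gh: "Polynomial.smult (int n) Phi = g1 * h1"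
      "poly (of_int_poly g1) z = 0" "poly (of_int_poly h1) w = 0" unfolding split_def by blast
  have "int p * int p dvd poly g1 1 * poly h1 1"
    using int_poly_prime_dvd_at_one[OF p z(1) gh(2)] int_poly_prime_dvd_at_one[OF p w(1) gh(3)]
    by (rule mult_dvd_mono)
  also have "poly g1 1 * poly h1 1 = int n * int p"
    using arg_cong[OF gh(1), of "\<lambda>u. poly u 1"] by (simp add: Phi1)
  finally have "int p dvd int n" using prime_gt_0_nat[OF p] by simp
  then obtain n' where n': "n = p * n'" by (auto elim: dvdE)
  have n'pos: "0 < n'" "n' < n" using n(1) prime_gt_1_nat[OF p] by (auto simp: n')
  have cancel: "A = B" if "Polynomial.smult (int p) A = Polynomial.smult (int p) B" for A B
    using that smult_diff_right[of "int p" A B] prime_gt_0_nat[OF p] by simp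
  have "prime_elem (int p)" using p by simp
  then have "prime_elem [:int p:]" by (rule lift_prime_elem_poly)
  moreover have "[:int p:] dvd g1 * h1"
    unfolding gh(1)[symmetric] by (intro dvdI[of _ _ "Polynomial.smult (int n') Phi"]) (simp add: n' mult.commute)
  ultimately consider "[:int p:] dvd g1" | "[:int p:] dvd h1" by (auto simp: prime_elem_dvd_mult_iff)
  then show False
  proof cases
    case 1
    then obtain g2 where g2: "g1 = Polynomial.smult (int p) g2" by (auto elim: dvdE)
    have "Polynomial.smult (int p) (Polynomial.smult (int n') Phi) = Polynomial.smult (int p) (g2 * h1)"
      using gh(1) by (simp add: n' g2)
    from cancel[OF this] have "split n' g2 h1"
      using gh(2,3) prime_gt_0_nat[OF p] by (simp add: split_def g2 of_int_hom.map_poly_hom_smult)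
    with least[OF n'pos(2)] n'pos(1) show False by blast
  next
    case 2
    then obtain h2 where h2: "h1 = Polynomial.smult (int p) h2" by (auto elim: dvdE)
    have "Polynomial.smult (int p) (Polynomial.smult (int n') Phi) = Polynomial.smult (int p) (g1 * h2)"
      using gh(1) by (simp add: n' h2)
    from cancel[OF this] have "split n' g1 h2"
      using gh(2,3) prime_gt_0_nat[OF p] by (simp add: split_def h2 of_int_hom.map_poly_hom_smult)
    with least[OF n'pos(2)] n'pos(1) show False by blast
  qed
qed

lemma primitive_roots_conjugate:
  fixes z w :: complex and f :: "rat poly"
  assumes "prime p" "k > 0"
    and "z ^ (p ^ k) = 1" "z ^ (p ^ (k - 1)) \<noteq> 1"
    and "w ^ (p ^ k) = 1" "w ^ (p ^ (k - 1)) \<noteq> 1"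
    and f: "poly (map_poly of_rat f) z = 0"
  shows "poly (map_poly of_rat f) w = 0"
proof -
  obtain c g where c: "c > 0" "Polynomial.smult (of_int c) f = of_int_poly g"
    using rat_poly_common_denominator by blast
  have g: "poly (of_int_poly g) x = of_int c * poly (map_poly of_rat f) x" for x :: complex
    using arg_cong[OF c(2), of "\<lambda>u. poly (map_poly of_rat u) x"]
    by (simp add: map_poly_map_poly o_def of_rat_hom.map_poly_hom_smult)
  have "poly (of_int_poly g) w = 0"
    by (rule primitive_roots_conjugate_int[OF assms(1-6)]) (simp add: g f)
  then show ?thesis using c(1) by (simp add: g)
qed

section \<open>Subfields of the complex numbers and the field generated by an algebraic
  number\<close>

abbreviation rpoly :: "rat poly \<Rightarrow> complex \<Rightarrow> complex" where
  "rpoly f z \<equiv> poly (map_poly of_rat f) z"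

lemma is_subfield_C_gen_subfield: "is_subfield_C (gen_subfield S)"
  unfolding gen_subfield_def is_subfield_C_def by blast

lemma gen_subfield_superset: "S \<subseteq> gen_subfield S"
  unfolding gen_subfield_def by blast

lemma gen_subfield_least: "is_subfield_C K \<Longrightarrow> S \<subseteq> K \<Longrightarrow> gen_subfield S \<subseteq> K"
  unfolding gen_subfield_def by blast

lemma is_subfield_CD:
  assumes "is_subfield_C K"
  shows "0 \<in> K" "1 \<in> K" "\<And>x y. x \<in> K \<Longrightarrow> y \<in> K \<Longrightarrow> x + y \<in> K"
    "\<And>x y. x \<in> K \<Longrightarrow> y \<in> K \<Longrightarrow> x * y \<in> K" "\<And>x. x \<in> K \<Longrightarrow> - x \<in> K"
    "\<And>x. x \<in> K \<Longrightarrow> inverse x \<in> K" "\<And>x y. x \<in> K \<Longrightarrow> y \<in> K \<Longrightarrow> x / y \<in> K"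
    "\<And>x y. x \<in> K \<Longrightarrow> y \<in> K \<Longrightarrow> x - y \<in> K"
proof -
  note D = assms[unfolded is_subfield_C_def]
  show 1: "0 \<in> K" "1 \<in> K" "\<And>x y. x \<in> K \<Longrightarrow> y \<in> K \<Longrightarrow> x + y \<in> K"
    "\<And>x y. x \<in> K \<Longrightarrow> y \<in> K \<Longrightarrow> x * y \<in> K" "\<And>x. x \<in> K \<Longrightarrow> - x \<in> K"
    "\<And>x. x \<in> K \<Longrightarrow> inverse x \<in> K" using D by blast+
  show "x / y \<in> K" "x - y \<in> K" if "x \<in> K" "y \<in> K" for x y
    using that 1(4)[of x "inverse y"] 1(3)[of x "- y"] 1(5,6) by (simp_all add: divide_inverse)
qed

lemma subfield_sum:
  assumes "is_subfield_C K" "\<And>i. i \<in> I \<Longrightarrow> f i \<in> K"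
  shows "sum f I \<in> K"
  using assms(2) by (induction I rule: infinite_finite_induct) (auto intro: is_subfield_CD[OF assms(1)])

lemma subfield_power:
  assumes "is_subfield_C K" "x \<in> K"
  shows "x ^ n \<in> K"
  by (induction n) (auto intro: is_subfield_CD[OF assms(1)] assms(2))

lemma subfield_of_nat: "is_subfield_C K \<Longrightarrow> of_nat n \<in> K"
  by (induction n) (auto intro: is_subfield_CD)

lemma subfield_of_int: "is_subfield_C K \<Longrightarrow> of_int n \<in> K"
  by (metis int_cases2 of_int_minus of_int_of_nat_eq is_subfield_CD(5) subfield_of_nat)

lemma subfield_of_rat:
  assumes "is_subfield_C K"
  shows "of_rat q \<in> K"
proof -
  obtain a b where "q = of_int a / of_int b"
    by (metis quotient_of_div surj_pair)
  then show ?thesis using assms by (auto simp: of_rat_divide intro: is_subfield_CD subfield_of_int)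
qed

lemma subfield_rpoly:
  assumes "is_subfield_C K" "z \<in> K"
  shows "rpoly f z \<in> K"
  unfolding poly_altdef
  by (auto intro!: subfield_sum[OF assms(1)] is_subfield_CD[OF assms(1)] subfield_power assms subfield_of_rat)

lemma rpoly_ring:
  "rpoly (f + g) z = rpoly f z + rpoly g z" "rpoly (f * g) z = rpoly f z * rpoly g z"
  "rpoly (- f) z = - rpoly f z" "rpoly 1 z = 1" "rpoly 0 z = 0" "rpoly (f - g) z = rpoly f z - rpoly g z"
  "rpoly (Polynomial.monom 1 n) z = z ^ n" "rpoly [:q:] z = of_rat q"
  by (simp_all add: of_rat_poly_hom.hom_add of_rat_poly_hom.hom_mult of_rat_poly_hom.hom_uminus
      of_rat_poly_hom.hom_minus of_rat_hom.map_poly_hom_monom of_rat_hom.map_poly_pCons_hom poly_monom)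

text \<open>Let m be a nonzero annihilating polynomial of least degree. The gcd of f and m does not
  vanish at z, so its cofactor in m does; by minimality the gcd is constant, and the Bezout identity
  yields the inverse.\<close>

lemma rpoly_inverse:
  assumes alg: "rpoly q z = 0" "q \<noteq> 0" and nz: "rpoly f z \<noteq> 0"
  shows "\<exists>g. inverse (rpoly f z) = rpoly g z"
proof -
  obtain n where "\<exists>q. q \<noteq> 0 \<and> rpoly q z = 0 \<and> Polynomial.degree q = n"
    and least: "\<And>k. k < n \<Longrightarrow> \<not> (\<exists>q. q \<noteq> 0 \<and> rpoly q z = 0 \<and> Polynomial.degree q = k)"
    using alg exists_least_iff[of "\<lambda>n. \<exists>q. q \<noteq> 0 \<and> rpoly q z = 0 \<and> Polynomial.degree q = n"] by blast
  then obtain m where m: "m \<noteq> 0" "rpoly m z = 0" "Polynomial.degree m = n" by blast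
  define g where "g = gcd f m"
  obtain s t where st: "s * f + t * m = g" unfolding g_def using bezout_coefficients_fst_snd by blast
  obtain h where h: "m = g * h" using gcd_dvd2[of f m] unfolding g_def by (elim dvdE)
  have "rpoly g z \<noteq> 0"
    using nz gcd_dvd1[of f m] unfolding g_def[symmetric] by (auto elim!: dvdE simp: rpoly_ring)
  then have "rpoly h z = 0" using m(2) by (simp add: h rpoly_ring)
  moreover have gh: "g \<noteq> 0" "h \<noteq> 0" using m(1) h by auto
  ultimately have "Polynomial.degree h \<ge> n" using least by (metis not_le)
  then have "Polynomial.degree g = 0" using degree_mult_eq[OF gh] m(3) h by simp
  then obtain a where a: "g = [:a:]" by (auto elim: degree_eq_zeroE)
  have "rpoly s z * rpoly f z = of_rat a"
    using arg_cong[OF st, of "\<lambda>u. rpoly u z"] by (simp add: rpoly_ring m(2) a)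
  moreover have "a \<noteq> 0" using gh(1) a by simp
  ultimately have "rpoly ([:inverse a:] * s) z * rpoly f z = 1"
    unfolding rpoly_ring mult.assoc by (simp add: of_rat_inverse)
  then show ?thesis by (metis inverse_unique mult.commute)
qed

lemma gen_subfield_algebraic:
  assumes "rpoly q z = 0" "q \<noteq> 0"
  shows "gen_subfield {z} = range (\<lambda>f. rpoly f z)"
proof
  have "is_subfield_C (range (\<lambda>f. rpoly f z))"
    unfolding is_subfield_C_def
  proof (intro conjI ballI)
    show "0 \<in> range (\<lambda>f. rpoly f z)" by (rule range_eqI[of _ _ 0]) (simp add: rpoly_ring)
    show "1 \<in> range (\<lambda>f. rpoly f z)" by (rule range_eqI[of _ _ 1]) (simp add: rpoly_ring)
    fix x assume "x \<in> range (\<lambda>f. rpoly f z)"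
    then obtain f where f: "x = rpoly f z" by blast
    show "- x \<in> range (\<lambda>f. rpoly f z)" unfolding f rpoly_ring(3)[symmetric] by (rule rangeI)
    show "inverse x \<in> range (\<lambda>f. rpoly f z)"
    proof (cases "x = 0")
      case True
      then show ?thesis by (intro range_eqI[of _ _ 0]) (simp add: rpoly_ring)
    next
      case False
      then obtain g where "inverse x = rpoly g z" using rpoly_inverse[OF assms, of f] f by blast
      then show ?thesis by (rule range_eqI)
    qed
    fix y assume "y \<in> range (\<lambda>f. rpoly f z)"
    then obtain g where g: "y = rpoly g z" by blast
    show "x + y \<in> range (\<lambda>f. rpoly f z)" unfolding f g rpoly_ring(1)[symmetric] by (rule rangeI)
    show "x * y \<in> range (\<lambda>f. rpoly f z)" unfolding f g rpoly_ring(2)[symmetric] by (rule rangeI)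
  qed
  moreover have "z \<in> range (\<lambda>f. rpoly f z)"
    by (rule range_eqI[of _ _ "Polynomial.monom 1 1"]) (simp add: rpoly_ring poly_monom)
  ultimately show "gen_subfield {z} \<subseteq> range (\<lambda>f. rpoly f z)"
    by (intro gen_subfield_least) auto
  show "range (\<lambda>f. rpoly f z) \<subseteq> gen_subfield {z}"
    using gen_subfield_superset[of "{z}"] by (auto intro: subfield_rpoly is_subfield_C_gen_subfield)
qed

lemma gen_subfield_root_of_unity:
  assumes "z ^ m = 1" "m > 0"
  shows "gen_subfield {z} = range (\<lambda>f. rpoly f z)"
proof (rule gen_subfield_algebraic)
  show "rpoly (Polynomial.monom 1 m - 1) z = 0" unfolding rpoly_ring assms(1) by simp
  show "Polynomial.monom 1 m - 1 \<noteq> (0 :: rat poly)"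
  proof
    assume "Polynomial.monom 1 m - 1 = (0 :: rat poly)"
    then have "Polynomial.degree (Polynomial.monom (1::rat) m) = Polynomial.degree (1 :: rat poly)" by simp
    then show False using assms(2) by (simp add: degree_monom_eq)
  qed
qed

text \<open>For k > 0 these are the primitive p^k-th roots of unity; for k = 0 the truncated subtraction
  makes the set empty.\<close>
definition prim_roots :: "nat \<Rightarrow> nat \<Rightarrow> complex set" where
  "prim_roots p k = {w. w ^ (p ^ k) = 1 \<and> w ^ (p ^ (k - 1)) \<noteq> 1}"

section \<open>Roots of unity of prime power order and Ramanujan sums\<close>

lemma finite_roots_unity': "n > 0 \<Longrightarrow> finite {z::complex. z ^ n = 1}"
  using card_roots_unity_eq[of n] card.infinite by fastforce

text \<open>If z^n = 1, then z^g = 1 for g = gcd(n, p^k), a power of p, and z^(p^(k-1)) \<noteq> 1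
  forces g = p^k. So the powers z^j with j < p^k are distinct, and there are as many of them as
  there are \<open>p ^ k\<close>-th roots of unity.\<close>

lemma roots_unity_generated:
  assumes p: "prime p" and z: "z \<in> prim_roots p k" and x: "x ^ (p ^ k) = 1"
  shows "\<exists>j. x = z ^ j"
proof -
  have p0: "p > 0" using p by (rule prime_gt_0_nat)
  have z1: "z ^ (p ^ k) = 1" "z ^ (p ^ (k - 1)) \<noteq> 1" using z by (auto simp: prim_roots_def)
  have k: "k > 0"  using z1 by (cases k) auto
  have z0: "z \<noteq> 0" using z1 p0 by (auto simp: zero_power)
  have ord: "p ^ k dvd n" if "z ^ n = 1" for n
  proof -
    define g where "g = gcd n (p ^ k)"
    obtain a b where ab: "p ^ k * a = n * b + g"
      using bezout_nat[of "p ^ k" n] p0 by (auto simp: g_def gcd.commute)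
    have "z ^ (p ^ k * a) = z ^ (n * b) * z ^ g" unfolding ab power_add by simp
    then have zg: "z ^ g = 1" using that z1 by (simp add: power_mult)
    obtain i where i: "i \<le> k" "g = p ^ i"
      using divides_primepow_nat[OF p, of g k] by (auto simp: g_def)
    have "i = k"
    proof (rule ccontr)
      assume "i \<noteq> k"
      then have "p ^ (k - 1) = p ^ i * p ^ (k - 1 - i)" using i by (simp flip: power_add)
      then have "z ^ (p ^ (k - 1)) = 1" using zg i by (simp add: power_mult)
      with z1 show False by simp
    qed
    then show ?thesis using i unfolding g_def by (metis gcd_dvd1)
  qed
  have "inj_on (\<lambda>j. z ^ j) {..<p ^ k}"
  proof (rule linorder_inj_onI)
    fix i j assume ij: "i < j" "i \<in> {..<p ^ k}" "j \<in> {..<p ^ k}"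
    show "z ^ i \<noteq> z ^ j"
    proof
      assume "z ^ i = z ^ j"
      then have "z ^ i * z ^ (j - i) = z ^ i * 1"
        using ij by (metis le_add_diff_inverse less_imp_le mult_1_right power_add)
      then have "z ^ (j - i) = 1" using z0 by simp
      then have "p ^ k dvd j - i" by (rule ord)
      then show False using ij by (auto dest: dvd_imp_le)
    qed
  qed auto
  then have "card ((\<lambda>j. z ^ j) ` {..<p ^ k}) = p ^ k" by (simp add: card_image)
  moreover have "(\<lambda>j. z ^ j) ` {..<p ^ k} \<subseteq> {z. z ^ (p ^ k) = 1}"
  proof -
    have "(z ^ j) ^ (p ^ k) = 1" for j by (metis mult.commute power_mult power_one z1(1))
    then show ?thesis by auto
  qed
  ultimately have "(\<lambda>j. z ^ j) ` {..<p ^ k} = {z. z ^ (p ^ k) = 1}"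
    using p0 by (intro card_subset_eq finite_roots_unity') (simp_all add: card_roots_unity_eq)
  then show ?thesis using x by blast
qed

lemma sum_roots_unity_power:
  assumes "n > 0"
  shows "(\<Sum>w | w ^ n = 1. (w::complex) ^ j) = (if n dvd j then of_nat n else 0)"
proof -
  define c where "c = cis (2 * pi / real n)"
  have cj: "cis (2 * pi * real k / real n) = c ^ k" for k by (simp add: c_def DeMoivre mult_ac)
  have "(\<Sum>w | w ^ n = 1. w ^ j) = (\<Sum>k<n. (c ^ k) ^ j)"
    using sum.reindex_bij_betw[OF bij_betw_roots_unity[OF assms], of "\<lambda>w. w ^ j"] by (simp add: cj)
  also have "\<dots> = (\<Sum>k<n. (c ^ j) ^ k)" by (simp add: mult.commute flip: power_mult)
  finally have e: "(\<Sum>w | w ^ n = 1. w ^ j) = (\<Sum>k<n. (c ^ j) ^ k)" .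
  have c1: "c ^ n = 1" using assms by (simp add: c_def DeMoivre)
  show ?thesis
  proof (cases "n dvd j")
    case True
    then have "c ^ j = 1" using c1 by (auto elim!: dvdE simp: power_mult)
    then show ?thesis using True e by simp
  next
    case False
    have "c ^ j \<noteq> 1"
    proof
      assume "c ^ j = 1"
      then have "c ^ (j mod n) = c ^ 0"
        using c1 by (metis div_mult_mod_eq mult.commute mult_1 power_0 power_add power_mult power_one)
      then have "j mod n = 0"
        using bij_betw_roots_unity[OF assms] assms
        by (auto simp: bij_betw_def inj_on_def cj)
      with False show False by (simp add: dvd_eq_mod_eq_0)
    qed
    moreover have "(c ^ j) ^ n = 1" using c1 by (metis mult.commute power_mult power_one)
    ultimately show ?thesis using False e by (simp add: geometric_sum)
  qed
qed

lemma prim_roots_minus: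
  assumes "prime p" "k > 0"
  shows "prim_roots p k = {w. w ^ (p ^ k) = 1} - {w. w ^ (p ^ (k - 1)) = 1}"
    "{w::complex. w ^ (p ^ (k - 1)) = 1} \<subseteq> {w. w ^ (p ^ k) = 1}"
proof -
  have "p ^ k = p ^ (k - 1) * p" using power_minus_mult[OF assms(2), of p] by simp
  then show "{w::complex. w ^ (p ^ (k - 1)) = 1} \<subseteq> {w. w ^ (p ^ k) = 1}"
    by (auto simp: power_mult)
qed (auto simp: prim_roots_def)

text \<open>The primitive roots are the \<open>p ^ k\<close>-th roots of unity without the
  \<open>p ^ (k - 1)\<close>-th ones, so the sum is a difference of two complete power sums.\<close>

lemma ramanujan_sum_prime_power:
  assumes p: "prime p" and k: "k > 0"
  shows "(\<Sum>w\<in>prim_roots p k. w ^ j) =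
    (if p ^ k dvd j then of_nat (p ^ k) else 0) - (if p ^ (k - 1) dvd j then of_nat (p ^ (k - 1)) else 0)"
proof -
  have p0: "p > 0" using p by (rule prime_gt_0_nat)
  show ?thesis
    unfolding prim_roots_minus(1)[OF p k]
    by (subst sum_diff) (use p0 prim_roots_minus(2)[OF p k] in \<open>simp_all add: finite_roots_unity' sum_roots_unity_power\<close>)
qed

section \<open>The Galois group of a cyclotomic field of prime power order\<close>

lemma field_autsD:
  assumes "\<sigma> \<in> field_auts K"
  shows "\<And>x. x \<in> K \<Longrightarrow> \<sigma> x \<in> K" "inj_on \<sigma> K" "\<sigma> 1 = 1"
    "\<And>x y. x \<in> K \<Longrightarrow> y \<in> K \<Longrightarrow> \<sigma> (x + y) = \<sigma> x + \<sigma> y"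
    "\<And>x y. x \<in> K \<Longrightarrow> y \<in> K \<Longrightarrow> \<sigma> (x * y) = \<sigma> x * \<sigma> y"
  using assms unfolding field_auts_def bij_betw_def by auto

lemma field_aut_basic:
  assumes "\<sigma> \<in> field_auts K" "is_subfield_C K"
  shows "\<sigma> 0 = 0" "\<sigma> (of_rat q) = of_rat q"
    "x \<in> K \<Longrightarrow> \<sigma> (x ^ n) = \<sigma> x ^ n"
    "(\<And>i. i \<in> I \<Longrightarrow> f i \<in> K) \<Longrightarrow> \<sigma> (sum f I) = (\<Sum>i\<in>I. \<sigma> (f i))"
proof -
  note D = field_autsD[OF assms(1)] and S = is_subfield_CD[OF assms(2)]
  have "\<sigma> (0 + 0) = \<sigma> 0 + \<sigma> 0" by (intro D S)
  then show s0: "\<sigma> 0 = 0" by simp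
  have nat: "\<sigma> (of_nat n) = of_nat n" for n
    by (induction n) (auto simp: s0 D S subfield_of_nat assms(2))
  have neg: "\<sigma> (- x) = - \<sigma> x" if "x \<in> K" for x
  proof -
    have "\<sigma> (x + - x) = \<sigma> x + \<sigma> (- x)" using that by (intro D S)
    then show ?thesis by (simp add: s0 eq_neg_iff_add_eq_0 add.commute)
  qed
  have int: "\<sigma> (of_int n) = of_int n" for n
    by (cases n) (auto simp: nat neg subfield_of_nat assms(2) simp del: of_nat_Suc)
  obtain a b where "quotient_of q = (a, b)" by fastforce
  then have "q = of_int a / of_int b" and b: "b \<noteq> 0"
    using quotient_of_div quotient_of_denom_pos by fastforce+
  then have ab: "of_rat q * of_int b = (of_int a :: complex)"
    by (metis nonzero_eq_divide_eq of_int_eq_0_iff of_rat_divide of_rat_of_int_eq)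
  have "\<sigma> (of_rat q * of_int b) = \<sigma> (of_rat q) * \<sigma> (of_int b)"
    by (intro D subfield_of_rat subfield_of_int assms(2))
  then have "\<sigma> (of_rat q) * of_int b = of_rat q * of_int b" unfolding ab int by simp
  then show "\<sigma> (of_rat q) = of_rat q" using b by simp
  show "\<sigma> (x ^ n) = \<sigma> x ^ n" if "x \<in> K"
    by (induction n) (auto simp: D that subfield_power assms(2))
  show "\<sigma> (sum f I) = (\<Sum>i\<in>I. \<sigma> (f i))" if "\<And>i. i \<in> I \<Longrightarrow> f i \<in> K"
    using that by (induction I rule: infinite_finite_induct) (auto simp: s0 D subfield_sum assms(2))
qed

lemma field_aut_rpoly:
  assumes "\<sigma> \<in> field_auts K" "is_subfield_C K" "z \<in> K"
  shows "\<sigma> (rpoly f z) = rpoly f (\<sigma> z)"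
proof -
  note D = field_autsD[OF assms(1)] and S = is_subfield_CD[OF assms(2)] and B = field_aut_basic[OF assms(1,2)]
  have t: "of_rat (Polynomial.coeff f i) * z ^ i \<in> K" for i
    by (intro S subfield_of_rat subfield_power assms)
  have "\<sigma> (of_rat (Polynomial.coeff f i) * z ^ i) = of_rat (Polynomial.coeff f i) * \<sigma> z ^ i" for i
    using D(5)[OF subfield_of_rat[OF assms(2)] subfield_power[OF assms(2,3)]] B(2) B(3)[OF assms(3)]
    by simp
  then show ?thesis using B(4)[of "{..Polynomial.degree f}", OF t] by (simp add: poly_altdef)
qed

text \<open>Every element of the field is a rational polynomial in z, so an automorphism is
  determined by the image of z. Conversely, two primitive roots z and w satisfy the same rational
  polynomials, which makes the map from f(z) to f(w) well defined and injective.\<close>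

lemma field_auts_eval_bij:
  assumes p: "prime p" and z: "z \<in> prim_roots p k"
  shows "bij_betw (\<lambda>\<sigma>. \<sigma> z) (field_auts (gen_subfield {z})) (prim_roots p k)"
proof -
  define K where "K = gen_subfield {z}"
  have p0: "p > 0" using p by (rule prime_gt_0_nat)
  have z1: "z ^ (p ^ k) = 1" "z ^ (p ^ (k - 1)) \<noteq> 1" using z by (auto simp: prim_roots_def)
  have k: "k > 0"  using z1 by (cases k) auto
  have sub: "is_subfield_C K" unfolding K_def by (rule is_subfield_C_gen_subfield)
  have zK: "z \<in> K" unfolding K_def using gen_subfield_superset by blast
  have K: "K = range (\<lambda>f. rpoly f z)"
    unfolding K_def using z1(1) p0 by (intro gen_subfield_root_of_unity[of z "p ^ k"]) auto
  show ?thesis unfolding K_def[symmetric] bij_betw_def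
  proof (intro conjI equalityI subsetI)
    show "inj_on (\<lambda>\<sigma>. \<sigma> z) (field_auts K)"
    proof (rule inj_onI)
      fix \<sigma> \<tau> assume a: "\<sigma> \<in> field_auts K" "\<tau> \<in> field_auts K" "\<sigma> z = \<tau> z"
      show "\<sigma> = \<tau>"
      proof
        fix x
        show "\<sigma> x = \<tau> x"
        proof (cases "x \<in> K")
          case True
          then show ?thesis using a by (auto simp: K field_aut_rpoly[OF _ sub zK])
        next
          case False
          then show ?thesis using a by (auto simp: field_auts_def PiE_def extensional_def)
        qed
      qed
    qed
  next
    fix w assume "w \<in> (\<lambda>\<sigma>. \<sigma> z) ` field_auts K"
    then obtain \<sigma> where s: "\<sigma> \<in> field_auts K" "w = \<sigma> z" by blast
    have "w ^ (p ^ k) = 1"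
      using field_aut_basic(3)[OF s(1) sub zK, of "p ^ k"] z1 by (simp add: s field_autsD[OF s(1)])
    moreover have "w ^ (p ^ (k - 1)) \<noteq> 1"
    proof
      assume "w ^ (p ^ (k - 1)) = 1"
      then have "\<sigma> (z ^ (p ^ (k - 1))) = \<sigma> 1"
        using field_aut_basic(3)[OF s(1) sub zK] by (simp add: s field_autsD[OF s(1)])
      then have "z ^ (p ^ (k - 1)) = 1"
        by (rule inj_onD[OF field_autsD(2)[OF s(1)]]) (auto intro: subfield_power sub zK is_subfield_CD)
      with z1 show False by simp
    qed
    ultimately show "w \<in> prim_roots p k" by (simp add: prim_roots_def)
  next
    fix w assume w: "w \<in> prim_roots p k"
    then have w1: "w ^ (p ^ k) = 1" "w ^ (p ^ (k - 1)) \<noteq> 1" by (auto simp: prim_roots_def)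
    obtain a b where ab: "w = z ^ a" "z = w ^ b"
      using roots_unity_generated[OF p z w1(1)] roots_unity_generated[OF p w z1(1)] by blast
    have conj: "rpoly f z = rpoly g z \<longleftrightarrow> rpoly f w = rpoly g w" for f g
      using primitive_roots_conjugate[OF p k z1 w1, of "f - g"]
        primitive_roots_conjugate[OF p k w1 z1, of "f - g"] by (auto simp: rpoly_ring)
    define \<sigma> where "\<sigma> = restrict (\<lambda>x. rpoly (SOME f. rpoly f z = x) w) K"
    have s: "\<sigma> (rpoly f z) = rpoly f w" for f
    proof -
      have "rpoly (SOME g. rpoly g z = rpoly f z) z = rpoly f z" by (rule someI) simp
      then show ?thesis by (simp add: \<sigma>_def K conj)
    qed
    have wK: "w \<in> K" unfolding ab(1) by (intro subfield_power sub zK)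
    have inj: "inj_on \<sigma> K" by (auto intro!: inj_onI simp: K s conj)
    have img: "\<sigma> ` K = K"
    proof
      have "rpoly f w \<in> K" for f using wK by (rule subfield_rpoly[OF sub])
      then have "\<sigma> x \<in> K" if "x \<in> K" for x using that s unfolding K by fastforce
      then show "\<sigma> ` K \<subseteq> K" by blast
      show "K \<subseteq> \<sigma> ` K"
      proof
        fix x assume "x \<in> K"
        then obtain f where f: "x = rpoly f z" by (auto simp: K)
        \<comment> \<open>Surjectivity: since z = w^b, the element f(z) = f(w^b) is the image of
          f(z^b).\<close>
        have "x = rpoly (pcompose f (Polynomial.monom 1 b)) w"
          by (simp add: f ab(2) of_rat_hom.map_poly_pcompose poly_pcompose of_rat_hom.map_poly_hom_monom poly_monom)
        then have "x = \<sigma> (rpoly (pcompose f (Polynomial.monom 1 b)) z)" by (simp only: s)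
        then show "x \<in> \<sigma> ` K" by (rule image_eqI) (simp add: K)
      qed
    qed
    have hom: "\<sigma> (x + y) = \<sigma> x + \<sigma> y \<and> \<sigma> (x * y) = \<sigma> x * \<sigma> y" if xy: "x \<in> K" "y \<in> K" for x y
    proof -
      obtain f g where fg: "x = rpoly f z" "y = rpoly g z" using xy unfolding K by blast
      show ?thesis unfolding fg rpoly_ring(1,2)[symmetric] s by (simp add: rpoly_ring)
    qed
    have "\<sigma> 1 = 1" using s[of 1] by (simp add: rpoly_ring)
    moreover have "\<sigma> \<in> K \<rightarrow>\<^sub>E K" using img by (auto simp: \<sigma>_def)
    ultimately have "\<sigma> \<in> field_auts K"
      using inj img hom unfolding field_auts_def bij_betw_def by simp
    moreover have "\<sigma> z = w" using s[of "Polynomial.monom 1 1"] by (simp add: rpoly_ring poly_monom)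
    ultimately show "w \<in> (\<lambda>\<sigma>. \<sigma> z) ` field_auts K" by blast
  qed
qed

text \<open>This is the trace of x down to the rationals. Writing x = z^j and evaluating the
  automorphisms at z turns it into a Ramanujan sum; divisibility of j by \<open>p ^ k\<close> and
  \<open>p ^ (k - 1)\<close> becomes x = 1 and x^p = 1.\<close>

lemma sum_field_auts_root_of_unity:
  assumes p: "prime p" and z: "z \<in> prim_roots p k" and x: "x ^ (p ^ k) = 1"
  shows "(\<Sum>\<sigma>\<in>field_auts (gen_subfield {z}). \<sigma> x) =
    (if x = 1 then of_nat (p ^ k) else 0) - (if x ^ p = 1 then of_nat (p ^ (k - 1)) else 0)"
proof -
  have p0: "p > 0" using p by (rule prime_gt_0_nat)
  have z1: "z ^ (p ^ k) = 1" "z ^ (p ^ (k - 1)) \<noteq> 1" using z by (auto simp: prim_roots_def)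
  have k: "k > 0"  using z1 by (cases k) auto
  have pk: "p ^ k = p ^ (k - 1) * p" using power_minus_mult[OF k, of p] by simp
  have sub: "is_subfield_C (gen_subfield {z})" by (rule is_subfield_C_gen_subfield)
  have zK: "z \<in> gen_subfield {z}" using gen_subfield_superset by blast
  obtain j where j: "x = z ^ j" using roots_unity_generated[OF p z x] by blast
  have ord: "z ^ n = 1 \<longleftrightarrow> p ^ k dvd n" for n
  proof
    assume zn: "z ^ n = 1"
    \<comment> \<open>All \<open>p ^ k\<close>-th roots of unity are powers of z, so z^n = 1 makes
      the n-th power sum equal to their number; it would be 0 if n were not divisible by
      \<open>p ^ k\<close>.\<close>
    have "(\<Sum>w::complex | w ^ (p ^ k) = 1. w ^ n) = (\<Sum>w::complex | w ^ (p ^ k) = 1. 1)"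
    proof (rule sum.cong)
      fix w :: complex assume "w \<in> {w. w ^ (p ^ k) = 1}"
      then obtain i where "w = z ^ i" using roots_unity_generated[OF p z] by blast
      then show "w ^ n = 1" using zn by (metis mult.commute power_mult power_one)
    qed simp
    then show "p ^ k dvd n"
      using p0 by (auto simp: sum_roots_unity_power card_roots_unity_eq split: if_splits)
  next
    assume "p ^ k dvd n"
    then show "z ^ n = 1" using z1 by (auto elim!: dvdE simp: power_mult)
  qed
  have "(\<Sum>\<sigma>\<in>field_auts (gen_subfield {z}). \<sigma> x) = (\<Sum>\<sigma>\<in>field_auts (gen_subfield {z}). (\<sigma> z) ^ j)"
    unfolding j by (intro sum.cong refl field_aut_basic(3)[OF _ sub zK])
  also have "\<dots> = (\<Sum>w\<in>prim_roots p k. w ^ j)"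
    by (rule sum.reindex_bij_betw[OF field_auts_eval_bij[OF p z]])
  also have "\<dots> = (if x = 1 then of_nat (p ^ k) else 0) - (if x ^ p = 1 then of_nat (p ^ (k - 1)) else 0)"
    unfolding ramanujan_sum_prime_power[OF p k] j ord power_mult[symmetric]
    using p0 by (simp add: pk)
  finally show ?thesis .
qed

lemma cis_prim_root:
  assumes "prime p" "k > 0"
  shows "cis (2 * pi / real (p ^ k)) \<in> prim_roots p k"
proof -
  have p0: "p > 0" and p1: "p > 1" using assms by (auto dest: prime_gt_0_nat prime_gt_1_nat)
  have pk: "p ^ k = p ^ (k - 1) * p" using power_minus_mult[OF assms(2), of p] by simp
  let ?n = "p ^ k"
  have n: "?n > 0" using p0 by simp
  have lt: "p ^ (k - 1) < ?n" using pk p0 p1 by simp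
  have inj: "inj_on (\<lambda>k. cis (2 * pi * real k / real ?n)) {..<?n}"
    using bij_betw_roots_unity[OF n] by (simp add: bij_betw_def)
  have "cis (2 * pi / real ?n) ^ (p ^ (k - 1)) \<noteq> 1"
  proof
    assume "cis (2 * pi / real ?n) ^ (p ^ (k - 1)) = 1"
    then have "cis (2 * pi * real (p ^ (k - 1)) / real ?n) = cis (2 * pi * real 0 / real ?n)"
      by (simp add: DeMoivre mult_ac)
    then have "p ^ (k - 1) = 0" by (rule inj_onD[OF inj]) (use lt n in auto)
    then show False using p0 by simp
  qed
  moreover have "cis (2 * pi / real ?n) ^ ?n = 1" using n by (simp add: DeMoivre)
  ultimately show ?thesis by (simp add: prim_roots_def)
qed

section \<open>Finite p-groups of odd order\<close>

lemma fermat_int_iterate: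
  fixes a :: int
  assumes "prime p"
  shows "[a ^ (p ^ n) = a] (mod int p)"
proof (induction n)
  case (Suc n)
  have "[(a ^ (p ^ n)) ^ p = a ^ (p ^ n)] (mod int p)" by (rule fermat_int[OF assms])
  with Suc show ?case by (metis cong_trans power_Suc2 power_mult)
qed simp

text \<open>Put t = r - 1, so that the sum minus p is t W. As p divides t, W is congruent to p (p -
  1) / 2 modulo p, hence W = p w because p is odd. Then r^p - 1 = t p (1 + t w) with 1 + t w prime
  to p, so \<open>p ^ k\<close> divides t p and with it t W.\<close>

lemma geometric_sum_cong_prime_power:
  fixes r :: int
  assumes p: "prime p" "odd p" and k: "k > 0" and r: "[r ^ p = 1] (mod int p ^ k)"
  shows "[(\<Sum>i<p. r ^ i) = int p] (mod int p ^ k)"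
proof -
  define t where "t = r - 1"
  define W where "W = (\<Sum>i<p. \<Sum>j<i. r ^ j)"
  have pp: "prime (int p)" using p by simp
  have "[r ^ p = 1] (mod int p)"
    using r k by (metis cong_dvd_modulus dvd_power)
  moreover have "[r ^ p = r] (mod int p)" by (rule fermat_int[OF p(1)])
  ultimately have r1: "[r = 1] (mod int p)" by (meson cong_sym cong_trans)
  then have pt: "int p dvd t" by (simp add: t_def cong_iff_dvd_diff)
  have geo: "r ^ i - 1 = t * (\<Sum>j<i. r ^ j)" for i
    by (simp add: t_def power_diff_1_eq)
  have S: "(\<Sum>i<p. r ^ i) - int p = t * W"
    using sum_subtractf[of "\<lambda>i. r ^ i" "\<lambda>_. 1" "{..<p}"] by (simp add: geo W_def sum_distrib_left)
  have "[W = (\<Sum>i<p. \<Sum>j<i. 1)] (mod int p)"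
    unfolding W_def using cong_pow[OF r1] by (intro cong_sum) simp
  also have "(\<Sum>i<p. \<Sum>j<i. 1) = (\<Sum>i<p. int i)" by simp
  finally have "[2 * W = 2 * (\<Sum>i<p. int i)] (mod int p)" by (rule cong_scalar_left)
  also have "2 * (\<Sum>i<p. int i) = int p * (int p - 1)"
    by (induction p) (simp_all add: algebra_simps)
  finally have "int p dvd 2 * W" by (simp add: cong_dvd_iff)
  moreover have "\<not> int p dvd 2"
  proof
    assume "int p dvd 2"
    then have "p dvd 2" by presburger
    then show False using p by (metis dvd_refl primes_dvd_imp_eq two_is_prime_nat)
  qed
  ultimately have "int p dvd W" using pp prime_dvd_multD by blast
  then obtain w where w: "W = int p * w" by (elim dvdE)
  have "int p ^ k dvd r ^ p - 1" using r by (simp add: cong_iff_dvd_diff)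
  also have "r ^ p - 1 = (t * int p) * (1 + t * w)"
    using S unfolding geo w by (simp add: algebra_simps)
  finally have "int p ^ k dvd (t * int p) * (1 + t * w)" .
  moreover have "\<not> int p dvd 1 + t * w"
    using pt pp by (metis dvd_add_times_triv_right_iff dvd_add_left_iff dvd_mult2 not_prime_unit)
  then have "coprime (int p ^ k) (1 + t * w)" using pp by (simp add: prime_imp_coprime)
  ultimately have "int p ^ k dvd t * int p" by (simp add: coprime_dvd_mult_left_iff)
  then have "int p ^ k dvd t * W" unfolding w by (metis dvd_mult2 mult.assoc)
  then show ?thesis unfolding S[symmetric] by (simp add: cong_iff_dvd_diff)
qed

context group
begin

text \<open>The class equation: if only the identity were central, all other conjugacy classes would
  have size divisible by p, and p would divide 1.\<close>

lemma p_group_center_nontrivial: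
  assumes p: "prime p" and ord: "Coset.order G = p ^ n" "n > 0"
  shows "\<exists>z\<in>carrier G. z \<noteq> \<one> \<and> (\<forall>g\<in>carrier G. g \<otimes> z = z \<otimes> g)"
proof (rule ccontr)
  assume none: "\<not> ?thesis"
  define \<phi> where "\<phi> = (\<lambda>g. \<lambda>h\<in>carrier G. g \<otimes> h \<otimes> inv g)"
  interpret conj: group_action G "carrier G" \<phi>
    unfolding \<phi>_def by (rule action_by_conjugation)
  have fin: "finite (carrier G)"
    using ord prime_gt_0_nat[OF p] by (metis card.infinite Coset.order_def power_eq_0_iff less_irrefl)
  let ?O = "orbits G (carrier G) \<phi>"
  have fO: "finite ?O" using fin by (simp add: orbits_def)
  have one: "{\<one>} \<in> ?O"
  proof -
    have "orbit G \<phi> \<one> = {\<one>}" by (auto simp: orbit_def \<phi>_def intro!: exI[of _ \<one>])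
    then show ?thesis unfolding orbits_def by (metis (mono_tags, lifting) mem_Collect_eq one_closed)
  qed
  have "p dvd card X" if X: "X \<in> ?O - {{\<one>}}" for X
  proof -
    obtain x where x: "x \<in> carrier G" "X = orbit G \<phi> x" using X by (auto simp: orbits_def)
    have "card X dvd p ^ n" unfolding x(2) ord(1)[symmetric]
      by (metis conj.orbit_stabilizer_theorem dvd_triv_left x(1))
    then obtain i where i: "card X = p ^ i" using divides_primepow_nat[OF p] by blast
    have "i \<noteq> 0"
    proof
      assume "i = 0"
      then obtain y where "X = {y}" using i by (auto simp: card_1_singleton_iff)
      moreover have "x \<in> X" unfolding x(2) by (rule conj.orbit_refl[OF x(1)])
      ultimately have Xx: "X = {x}" by auto
      have "g \<otimes> x = x \<otimes> g" if g: "g \<in> carrier G" for g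
      proof -
        have "\<phi> g x \<in> X" unfolding x(2) orbit_def using g by blast
        then have "g \<otimes> x \<otimes> inv g = x" using x(1) by (simp add: Xx \<phi>_def)
        then show ?thesis using g x(1) by (metis inv_solve_right m_closed)
      qed
      then have "x = \<one>" using none x(1) by blast
      with X Xx show False by simp
    qed
    then show ?thesis using i by simp
  qed
  then have d1: "p dvd (\<Sum>X\<in>?O - {{\<one>}}. card X)" by (rule dvd_sum)
  have "(\<Sum>X\<in>?O. card X) = card (carrier G)"
    using conj.disjoint_sum[OF fin, of "\<lambda>_. 1::nat"] by simp
  moreover have "(\<Sum>X\<in>?O. card X) = 1 + (\<Sum>X\<in>?O - {{\<one>}}. card X)"
    using sum.remove[OF fO one, of card] by simp
  ultimately have "p ^ n = 1 + (\<Sum>X\<in>?O - {{\<one>}}. card X)" using ord by (simp add: Coset.order_def)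
  moreover have "p dvd p ^ n" using ord(2) by simp
  ultimately have "p dvd 1" using d1 by (metis dvd_add_left_iff)
  then show False using p by (simp add: not_prime_unit)
qed

text \<open>A nontrivial central element of the quotient has order a power of p there; its last
  power outside A is still central modulo A and has its p-th power in A.\<close>

lemma p_group_central_mod_normal:
  assumes p: "prime p" and ord: "Coset.order G = p ^ n" and A: "A \<lhd> G" "A \<noteq> carrier G"
  shows "\<exists>y\<in>carrier G - A. y [^] p \<in> A \<and> (\<forall>g\<in>carrier G. \<exists>a\<in>A. g \<otimes> y = a \<otimes> (y \<otimes> g))"
proof -
  interpret A: normal A G by (rule A(1))
  interpret Q: group "G Mod A" by (rule A.factorgroup_is_group)
  have fin: "finite (carrier G)"
    using ord prime_gt_0_nat[OF p] by (metis card.infinite Coset.order_def power_eq_0_iff less_irrefl)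
  have Asub: "A \<subseteq> carrier G" by (rule A.subset)
  have carr: "carrier (G Mod A) = (\<lambda>x. A #> x) ` carrier G" by (rule carrier_FactGroup)
  have lag: "Coset.order (G Mod A) * card A = p ^ n"
    using lagrange[OF A.is_subgroup] ord by (simp add: FactGroup_def Coset.order_def)
  then have "Coset.order (G Mod A) dvd p ^ n" by (metis dvd_triv_left)
  then obtain j where j: "Coset.order (G Mod A) = p ^ j" using divides_primepow_nat[OF p] by blast
  have "j \<noteq> 0"
  proof
    assume "j = 0"
    then have "card A = card (carrier G)" using lag j ord by (simp add: Coset.order_def)
    then have "A = carrier G" using Asub fin by (simp add: card_subset_eq)
    with A(2) show False by simp
  qed
  then obtain z where z: "z \<in> carrier (G Mod A)" "z \<noteq> A"
      "\<And>g. g \<in> carrier (G Mod A) \<Longrightarrow> g \<otimes>\<^bsub>G Mod A\<^esub> z = z \<otimes>\<^bsub>G Mod A\<^esub> g"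
    using Q.p_group_center_nontrivial[OF p j] by auto
  then obtain x where x: "x \<in> carrier G" "z = A #> x" by (auto simp: carr)
  have xA: "x \<notin> A" using z(2) x A.rcos_const by auto
  have "x [^] (p ^ n) = \<one>" using x(1) ord pow_order_eq_1 by simp
  then have ex: "\<exists>i. x [^] (p ^ i) \<in> A" using A.one_closed by metis
  define i where "i = (LEAST i. x [^] (p ^ i) \<in> A)"
  have i: "x [^] (p ^ i) \<in> A" unfolding i_def using ex by (rule LeastI_ex)
  have i0: "i \<noteq> 0" using i xA x(1) by (metis nat_pow_eone power_0)
  define y where "y = x [^] (p ^ (i - 1))"
  have yc: "y \<in> carrier G" using x by (simp add: y_def)
  have "y \<notin> A" unfolding y_def using i0 not_less_Least[of "i - 1" "\<lambda>i. x [^] (p ^ i) \<in> A"]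
    by (simp add: i_def)
  moreover have "y [^] p \<in> A"
    using i i0 x(1) by (simp add: y_def nat_pow_pow power_minus_mult flip: power_Suc2)
  moreover have "\<exists>a\<in>A. g \<otimes> y = a \<otimes> (y \<otimes> g)" if g: "g \<in> carrier G" for g
  proof -
    have gA: "A #> g \<in> carrier (G Mod A)" using g by (simp add: carr)
    have zy: "A #> y = z [^]\<^bsub>G Mod A\<^esub> (p ^ (i - 1))"
      using x A.FactGroup_pow[of x "p ^ (i - 1)"] by (simp add: y_def)
    have "(A #> g) \<otimes>\<^bsub>G Mod A\<^esub> (A #> y) = (A #> y) \<otimes>\<^bsub>G Mod A\<^esub> (A #> g)"
      unfolding zy using Q.group_commutes_pow[OF z(3)[OF gA, symmetric] z(1) gA] by simp
    then have "A #> (g \<otimes> y) = A #> (y \<otimes> g)" using g yc by (simp add: A.rcos_sum)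
    moreover have "g \<otimes> y \<in> A #> (g \<otimes> y)" using g yc rcos_self[OF _ A.is_subgroup] by simp
    ultimately show ?thesis unfolding r_coset_def by auto
  qed
  ultimately show ?thesis using yc by blast
qed

lemma twisted_pow_right:
  assumes "g \<in> carrier G" "a \<in> carrier G" "g \<otimes> a = a [^] (r::nat) \<otimes> g"
  shows "g \<otimes> a [^] (i::nat) = a [^] (r * i) \<otimes> g"
proof (induction i)
  case (Suc i)
  have "g \<otimes> a [^] Suc i = (g \<otimes> a [^] i) \<otimes> a" using assms by (simp add: m_assoc)
  also have "\<dots> = a [^] (r * i) \<otimes> (g \<otimes> a)" unfolding Suc using assms(1,2) by (simp add: m_assoc)
  also have "\<dots> = a [^] (r * i) \<otimes> a [^] r \<otimes> g" unfolding assms(3) using assms(1,2) by (simp add: m_assoc)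
  also have "\<dots> = a [^] (r * Suc i) \<otimes> g" using assms(1,2) by (simp add: nat_pow_mult add.commute)
  finally show ?case .
qed (use assms in simp)

lemma twisted_pow_left:
  assumes "g \<in> carrier G" "a \<in> carrier G" "g \<otimes> a = a [^] (r::nat) \<otimes> g"
  shows "g [^] (j::nat) \<otimes> a = a [^] (r ^ j) \<otimes> g [^] j"
proof (induction j)
  case (Suc j)
  have "g [^] Suc j \<otimes> a = g [^] j \<otimes> (g \<otimes> a)" using assms by (simp add: m_assoc)
  also have "\<dots> = (g [^] j \<otimes> a [^] r) \<otimes> g" unfolding assms(3) using assms(1,2) by (simp add: m_assoc)
  also have "g [^] j \<otimes> a [^] r = a [^] (r ^ j * r) \<otimes> g [^] j"
    by (rule twisted_pow_right[OF _ assms(2) Suc]) (use assms in simp)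
  finally show ?case using assms(1,2) by (simp add: m_assoc mult.commute)
qed (use assms in simp)

text \<open>Moving all factors y to the right past the factors c collects the exponents 1, r, ...,
  r^(j-1) on c. This is how the geometric sum enters the group theory.\<close>

lemma twisted_prod_pow:
  assumes "y \<in> carrier G" "c \<in> carrier G" "y \<otimes> c = c [^] (r::nat) \<otimes> y"
  shows "(c \<otimes> y) [^] (j::nat) = c [^] (\<Sum>i<j. r ^ i) \<otimes> y [^] j"
proof (induction j)
  case (Suc j)
  have "(c \<otimes> y) [^] Suc j = c [^] (\<Sum>i<j. r ^ i) \<otimes> (y [^] j \<otimes> c) \<otimes> y"
    using Suc assms(1,2) by (simp add: m_assoc)
  also have "\<dots> = (c [^] (\<Sum>i<j. r ^ i) \<otimes> c [^] (r ^ j)) \<otimes> (y [^] j \<otimes> y)"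
    unfolding twisted_pow_left[OF assms] using assms(1,2) by (simp add: m_assoc)
  also have "\<dots> = c [^] (\<Sum>i<Suc j. r ^ i) \<otimes> y [^] Suc j"
    using assms(1,2) by (simp add: nat_pow_mult)
  finally show ?case .
qed (use assms in simp)

lemma nat_pow_eq_iff_cong:
  assumes "a \<in> carrier G"
  shows "a [^] (i::nat) = a [^] (j::nat) \<longleftrightarrow> [int i = int j] (mod int (ord a))"
  using int_pow_eq[OF assms, of "int i" "int j"]
  by (simp add: int_pow_int cong_iff_dvd_diff dvd_diff_commute)

text \<open>In a finite group the inverse of a^i is again a natural power, with exponent i times the
  group order minus 1. Natural exponents fit the twisted power laws above.\<close>

lemma subgroup_nat_powers:
  assumes fin: "finite (carrier G)" and a: "a \<in> carrier G"
  shows "subgroup (range (\<lambda>i::nat. a [^] i)) G"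
proof (rule subgroupI)
  show "range (\<lambda>i::nat. a [^] i) \<subseteq> carrier G" using a by auto
  show "range (\<lambda>i::nat. a [^] i) \<noteq> {}" by simp
  fix x assume "x \<in> range (\<lambda>i::nat. a [^] i)"
  then obtain i :: nat where i: "x = a [^] i" by blast
  have "a [^] (i * (Coset.order G - 1)) \<otimes> x = a [^] (Coset.order G * i)"
  proof -
    have "Coset.order G > 0" using fin by (simp add: order_gt_0_iff_finite)
    then have "i * (Coset.order G - 1) + i = Coset.order G * i" by (cases "Coset.order G") auto
    then show ?thesis using a by (simp add: i nat_pow_mult)
  qed
  also have "\<dots> = \<one>" using a pow_order_eq_1[OF a] by (simp flip: nat_pow_pow)
  finally have "inv x = a [^] (i * (Coset.order G - 1))"
    by (rule inv_equality) (use a i in simp_all)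
  then show "inv x \<in> range (\<lambda>i::nat. a [^] i)" by blast
  fix y assume "y \<in> range (\<lambda>i::nat. a [^] i)"
  then obtain j :: nat where "y = a [^] j" by blast
  then have "x \<otimes> y = a [^] (i + j)" using a by (simp add: i nat_pow_mult)
  then show "x \<otimes> y \<in> range (\<lambda>i::nat. a [^] i)" by blast
qed

text \<open>This is the step that fails for p = 2 (quaternion groups). A maximal cyclic normal subgroup A
  containing the centre is proper. For y central of order p modulo A, conjugation by y raises A to a
  power r with r^p = 1, so the p-th power map is multiplicative on A y; maximality makes y^p a p-th
  power in A, and y can be corrected to have order p.\<close>
lemma p_group_noncentral_order_p:
  assumes p: "prime p" "odd p" and ord: "Coset.order G = p ^ n"
    and nonab: "\<exists>x\<in>carrier G. \<exists>y\<in>carrier G. x \<otimes> y \<noteq> y \<otimes> x"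
    and center_cyclic: "\<exists>c\<in>carrier G. (\<forall>g\<in>carrier G. g \<otimes> c = c \<otimes> g) \<and>
      (\<forall>z\<in>carrier G. (\<forall>g\<in>carrier G. g \<otimes> z = z \<otimes> g) \<longrightarrow> (\<exists>i::nat. z = c [^] i))"
  shows "\<exists>x\<in>carrier G. x [^] p = \<one> \<and> (\<exists>g\<in>carrier G. g \<otimes> x \<noteq> x \<otimes> g) \<and>
    (\<forall>g\<in>carrier G. \<exists>c\<in>carrier G. (\<forall>h\<in>carrier G. h \<otimes> c = c \<otimes> h) \<and> g \<otimes> x = c \<otimes> (x \<otimes> g))"
proof -
  have p0: "p > 0" using p(1) by (rule prime_gt_0_nat)
  have fin: "finite (carrier G)"
    using ord p0 by (metis card.infinite Coset.order_def power_eq_0_iff less_irrefl)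
  define central where "central = (\<lambda>z. \<forall>g\<in>carrier G. g \<otimes> z = z \<otimes> g)"
  define pw where "pw = (\<lambda>a. range (\<lambda>i::nat. a [^] i))"
  have pw_sub: "subgroup (pw a) G" if "a \<in> carrier G" for a
    unfolding pw_def by (rule subgroup_nat_powers[OF fin that])
  have pw_carr: "pw a \<subseteq> carrier G" if "a \<in> carrier G" for a
    using subgroup.subset[OF pw_sub[OF that]] .
  \<comment> \<open>\<open>Q a\<close> says that the powers of a form a normal subgroup containing
    the centre. Expressing normality on the generator yields the exponent r by which an element
    acts.\<close>
  define Q where "Q = (\<lambda>a. a \<in> carrier G \<and> (\<forall>g\<in>carrier G. \<exists>r::nat. g \<otimes> a = a [^] r \<otimes> g) \<and>
    (\<forall>z\<in>carrier G. central z \<longrightarrow> z \<in> pw a))"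
  obtain c where c: "c \<in> carrier G" "central c" "\<forall>z\<in>carrier G. central z \<longrightarrow> z \<in> pw c"
    using center_cyclic unfolding central_def pw_def by (auto simp: image_iff)
  have "Q c" using c unfolding Q_def central_def by (auto intro!: exI[of _ 1])
  moreover have "card (pw a) < Suc (card (carrier G))" if "Q a" for a
    using that pw_carr[of a] fin unfolding Q_def by (simp add: card_mono less_Suc_eq_le)
  ultimately obtain a where Qa: "Q a" and max: "\<And>y. Q y \<Longrightarrow> card (pw y) \<le> card (pw a)"
    using ex_has_greatest_nat[of Q c "\<lambda>a. card (pw a)" "Suc (card (carrier G))"] by blast
  have a: "a \<in> carrier G" and norm: "\<And>g. g \<in> carrier G \<Longrightarrow> \<exists>r::nat. g \<otimes> a = a [^] r \<otimes> g"
    and cent: "\<And>z. z \<in> carrier G \<Longrightarrow> central z \<Longrightarrow> z \<in> pw a" using Qa unfolding Q_def by auto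
  have aA: "a \<in> pw a" using a by (auto simp: pw_def intro!: image_eqI[of _ _ 1])
  have pw_comm: "x \<otimes> y = y \<otimes> x" if "x \<in> pw a" "y \<in> pw a" for x y
    using that a by (auto simp: pw_def nat_pow_mult add.commute)
  have conj_pw: "\<exists>b'\<in>pw a. g \<otimes> b = b' \<otimes> g" if "g \<in> carrier G" "b \<in> pw a" for g b
    using norm[OF that(1)] that twisted_pow_right[OF that(1) a] unfolding pw_def by blast
  have norm_sub: "pw a \<lhd> G"
  proof (rule normal_invI[OF pw_sub[OF a]])
    fix g b assume gb: "g \<in> carrier G" "b \<in> pw a"
    then obtain b' where b': "b' \<in> pw a" "g \<otimes> b = b' \<otimes> g" using conj_pw by blast
    then have "g \<otimes> b \<otimes> inv g = b'" using gb pw_carr[OF a] by (auto simp: m_assoc)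
    then show "g \<otimes> b \<otimes> inv g \<in> pw a" using b' by simp
  qed
  have "pw a \<noteq> carrier G" using nonab pw_comm by blast
  then obtain y where y: "y \<in> carrier G" "y \<notin> pw a" "y [^] p \<in> pw a"
      and ycent: "\<And>g. g \<in> carrier G \<Longrightarrow> \<exists>b\<in>pw a. g \<otimes> y = b \<otimes> (y \<otimes> g)"
    using p_group_central_mod_normal[OF p(1) ord norm_sub] by blast
  have "ord a dvd p ^ n" using ord_dvd_group_order[OF a] ord by simp
  then obtain k where k: "ord a = p ^ k" using divides_primepow_nat[OF p(1)] by blast
  have k0: "k > 0"
  proof (rule ccontr)
    assume "\<not> k > 0"
    then have "a = \<one>" using k a ord_eq_1[OF a] by simp
    have "n > 0"
    proof (rule ccontr)
      assume "\<not> n > 0"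
      then have "card (carrier G) = 1" using ord by (simp add: Coset.order_def)
      then show False using nonab by (auto simp: card_1_singleton_iff)
    qed
    then obtain z where "z \<in> carrier G" "z \<noteq> \<one>" "central z"
      using p_group_center_nontrivial[OF p(1) ord] unfolding central_def by blast
    then have "z \<in> pw a" using cent by blast
    with \<open>a = \<one>\<close> \<open>z \<noteq> \<one>\<close> show False by (auto simp: pw_def)
  qed
  have pow_eq: "a [^] i = a [^] j \<longleftrightarrow> [int i = int j] (mod int p ^ k)" for i j :: nat
    using nat_pow_eq_iff_cong[OF a] by (simp add: k)
  obtain r :: nat where r: "y \<otimes> a = a [^] r \<otimes> y" using norm[OF y(1)] by blast
  obtain s :: nat where s: "y [^] p = a [^] s" using y(3) by (auto simp: pw_def)
  have "a [^] (r ^ p) = a [^] (1::nat)"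
  proof -
    have "a [^] (r ^ p) \<otimes> y [^] p = a \<otimes> y [^] p"
      using twisted_pow_left[OF y(1) a r, of p] pw_comm[OF y(3) aA] by simp
    then show ?thesis using a y(1) by simp
  qed
  then have "[int r ^ p = 1] (mod int p ^ k)" using pow_eq[of "r ^ p" 1] by simp
  then have S: "[(\<Sum>i<p. int r ^ i) = int p] (mod int p ^ k)"
    by (rule geometric_sum_cong_prime_power[OF p k0])
  define S' where "S' = (\<Sum>i<p. r ^ i)"
  have S': "[int S' = int p] (mod int p ^ k)" using S by (simp add: S'_def)
  have pow_S: "x [^] S' = x [^] p" if x: "x \<in> pw a" for x
  proof -
    obtain i :: nat where i: "x = a [^] i" using x by (auto simp: pw_def)
    show ?thesis unfolding i using a S'
      by (simp add: nat_pow_pow pow_eq cong_scalar_left)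
  qed
  have tw: "y \<otimes> x = x [^] r \<otimes> y" if x: "x \<in> pw a" for x
  proof -
    obtain i :: nat where i: "x = a [^] i" using x by (auto simp: pw_def)
    show ?thesis unfolding i using a twisted_pow_right[OF y(1) a r, of i]
      by (simp add: nat_pow_pow mult.commute)
  qed
  have pow_mult: "(x \<otimes> y) [^] p = x [^] p \<otimes> y [^] p" if x: "x \<in> pw a" for x
    using twisted_prod_pow[OF y(1) _ tw[OF x], of p] pow_S[OF x] pw_carr[OF a] x
    by (auto simp: S'_def)
  \<comment> \<open>Otherwise a is itself a power of y^p, so the powers of y contain those of a and
    also satisfy \<open>Q\<close>; as y is not a power of a, this contradicts maximality.\<close>
  have ps: "p dvd s"
  proof (rule ccontr)
    assume "\<not> p dvd s"
    then have "coprime s (p ^ k)" using p(1) by (metis coprime_commute coprime_power_right_iff prime_imp_coprime)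
    then obtain t where t: "[s * t = 1] (mod p ^ k)" using cong_solve_coprime_nat by (metis One_nat_def)
    have "a = y [^] (p * t)"
    proof -
      have "[int (s * t) = int 1] (mod int (p ^ k))" using t by (simp only: cong_int_iff)
      then have "a [^] (s * t) = a [^] (1::nat)" by (subst pow_eq) simp
      then show ?thesis using a y(1) s by (simp flip: nat_pow_pow)
    qed
    then have sub: "pw a \<subseteq> pw y" using y(1) by (auto simp: pw_def nat_pow_pow)
    have "y \<in> pw y" using y(1) by (auto simp: pw_def intro!: image_eqI[of _ _ 1])
    have "Q y" unfolding Q_def
    proof (intro conjI ballI impI)
      show "y \<in> carrier G" by (rule y(1))
      show "z \<in> pw y" if "z \<in> carrier G" "central z" for z using cent[OF that] sub by blast
      fix g assume g: "g \<in> carrier G"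
      obtain b where b: "b \<in> pw a" "g \<otimes> y = b \<otimes> (y \<otimes> g)" using ycent[OF g] by blast
      then obtain i :: nat where i: "b = y [^] i" using sub by (auto simp: pw_def)
      show "\<exists>r::nat. g \<otimes> y = y [^] r \<otimes> g"
        using b(2) g y(1) by (intro exI[of _ "Suc i"]) (simp add: i m_assoc)
    qed
    then have "card (pw y) \<le> card (pw a)" by (rule max)
    moreover have "pw a \<subset> pw y" using sub \<open>y \<in> pw y\<close> y(2) by blast
    then have "card (pw a) < card (pw y)"
      using finite_subset[OF pw_carr[OF y(1)] fin] by (simp add: psubset_card_mono)
    ultimately show False by simp
  qed
  then obtain s' where s': "s = p * s'" by (elim dvdE)
  \<comment> \<open>Chosen so that b^p is the inverse of y^p; since the p-th power is multiplicative
    on products of a power of a with y, the element b y has p-th power 1.\<close>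
  define b where "b = inv (a [^] s')"
  have asA: "a [^] s' \<in> pw a" by (simp add: pw_def)
  have b: "b \<in> pw a" unfolding b_def using subgroup.m_inv_closed[OF pw_sub[OF a] asA] .
  have bc: "b \<in> carrier G" using b pw_carr[OF a] by blast
  define x where "x = b \<otimes> y"
  have xc: "x \<in> carrier G" using bc y(1) by (simp add: x_def)
  have xp: "x [^] p = \<one>"
  proof -
    have "b [^] p = inv (a [^] s)" unfolding b_def s'
      using a by (simp add: nat_pow_inv nat_pow_pow mult.commute)
    then show ?thesis using pow_mult[OF b] s a by (simp add: x_def)
  qed
  have xA: "x \<notin> pw a"
  proof
    assume "x \<in> pw a"
    then have "inv b \<otimes> x \<in> pw a"
      using b pw_sub[OF a] by (meson subgroup.m_closed subgroup.m_inv_closed)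
    then show False using y bc by (simp add: x_def m_assoc[symmetric])
  qed
  show ?thesis
  proof (rule bexI[OF _ xc], intro conjI ballI)
    show "x [^] p = \<one>" by (rule xp)
    show "\<exists>g\<in>carrier G. g \<otimes> x \<noteq> x \<otimes> g" using cent[OF xc] xA unfolding central_def by blast
    fix g assume g: "g \<in> carrier G"
    obtain b1 where b1: "b1 \<in> pw a" "g \<otimes> b = b1 \<otimes> g" using conj_pw[OF g b] by blast
    obtain b2 where b2: "b2 \<in> pw a" "g \<otimes> y = b2 \<otimes> (y \<otimes> g)" using ycent[OF g] by blast
    have b12: "b1 \<in> carrier G" "b2 \<in> carrier G" using b1 b2 pw_carr[OF a] by auto
    \<comment> \<open>This is the commutator of g and x, computed inside the cyclic group. Both x
      and its conjugate c x have p-th power 1 and lie in the coset of y, where the p-th power is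
      multiplicative; hence c^p = 1.\<close>
    define c where "c = b1 \<otimes> b2 \<otimes> inv b"
    have cA: "c \<in> pw a" unfolding c_def
      using b b1 b2 pw_sub[OF a] by (meson subgroup.m_closed subgroup.m_inv_closed)
    have cc: "c \<in> carrier G" using cA pw_carr[OF a] by blast
    have gx: "g \<otimes> x = c \<otimes> (x \<otimes> g)"
    proof -
      have "g \<otimes> x = (g \<otimes> b) \<otimes> y" using g bc y(1) by (simp add: x_def m_assoc)
      also have "\<dots> = b1 \<otimes> (g \<otimes> y)" unfolding b1(2) using b12 g y(1) by (simp add: m_assoc)
      also have "\<dots> = b1 \<otimes> b2 \<otimes> (y \<otimes> g)" unfolding b2(2) using b12 g y(1) by (simp add: m_assoc)
      also have "y \<otimes> g = inv b \<otimes> (b \<otimes> (y \<otimes> g))"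
        using bc y(1) g by (simp add: m_assoc[symmetric])
      also have "b1 \<otimes> b2 \<otimes> (inv b \<otimes> (b \<otimes> (y \<otimes> g))) = c \<otimes> (x \<otimes> g)"
        using b12 g y(1) bc by (simp add: c_def x_def m_assoc)
      finally show ?thesis .
    qed
    have cp: "c [^] p = \<one>"
    proof -
      have cb: "c \<otimes> b \<in> pw a" using cA b pw_sub[OF a] by (meson subgroup.m_closed)
      have conj: "c \<otimes> x = g \<otimes> x \<otimes> inv g" using gx cc xc g by (simp add: m_assoc)
      have "(g \<otimes> x \<otimes> inv g) [^] j = g \<otimes> x [^] j \<otimes> inv g" for j :: nat
      proof (induction j)
        case (Suc j)
        have e: "inv g \<otimes> (g \<otimes> w) = w" if "w \<in> carrier G" for w
          using that g by (simp add: m_assoc[symmetric])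
        show ?case using Suc g xc by (simp add: m_assoc e)
      qed (use g in simp)
      then have "(c \<otimes> x) [^] p = \<one>" unfolding conj using xp g by simp
      moreover have "c \<otimes> x = (c \<otimes> b) \<otimes> y" using cc bc y(1) by (simp add: x_def m_assoc)
      ultimately have "(c \<otimes> b) [^] p \<otimes> y [^] p = \<one>" using pow_mult[OF cb] by simp
      moreover have "(c \<otimes> b) [^] p = c [^] p \<otimes> b [^] p"
        using pow_mult_distrib[OF pw_comm[OF cA b] cc bc] .
      moreover have "b [^] p \<otimes> y [^] p = \<one>" using pow_mult[OF b] xp by (simp add: x_def)
      ultimately show ?thesis using cc bc y(1) by (simp add: m_assoc)
    qed
    \<comment> \<open>An element h raises a to a power r' whose \<open>p ^ n\<close>-th power is 1
      modulo the order of a. By Fermat r' is 1 modulo p, and the order of c divides p, so h fixes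
      c.\<close>
    have "central c" unfolding central_def
    proof
      fix h assume h: "h \<in> carrier G"
      obtain r' :: nat where r': "h \<otimes> a = a [^] r' \<otimes> h" using norm[OF h] by blast
      obtain i :: nat where i: "c = a [^] i" using cA by (auto simp: pw_def)
      have "h [^] (p ^ n) = \<one>" using pow_order_eq_1[OF h] ord by simp
      then have "a [^] (r' ^ (p ^ n)) = a [^] (1::nat)"
        using twisted_pow_left[OF h a r', of "p ^ n"] a by simp
      then have "[int r' ^ (p ^ n) = 1] (mod int p ^ k)" using pow_eq[of "r' ^ (p ^ n)" 1] by simp
      then have "[int r' ^ (p ^ n) = 1] (mod int p)" using k0 by (metis cong_dvd_modulus dvd_power)
      then have "[int r' = int 1] (mod int p)"
        using fermat_int_iterate[OF p(1), of "int r'" n] by (metis cong_sym cong_trans of_nat_1)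
      then have r1: "[r' = 1] (mod p)" by (simp only: cong_int_iff)
      have "[int r' = int 1] (mod int (ord c))"
      proof -
        have "ord c dvd p" using cp cc by (simp add: pow_eq_id)
        then show ?thesis using r1 by (metis cong_dvd_modulus_nat cong_int_iff)
      qed
      then have "c [^] r' = c [^] (1::nat)" using nat_pow_eq_iff_cong[OF cc] by blast
      then show "h \<otimes> c = c \<otimes> h" using twisted_pow_right[OF h a r', of i] a cc
        by (simp add: i nat_pow_pow mult.commute)
    qed
    then show "\<exists>c\<in>carrier G. (\<forall>h\<in>carrier G. h \<otimes> c = c \<otimes> h) \<and> g \<otimes> x = c \<otimes> (x \<otimes> g)"
      using cc gx unfolding central_def by blast
  qed
qed

end

section \<open>Matrices and idempotents\<close>

text \<open>Matrices carry their dimensions, so they have no global zero and \<^const>\<open>sum\<close> does not apply to them.\<close>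
definition msum :: "nat \<Rightarrow> ('i \<Rightarrow> complex mat) \<Rightarrow> 'i set \<Rightarrow> complex mat" where
  "msum d f S = mat d d (\<lambda>(i, j). \<Sum>s\<in>S. f s $$ (i, j))"

lemma mat_trace_mult_comm:
  assumes "A \<in> carrier_mat n m" "B \<in> carrier_mat m n"
  shows "mat_trace (A * B) = mat_trace (B * A)"
proof -
  have "mat_trace (A * B) = (\<Sum>i<n. \<Sum>k<m. A $$ (i, k) * B $$ (k, i))"
    using assms by (auto simp: mat_trace_def scalar_prod_def lessThan_atLeast0 intro!: sum.cong)
  also have "\<dots> = (\<Sum>k<m. \<Sum>i<n. B $$ (k, i) * A $$ (i, k))"
    by (subst sum.swap) (simp add: mult.commute)
  also have "\<dots> = mat_trace (B * A)"
    using assms by (auto simp: mat_trace_def scalar_prod_def lessThan_atLeast0 intro!: sum.cong)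
  finally show ?thesis .
qed

locale square_mats =
  fixes d :: nat
begin

abbreviation M :: "complex mat set" where "M \<equiv> carrier_mat d d"
abbreviation I :: "complex mat" where "I \<equiv> 1\<^sub>m d"
abbreviation Om :: "complex mat" where "Om \<equiv> 0\<^sub>m d d"
abbreviation tr where "tr \<equiv> mat_trace"

lemma mat_assoc: "A \<in> M \<Longrightarrow> B \<in> M \<Longrightarrow> C \<in> M \<Longrightarrow> A * B * C = A * (B * C)"
  by (rule assoc_mult_mat)

lemma mat_closed [simp]:
  "A \<in> M \<Longrightarrow> B \<in> M \<Longrightarrow> A * B \<in> M" "A \<in> M \<Longrightarrow> c \<cdot>\<^sub>m A \<in> M" "A \<in> M \<Longrightarrow> B \<in> M \<Longrightarrow> A + B \<in> M"
  "A \<in> M \<Longrightarrow> B \<in> M \<Longrightarrow> A - B \<in> M" "I \<in> M" "Om \<in> M" "msum d f S \<in> M"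
  by (auto simp: msum_def)

lemma mat_unit [simp]: "A \<in> M \<Longrightarrow> I * A = A" "A \<in> M \<Longrightarrow> A * I = A" "A \<in> M \<Longrightarrow> Om * A = Om" "A \<in> M \<Longrightarrow> A * Om = Om"
  by (auto intro: left_mult_zero_mat right_mult_zero_mat)

lemma mat_mult_smult [simp]: "A \<in> M \<Longrightarrow> B \<in> M \<Longrightarrow> (c \<cdot>\<^sub>m A) * B = c \<cdot>\<^sub>m (A * B)"
  "A \<in> M \<Longrightarrow> B \<in> M \<Longrightarrow> A * (c \<cdot>\<^sub>m B) = c \<cdot>\<^sub>m (A * B)"
  by (auto simp: mult_smult_assoc_mat mult_smult_distrib)

lemma smult_smult_mat [simp]: "c \<cdot>\<^sub>m (e \<cdot>\<^sub>m A) = (c * e) \<cdot>\<^sub>m (A :: complex mat)"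
  by (intro eq_matI) auto

lemma smult_one_mat [simp]: "1 \<cdot>\<^sub>m (A :: complex mat) = A"
  by (intro eq_matI) auto

lemma smult_zero_mat [simp]: "A \<in> M \<Longrightarrow> 0 \<cdot>\<^sub>m A = Om" "c \<cdot>\<^sub>m Om = Om"
  by (intro eq_matI; auto)+

lemma smult_eq_zero: "A \<in> M \<Longrightarrow> c \<cdot>\<^sub>m A = Om \<Longrightarrow> c \<noteq> 0 \<Longrightarrow> A = Om"
  by (metis smult_one_mat smult_smult_mat left_inverse smult_zero_mat(2))

lemma smult_cancel_mat: "A \<in> M \<Longrightarrow> A \<noteq> Om \<Longrightarrow> c \<cdot>\<^sub>m A = e \<cdot>\<^sub>m A \<Longrightarrow> c = e"
proof (rule ccontr)
  assume a: "A \<in> M" "A \<noteq> Om" "c \<cdot>\<^sub>m A = e \<cdot>\<^sub>m A" "c \<noteq> e"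
  have "(c - e) \<cdot>\<^sub>m A = Om"
  proof (rule eq_matI)
    fix i j assume ij: "i < dim_row Om" "j < dim_col Om"
    have "(c \<cdot>\<^sub>m A) $$ (i, j) = (e \<cdot>\<^sub>m A) $$ (i, j)" by (simp only: a(3))
    then have "c * A $$ (i, j) = e * A $$ (i, j)" using a(1) ij by simp
    then show "((c - e) \<cdot>\<^sub>m A) $$ (i, j) = Om $$ (i, j)" using a(1) ij by (simp add: left_diff_distrib)
  qed (use a in auto)
  with a smult_eq_zero[of A "c - e"] show False by simp
qed

lemma tr_simps [simp]: "A \<in> M \<Longrightarrow> tr (c \<cdot>\<^sub>m A) = c * tr A" "tr I = of_nat d" "tr Om = 0"
  "A \<in> M \<Longrightarrow> B \<in> M \<Longrightarrow> tr (A + B) = tr A + tr B" "A \<in> M \<Longrightarrow> B \<in> M \<Longrightarrow> tr (A - B) = tr A - tr B"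
  by (auto simp: mat_trace_def sum_distrib_left sum.distrib sum_subtractf)

lemma tr_comm: "A \<in> M \<Longrightarrow> B \<in> M \<Longrightarrow> tr (A * B) = tr (B * A)"
  by (rule mat_trace_mult_comm)

lemma tr_conj: "A \<in> M \<Longrightarrow> B \<in> M \<Longrightarrow> C \<in> M \<Longrightarrow> C * A = I \<Longrightarrow> tr (A * (B * C)) = tr B"
  by (subst tr_comm) (simp_all add: mat_assoc)

lemma msum_cong: "S = T \<Longrightarrow> (\<And>s. s \<in> T \<Longrightarrow> f s = g s) \<Longrightarrow> msum d f S = msum d g T"
  by (simp add: msum_def)

lemma msum_mult_left:
  assumes "A \<in> M" "\<And>s. s \<in> S \<Longrightarrow> f s \<in> M"
  shows "A * msum d f S = msum d (\<lambda>s. A * f s) S"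
proof (rule eq_matI)
  fix i j assume "i < dim_row (msum d (\<lambda>s. A * f s) S)" "j < dim_col (msum d (\<lambda>s. A * f s) S)"
  then have ij: "i < d" "j < d" by (auto simp: msum_def)
  have "(A * msum d f S) $$ (i, j) = (\<Sum>k<d. \<Sum>s\<in>S. A $$ (i, k) * f s $$ (k, j))"
    using assms(1) ij by (auto simp: msum_def scalar_prod_def sum_distrib_left lessThan_atLeast0)
  also have "\<dots> = (\<Sum>s\<in>S. \<Sum>k<d. A $$ (i, k) * f s $$ (k, j))" by (rule sum.swap)
  also have "\<dots> = (\<Sum>s\<in>S. (A * f s) $$ (i, j))"
    using assms(1) ij by (intro sum.cong) (auto simp: scalar_prod_def lessThan_atLeast0 dest!: assms(2))
  finally show "(A * msum d f S) $$ (i, j) = msum d (\<lambda>s. A * f s) S $$ (i, j)"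
    using ij by (simp add: msum_def)
qed (use assms in \<open>auto simp: msum_def\<close>)

lemma msum_mult_right:
  assumes "A \<in> M" "\<And>s. s \<in> S \<Longrightarrow> f s \<in> M"
  shows "msum d f S * A = msum d (\<lambda>s. f s * A) S"
proof (rule eq_matI)
  fix i j assume "i < dim_row (msum d (\<lambda>s. f s * A) S)" "j < dim_col (msum d (\<lambda>s. f s * A) S)"
  then have ij: "i < d" "j < d" by (auto simp: msum_def)
  have "(msum d f S * A) $$ (i, j) = (\<Sum>k<d. \<Sum>s\<in>S. f s $$ (i, k) * A $$ (k, j))"
    using assms(1) ij by (auto simp: msum_def scalar_prod_def sum_distrib_right lessThan_atLeast0)
  also have "\<dots> = (\<Sum>s\<in>S. \<Sum>k<d. f s $$ (i, k) * A $$ (k, j))" by (rule sum.swap)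
  also have "\<dots> = (\<Sum>s\<in>S. (f s * A) $$ (i, j))"
    using assms(1) ij by (intro sum.cong) (auto simp: scalar_prod_def lessThan_atLeast0 dest!: assms(2))
  finally show "(msum d f S * A) $$ (i, j) = msum d (\<lambda>s. f s * A) S $$ (i, j)"
    using ij by (simp add: msum_def)
qed (use assms in \<open>auto simp: msum_def\<close>)

lemma msum_smult:
  assumes "\<And>s. s \<in> S \<Longrightarrow> f s \<in> M"
  shows "msum d (\<lambda>s. c \<cdot>\<^sub>m f s) S = c \<cdot>\<^sub>m msum d f S"
  by (rule eq_matI) (auto simp: msum_def sum_distrib_left dest!: assms intro!: sum.cong)

lemma msum_const_mat:
  assumes "A \<in> M"
  shows "msum d (\<lambda>s. c s \<cdot>\<^sub>m A) S = sum c S \<cdot>\<^sub>m A"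
  using assms by (intro eq_matI) (auto simp: msum_def sum_distrib_right)

lemma msum_reindex:
  assumes "bij_betw h S T"
  shows "msum d (\<lambda>s. f (h s)) S = msum d f T"
  unfolding msum_def by (intro cong_mat) (auto intro: sum.reindex_bij_betw[OF assms])

lemma msum_swap:
  "msum d (\<lambda>s. msum d (f s) T) S = msum d (\<lambda>t. msum d (\<lambda>s. f s t) S) T"
  by (rule eq_matI) (auto simp: msum_def intro: sum.swap)

lemma msum_restrict:
  assumes "finite S" "T \<subseteq> S" "\<And>s. s \<in> S - T \<Longrightarrow> f s = Om"
  shows "msum d f S = msum d f T"
proof (rule eq_matI)
  fix i j assume "i < dim_row (msum d f T)" "j < dim_col (msum d f T)"
  then have ij: "i < d" "j < d" by (auto simp: msum_def)
  have "(\<Sum>s\<in>S. f s $$ (i, j)) = (\<Sum>s\<in>T. f s $$ (i, j))"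
    using assms ij by (intro sum.mono_neutral_right) auto
  then show "msum d f S $$ (i, j) = msum d f T $$ (i, j)" using ij by (simp add: msum_def)
qed (auto simp: msum_def)

lemma msum_zero: "(\<And>s. s \<in> S \<Longrightarrow> f s = Om) \<Longrightarrow> msum d f S = Om"
  by (rule eq_matI) (auto simp: msum_def)

lemma tr_msum:
  assumes "\<And>s. s \<in> S \<Longrightarrow> f s \<in> M"
  shows "tr (msum d f S) = (\<Sum>s\<in>S. tr (f s))"
proof -
  have "tr (msum d f S) = (\<Sum>s\<in>S. \<Sum>i<d. f s $$ (i, i))"
    by (subst sum.swap) (simp add: mat_trace_def msum_def)
  then show ?thesis by (auto simp: mat_trace_def dest!: assms intro!: sum.cong)
qed

text \<open>In the product formula for entry (i, j), each term has a factor that lies on or below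
  the diagonal or is strictly closer to it, so induction on j - i makes all entries vanish.\<close>

lemma idempotent_upper_triangular_zero:
  assumes B: "B \<in> M" "B * B = B" "upper_triangular B" and diag: "\<And>i. i < d \<Longrightarrow> B $$ (i, i) = 0"
  shows "B = Om"
proof -
  have entry: "B $$ (i, j) = (\<Sum>l<d. B $$ (i, l) * B $$ (l, j))" if "i < d" "j < d" for i j
    using arg_cong[OF B(2), of "\<lambda>A. A $$ (i, j)"] B(1) that
    by (auto simp: scalar_prod_def lessThan_atLeast0)
  have "i < d \<Longrightarrow> j < d \<Longrightarrow> j - i = n \<Longrightarrow> B $$ (i, j) = 0" for n i j
  proof (induction n arbitrary: i j rule: less_induct)
    case (less n)
    show ?case
    proof (cases "i < j")
      case False
      then show ?thesis using less.prems diag B(1,3) by (cases "i = j") auto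
    next
      case True
      have "B $$ (i, l) * B $$ (l, j) = 0" if l: "l < d" for l
      proof -
        consider "l \<le> i" | "l \<ge> j" | "i < l" "l < j" by linarith
        then show ?thesis
        proof cases
          case 1
          then have "B $$ (i, l) = 0" using diag B(1,3) less.prems l by (cases "i = l") auto
          then show ?thesis by simp
        next
          case 2
          then have "B $$ (l, j) = 0" using diag B(1,3) less.prems l by (cases "j = l") auto
          then show ?thesis by simp
        next
          case 3
          then have "B $$ (i, l) = 0" using less.IH[of "l - i" i l] less.prems l by auto
          then show ?thesis by simp
        qed
      qed
      then have "(\<Sum>l<d. B $$ (i, l) * B $$ (l, j)) = 0" by (intro sum.neutral) simp
      then show ?thesis using entry[of i j] less.prems by simp
    qed
  qed
  then show ?thesis using B(1) by (intro eq_matI) auto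
qed

text \<open>The trace of an idempotent is its rank: after Schur triangularisation it counts the ones
  on the diagonal, as a triangular idempotent has only zeros and ones there.\<close>

lemma idempotent_trace:
  assumes E: "E \<in> M" "E * E = E"
  shows "\<exists>n::nat. tr E = of_nat n \<and> (n = 0 \<longrightarrow> E = Om)"
proof -
  obtain es where es: "Char_Poly.char_poly E = (\<Prod>e\<leftarrow>es. [:- e, 1:])"
    using char_poly_factorized[OF E(1)] by blast
  obtain B P Q where dec: "schur_decomposition E es = (B, P, Q)" by (cases "schur_decomposition E es") auto
  from schur_decomposition[OF E(1) es dec]
  have sim: "similar_mat_wit E B P Q" and ut: "upper_triangular B" by auto
  note s = similar_mat_witD2[OF E(1) sim]
  have c: "B \<in> M" "P \<in> M" "Q \<in> M" and PQ: "P * Q = I" "Q * P = I" and EB: "E = P * (B * Q)"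
    using s by (auto simp: mat_assoc)
  have QEP: "Q * (E * P) = B"
  proof -
    have "Q * (E * P) = (Q * P) * (B * (Q * P))" using c EB by (simp add: mat_assoc)
    then show ?thesis using c PQ by simp
  qed
  have "B * B = Q * (E * ((P * Q) * (E * P)))" using c E QEP[symmetric] by (simp add: mat_assoc)
  also have "\<dots> = Q * ((E * E) * P)" using c E PQ mat_assoc[of E E P] by (simp add: mat_assoc)
  finally have BB: "B * B = B" using E QEP by simp
  have trB: "tr E = tr B" unfolding EB using c PQ by (simp add: tr_conj)
  have diag: "B $$ (i, i) = 0 \<or> B $$ (i, i) = 1" if i: "i < d" for i
  proof -
    have "B $$ (i, i) = (\<Sum>l<d. B $$ (i, l) * B $$ (l, i))"
      using arg_cong[OF BB, of "\<lambda>A. A $$ (i, i)"] c(1) i by (auto simp: scalar_prod_def lessThan_atLeast0)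
    also have "\<dots> = (\<Sum>l<d. if l = i then B $$ (i, i) * B $$ (i, i) else 0)"
    proof (intro sum.cong refl)
      fix l assume l: "l \<in> {..<d}"
      consider "l = i" | "l < i" | "l > i" by linarith
      then show "B $$ (i, l) * B $$ (l, i) = (if l = i then B $$ (i, i) * B $$ (i, i) else 0)"
        using c(1) i l upper_triangularD[OF ut, of l i] upper_triangularD[OF ut, of i l] by cases auto
    qed
    finally have "B $$ (i, i) = B $$ (i, i) * B $$ (i, i)" using i by simp
    then show ?thesis by (metis mult_cancel_left2)
  qed
  define n where "n = card {i \<in> {..<d}. B $$ (i, i) = 1}"
  have "tr B = (\<Sum>i<d. if B $$ (i, i) = 1 then 1 else 0)"
    unfolding mat_trace_def using c diag by (intro sum.cong) auto
  also have "\<dots> = of_nat n" by (simp add: n_def sum.If_cases Int_def)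
  finally have "tr E = of_nat n" using trB by simp
  moreover have "E = Om" if "n = 0"
  proof -
    have "\<And>i. i < d \<Longrightarrow> B $$ (i, i) = 0" using that diag by (fastforce simp: n_def)
    then have "B = Om" using idempotent_upper_triangular_zero[OF c(1) BB ut] by blast
    then show ?thesis using EB c by simp
  qed
  ultimately show ?thesis by blast
qed

end

section \<open>Spectral projections of a matrix of finite order\<close>

context square_mats
begin

text \<open>The sequence Y i stands for X^i E, so that E plays the role of the identity.\<close>
lemma spectral_projections:
  assumes X: "X \<in> M" and Y: "\<And>i. Y i \<in> M" "Y 0 = E" "\<And>i. X * Y i = Y (Suc i)" "Y N = E" "N > 0"
    and YE: "\<And>i. Y i * E = Y i" "\<And>i. E * Y i = Y i"
  defines "P \<equiv> \<lambda>w. msum d (\<lambda>i. (w ^ (N - i) / of_nat N) \<cdot>\<^sub>m Y i) {..<N}"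
  shows "\<And>w. P w \<in> M" "\<And>w. w ^ N = 1 \<Longrightarrow> X * P w = w \<cdot>\<^sub>m P w"
    "\<And>w. P w * E = P w" "\<And>w. E * P w = P w"
    "msum d P {w. w ^ N = 1} = E"
    "\<And>w w'. w ^ N = 1 \<Longrightarrow> w' ^ N = 1 \<Longrightarrow> P w * P w' = (if w = w' then P w else Om)"
proof -
  show PM: "P w \<in> M" for w by (simp add: P_def)
  have E: "E \<in> M" using Y(1)[of 0] Y(2) by simp
  show XP: "X * P w = w \<cdot>\<^sub>m P w" if w: "w ^ N = 1" for w
  proof -
    \<comment> \<open>The exponent N - i stands for -i, since w^N = 1. With this choice
      \<open>f N = f 0\<close>, so shifting the index leaves the sum over one period
      unchanged.\<close>
    define f where "f = (\<lambda>i. (w ^ (N - i) / of_nat N) \<cdot>\<^sub>m Y i)"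
    have f: "f i \<in> M" for i using Y(1) by (simp add: f_def)
    have fN: "f N = f 0" using w Y(2,4) by (simp add: f_def)
    have "X * P w = msum d (\<lambda>i. X * f i) {..<N}"
      unfolding P_def f_def[symmetric] using X f by (simp add: msum_mult_left)
    also have "\<dots> = msum d (\<lambda>i. w \<cdot>\<^sub>m f (Suc i)) {..<N}"
    proof (rule msum_cong[OF refl])
      fix i assume i: "i \<in> {..<N}"
      have "w ^ (N - i) = w * w ^ (N - Suc i)" using i by (simp add: Suc_diff_Suc flip: power_Suc)
      then show "X * f i = w \<cdot>\<^sub>m f (Suc i)" using X Y(1) Y(3)[of i] by (simp add: f_def)
    qed
    also have "\<dots> = w \<cdot>\<^sub>m msum d (\<lambda>i. f (Suc i)) {..<N}" using f by (rule msum_smult)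
    also have "msum d (\<lambda>i. f (Suc i)) {..<N} = msum d f {..<N}"
    proof (rule eq_matI)
      fix i j assume "i < dim_row (msum d f {..<N})" "j < dim_col (msum d f {..<N})"
      then have ij: "i < d" "j < d" by (auto simp: msum_def)
      have "(\<Sum>k<N. f (Suc k) $$ (i, j)) + f 0 $$ (i, j) = (\<Sum>k<N. f k $$ (i, j)) + f N $$ (i, j)"
        using sum.lessThan_Suc[where g = "\<lambda>k. f k $$ (i, j)" and n = N] sum.lessThan_Suc_shift[where g = "\<lambda>k. f k $$ (i, j)" and n = N]
        by (simp only: add.commute)
      then show "msum d (\<lambda>i. f (Suc i)) {..<N} $$ (i, j) = msum d f {..<N} $$ (i, j)"
        using ij fN by (simp add: msum_def)
    qed (auto simp: msum_def)
    finally show ?thesis by (simp add: P_def f_def)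
  qed
  show PE: "P w * E = P w" "E * P w = P w" for w
    unfolding P_def using E Y(1) YE by (simp_all add: msum_mult_right msum_mult_left)
  show "msum d P {w. w ^ N = 1} = E"
  proof -
    have "msum d P {w. w ^ N = 1} =
        msum d (\<lambda>i. msum d (\<lambda>w. (w ^ (N - i) / of_nat N) \<cdot>\<^sub>m Y i) {w. w ^ N = 1}) {..<N}"
      unfolding P_def by (rule msum_swap)
    also have "\<dots> = msum d (\<lambda>i. (if i = 0 then 1 else 0) \<cdot>\<^sub>m Y i) {..<N}"
    proof (rule msum_cong[OF refl])
      fix i assume i: "i \<in> {..<N}"
      have "(\<Sum>w::complex | w ^ N = 1. w ^ (N - i) / of_nat N) = (if i = 0 then 1 else 0)"
      proof -
        have "N dvd N - i \<longleftrightarrow> i = 0" using i by (auto dest: dvd_imp_le)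
        then show ?thesis using Y(5) by (simp add: sum_roots_unity_power flip: sum_divide_distrib)
      qed
      then show "msum d (\<lambda>w. (w ^ (N - i) / of_nat N) \<cdot>\<^sub>m Y i) {w. w ^ N = 1} = (if i = 0 then 1 else 0) \<cdot>\<^sub>m Y i"
        using Y(1) by (simp add: msum_const_mat)
    qed
    also have "\<dots> = msum d (\<lambda>i. (if i = 0 then 1 else 0) \<cdot>\<^sub>m Y i) {0}"
      using Y(1,5) by (intro msum_restrict) auto
    also have "\<dots> = E" using E Y(2) by (intro eq_matI) (auto simp: msum_def)
    finally show ?thesis .
  qed
  show "P w * P w' = (if w = w' then P w else Om)" if w: "w ^ N = 1" "w' ^ N = 1" for w w'
  proof -
    have Pw: "P w = msum d (\<lambda>i. (w ^ (N - i) / of_nat N) \<cdot>\<^sub>m Y i) {..<N}" for w by (simp add: P_def)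
    have YP: "Y i * P w' = (w' ^ i) \<cdot>\<^sub>m P w'" for i
    proof (induction i)
      case (Suc i)
      have "Y (Suc i) * P w' = X * (Y i * P w')"
        unfolding Y(3)[symmetric] using X Y(1) PM by (simp add: mat_assoc)
      then show ?case unfolding Suc using X PM XP[OF w(2)] by (simp add: mult.commute)
    qed (simp add: Y(2) PE)
    have w0: "w \<noteq> 0" using w(1) Y(5) by (auto simp: zero_power)
    have "P w * P w' = msum d (\<lambda>i. ((w ^ (N - i) / of_nat N) * w' ^ i) \<cdot>\<^sub>m P w') {..<N}"
      unfolding Pw[of w] using PM Y(1) by (simp add: msum_mult_right YP)
    also have "\<dots> = (\<Sum>i<N. (w ^ (N - i) / of_nat N) * w' ^ i) \<cdot>\<^sub>m P w'" using PM by (rule msum_const_mat)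
    also have "(\<Sum>i<N. (w ^ (N - i) / of_nat N) * w' ^ i) = (\<Sum>i<N. (w' / w) ^ i) / of_nat N"
      unfolding sum_divide_distrib
    proof (intro sum.cong refl)
      fix i assume "i \<in> {..<N}"
      then have "w ^ (N - i) * w ^ i = 1" using w(1) by (simp flip: power_add)
      then have "w ^ (N - i) = 1 / w ^ i" using w0 by (simp add: field_simps)
      then show "w ^ (N - i) / of_nat N * w' ^ i = (w' / w) ^ i / of_nat N"
        by (simp add: power_divide)
    qed
    also have "\<dots> = (if w = w' then 1 else 0)"
    proof (cases "w = w'")
      case True
      then show ?thesis using w0 Y(5) by simp
    next
      case False
      then have "w' / w \<noteq> 1" using w0 by auto
      moreover have "(w' / w) ^ N = 1" using w by (simp add: power_divide)
      ultimately show ?thesis using False by (simp add: geometric_sum)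
    qed
    finally show ?thesis using PM by auto
  qed
qed

text \<open>If X is diagonalised by its spectral projections, the trace is a sum of d roots of unity,
  and its modulus is d only if they all agree.\<close>
lemma finite_order_trace_bound_scalar:
  assumes X: "X \<in> M" and Y: "\<And>i. Y i \<in> M" "Y 0 = I" "\<And>i. X * Y i = Y (Suc i)" "Y N = I" "N > 0"
    and tr: "cmod (tr X) = real d" and d: "d > 0"
  shows "\<exists>c. X = c \<cdot>\<^sub>m I"
proof -
  define P where "P = (\<lambda>w. msum d (\<lambda>i. (w ^ (N - i) / of_nat N) \<cdot>\<^sub>m Y i) {..<N})"
  define R where "R = {w::complex. w ^ N = 1}"
  have "\<And>i. Y i * I = Y i" "\<And>i. I * Y i = Y i" using Y(1) by auto
  note S' = spectral_projections[OF X Y this, folded P_def R_def]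
  have Pw: "P w = msum d (\<lambda>i. (w ^ (N - i) / of_nat N) \<cdot>\<^sub>m Y i) {..<N}" for w by (simp add: P_def)
  note S = S'[folded Pw]
  have R: "w \<in> R \<longleftrightarrow> w ^ N = 1" for w by (simp add: R_def)
  have fR: "finite R" unfolding R_def by (rule finite_roots_unity'[OF Y(5)])
  have "\<exists>n::nat. tr (P w) = of_nat n \<and> (n = 0 \<longrightarrow> P w = Om)" if "w \<in> R" for w
    using that S by (intro idempotent_trace) (auto simp: R)
  then obtain n :: "complex \<Rightarrow> nat" where n: "\<And>w. w \<in> R \<Longrightarrow> tr (P w) = of_nat (n w)"
      "\<And>w. w \<in> R \<Longrightarrow> n w = 0 \<Longrightarrow> P w = Om" by metis
  have sumn: "(\<Sum>w\<in>R. of_nat (n w)) = (of_nat d :: complex)"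
  proof -
    have "(of_nat d :: complex) = tr (msum d P R)" using S(5) by simp
    also have "\<dots> = (\<Sum>w\<in>R. tr (P w))" using S(1) by (simp add: tr_msum)
    finally show ?thesis using n(1) by simp
  qed
  have XP: "X = msum d (\<lambda>w. w \<cdot>\<^sub>m P w) R"
  proof -
    have "X = X * msum d P R" using X S(5) by simp
    also have "\<dots> = msum d (\<lambda>w. X * P w) R" using X S(1) by (simp add: msum_mult_left)
    also have "\<dots> = msum d (\<lambda>w. w \<cdot>\<^sub>m P w) R" by (rule msum_cong) (auto simp: R S(2))
    finally show ?thesis .
  qed
  have "tr X = (\<Sum>w\<in>R. tr (w \<cdot>\<^sub>m P w))" unfolding XP using S(1) by (simp add: tr_msum)
  also have "\<dots> = (\<Sum>w\<in>R. of_nat (n w) * w)" using S(1) n(1) by (simp add: mult.commute)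
  finally have trX: "tr X = (\<Sum>w\<in>R. of_nat (n w) * w)" .
  \<comment> \<open>The mean of the eigenvalues, of modulus 1 by hypothesis. The nonnegative numbers
    \<open>n w * (1 - Re (cnj u * w))\<close> sum to 0, so every eigenvalue w that occurs has
    \<open>cnj u * w\<close> = 1, that is w = u.\<close>
  define u where "u = tr X / of_nat d"
  have ud: "u * of_nat d = tr X" using d by (simp add: u_def)
  have u1: "cmod u = 1" using tr d by (simp add: u_def norm_divide)
  have w1: "cmod w = 1" if "w \<in> R" for w
    using that Y(5) by (simp add: R) (metis norm_one norm_power power_eq_1_iff norm_ge_zero not_gr_zero)
  have "n w * (1 - Re (cnj u * w)) = 0" if w: "w \<in> R" for w
  proof -
    have nn: "0 \<le> real (n w) * (1 - Re (cnj u * w))" if "w \<in> R" for w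
    proof -
      have "Re (cnj u * w) \<le> cmod (cnj u * w)" by (rule complex_Re_le_cmod)
      then show ?thesis using u1 w1[OF that] by (simp add: norm_mult)
    qed
    have "(\<Sum>w\<in>R. of_nat (n w) * (1 - cnj u * w)) = (\<Sum>w\<in>R. of_nat (n w)) - cnj u * tr X"
      unfolding trX by (simp add: sum_distrib_left right_diff_distrib sum_subtractf mult_ac)
    also have "\<dots> = of_nat d - (u * cnj u) * of_nat d" unfolding sumn ud[symmetric] by (simp add: mult_ac)
    also have "\<dots> = 0" using u1 by (simp add: complex_norm_square[symmetric])
    finally have "(\<Sum>w\<in>R. real (n w) * (1 - Re (cnj u * w))) = 0"
      by (auto dest!: arg_cong[of _ _ Re])
    then show ?thesis using nn fR w by (simp add: sum_nonneg_eq_0_iff)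
  qed
  then have wu: "w = u" if "w \<in> R" "n w \<noteq> 0" for w
  proof -
    have "Re (cnj u * w) = 1" using that \<open>\<And>w. w \<in> R \<Longrightarrow> n w * (1 - Re (cnj u * w)) = 0\<close>[of w] by simp
    moreover have "cmod (cnj u * w) = 1" using u1 w1[OF that(1)] by (simp add: norm_mult)
    ultimately have "cnj u * w = 1"
      by (metis (no_types, lifting) cmod_eq_Re complex_eqI one_complex.sel cmod_power2 power_one add_cancel_right_right zero_eq_power2)
    then have "(u * cnj u) * w = u" by (simp add: mult_ac)
    then show ?thesis using u1 by (simp add: complex_norm_square[symmetric])
  qed
  have "X = msum d (\<lambda>w. u \<cdot>\<^sub>m P w) R" unfolding XP
  proof (rule msum_cong[OF refl])
    fix w assume "w \<in> R"
    then show "w \<cdot>\<^sub>m P w = u \<cdot>\<^sub>m P w" using wu n(2) by (cases "n w = 0") auto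
  qed
  also have "\<dots> = u \<cdot>\<^sub>m I" using S(1,5) by (simp add: msum_smult)
  finally show ?thesis by blast
qed

end

section \<open>Schur orthogonality\<close>

text \<open>Irreducibility is encoded by the conclusion of Schur's lemma. In this form it passes to
  conjugate representations by plain matrix algebra, without transporting invariant
  subspaces.\<close>

locale schur_rep = group G + square_mats d for G (structure) and d +
  fixes \<rho> :: "'a \<Rightarrow> complex mat"
  assumes fin: "finite (carrier G)" and rep: "is_rep G d \<rho>" and dpos: "d > 0"
    and schur: "\<And>A. A \<in> M \<Longrightarrow> (\<And>g. g \<in> carrier G \<Longrightarrow> \<rho> g * A = A * \<rho> g) \<Longrightarrow> \<exists>c. A = c \<cdot>\<^sub>m I"
begin

lemma rho [simp]: "g \<in> carrier G \<Longrightarrow> \<rho> g \<in> M" "\<rho> \<one> = I"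
  "g \<in> carrier G \<Longrightarrow> h \<in> carrier G \<Longrightarrow> \<rho> (g \<otimes> h) = \<rho> g * \<rho> h"
  using rep by (auto simp: is_rep_def)

lemma rho_inv [simp]: "g \<in> carrier G \<Longrightarrow> \<rho> g * \<rho> (inv g) = I" "g \<in> carrier G \<Longrightarrow> \<rho> (inv g) * \<rho> g = I"
  by (metis inv_closed r_inv l_inv rho(2,3))+

lemma rho_inv_left [simp]:
  assumes "g \<in> carrier G" "A \<in> M"
  shows "\<rho> g * (\<rho> (inv g) * A) = A" "\<rho> (inv g) * (\<rho> g * A) = A"
  using assms mat_assoc[of "\<rho> g" "\<rho> (inv g)" A] mat_assoc[of "\<rho> (inv g)" "\<rho> g" A] by simp_all

lemma card_pos: "card (carrier G) > 0"
  using fin by (simp add: card_gt_0_iff) (use one_closed in blast)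

text \<open>Left translation by h permutes T. A subgroup T is allowed because the descent averages
  over smaller and smaller subgroups.\<close>

lemma average_commutes:
  assumes T: "subgroup T G" and A: "A \<in> M" and h: "h \<in> T"
  defines "S \<equiv> msum d (\<lambda>g. \<rho> g * A * \<rho> (inv g)) T"
  shows "\<rho> h * S = S * \<rho> h"
proof -
  have Tc: "g \<in> carrier G" if "g \<in> T" for g using subgroup.mem_carrier[OF T that] .
  have hc: "h \<in> carrier G" using Tc[OF h] .
  have bij: "bij_betw (\<lambda>g. h \<otimes> g) T T"
  proof (rule bij_betwI[of _ _ _ "\<lambda>g. inv h \<otimes> g"])
    show "(\<lambda>g. h \<otimes> g) \<in> T \<rightarrow> T" "(\<lambda>g. inv h \<otimes> g) \<in> T \<rightarrow> T"
      using h subgroup.m_closed[OF T] subgroup.m_inv_closed[OF T] by auto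
  qed (use Tc hc in \<open>auto simp: m_assoc[symmetric]\<close>)
  have "\<rho> h * S = msum d (\<lambda>g. \<rho> h * (\<rho> g * A * \<rho> (inv g))) T"
    unfolding S_def using A Tc hc by (intro msum_mult_left) auto
  also have "\<dots> = msum d (\<lambda>g. (\<rho> (h \<otimes> g) * A * \<rho> (inv (h \<otimes> g))) * \<rho> h) T"
  proof (rule msum_cong[OF refl])
    fix g assume g: "g \<in> T"
    have "\<rho> (inv (h \<otimes> g)) * \<rho> h = \<rho> (inv g)"
      using Tc[OF g] hc by (simp add: inv_mult_group mat_assoc)
    then show "\<rho> h * (\<rho> g * A * \<rho> (inv g)) = (\<rho> (h \<otimes> g) * A * \<rho> (inv (h \<otimes> g))) * \<rho> h"
      using Tc[OF g] hc A by (simp add: mat_assoc)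
  qed
  also have "\<dots> = msum d (\<lambda>g. (\<rho> g * A * \<rho> (inv g)) * \<rho> h) T"
    by (rule msum_reindex[OF bij, of "\<lambda>g. (\<rho> g * A * \<rho> (inv g)) * \<rho> h"])
  also have "\<dots> = S * \<rho> h"
    unfolding S_def using A Tc hc by (intro msum_mult_right[symmetric]) auto
  finally show ?thesis .
qed

lemma average_scalar:
  assumes A: "A \<in> M"
  shows "msum d (\<lambda>g. \<rho> g * A * \<rho> (inv g)) (carrier G) = (of_nat (card (carrier G)) * tr A / of_nat d) \<cdot>\<^sub>m I"
proof -
  define S where "S = msum d (\<lambda>g. \<rho> g * A * \<rho> (inv g)) (carrier G)"
  have "S \<in> M" by (simp add: S_def)
  moreover have "\<rho> g * S = S * \<rho> g" if "g \<in> carrier G" for g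
    unfolding S_def by (rule average_commutes[OF subgroup_self A that])
  ultimately obtain c where c: "S = c \<cdot>\<^sub>m I" using schur by blast
  have "tr S = (\<Sum>g\<in>carrier G. tr (\<rho> g * A * \<rho> (inv g)))"
    unfolding S_def using A by (intro tr_msum) auto
  also have "\<dots> = of_nat (card (carrier G)) * tr A" using A by (simp add: tr_conj mat_assoc)
  finally have "c * of_nat d = of_nat (card (carrier G)) * tr A" using c by simp
  then have "c = of_nat (card (carrier G)) * tr A / of_nat d" using dpos by (simp add: field_simps)
  then show ?thesis using c S_def by simp
qed

text \<open>The sum is entry (i, j) of the average over the group of the elementary matrix at (k,
  l), and such an average is a scalar matrix known from its trace.\<close>

lemma schur_orthogonality:
  assumes "i < d" "j < d" "k < d" "l < d"
  shows "(\<Sum>g\<in>carrier G. \<rho> g $$ (i, k) * \<rho> (inv g) $$ (l, j)) =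
    (if i = j \<and> k = l then of_nat (card (carrier G)) / of_nat d else 0)"
proof -
  define A where "A = mat d d (\<lambda>(a, b). if a = k \<and> b = l then 1 else (0::complex))"
  have A: "A \<in> M" by (simp add: A_def)
  have "(\<rho> g * A * \<rho> (inv g)) $$ (i, j) = \<rho> g $$ (i, k) * \<rho> (inv g) $$ (l, j)" if g: "g \<in> carrier G" for g
  proof -
    have dims: "dim_row (\<rho> g) = d" "dim_col (\<rho> g) = d" "dim_row (\<rho> (inv g)) = d" "dim_col (\<rho> (inv g)) = d"
      using carrier_matD[OF rho(1)[OF g]] carrier_matD[OF rho(1)[OF inv_closed[OF g]]] by auto
    have "(\<rho> g * A) $$ (i, b) = (if b = l then \<rho> g $$ (i, k) else 0)" if "b < d" for b
      using assms that dims by (auto simp: A_def scalar_prod_def if_distrib[of "\<lambda>x. _ * x"] cong: if_cong)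
    then have "(\<rho> g * A * \<rho> (inv g)) $$ (i, j) = (\<Sum>b<d. (if b = l then \<rho> g $$ (i, k) else 0) * \<rho> (inv g) $$ (b, j))"
      using assms dims by (auto simp: scalar_prod_def lessThan_atLeast0 A_def intro!: sum.cong)
    also have "\<dots> = (\<Sum>b<d. if b = l then \<rho> g $$ (i, k) * \<rho> (inv g) $$ (b, j) else 0)"
      by (intro sum.cong) auto
    finally show ?thesis using assms by simp
  qed
  then have "(\<Sum>g\<in>carrier G. \<rho> g $$ (i, k) * \<rho> (inv g) $$ (l, j)) =
     msum d (\<lambda>g. \<rho> g * A * \<rho> (inv g)) (carrier G) $$ (i, j)"
    using assms by (simp add: msum_def)
  also have "\<dots> = (of_nat (card (carrier G)) * tr A / of_nat d) * (if i = j then 1 else 0)"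
    unfolding average_scalar[OF A] using assms by simp
  also have "tr A = (if k = l then 1 else 0)"
  proof -
    have "tr A = (\<Sum>a<d. if a = k then (if k = l then 1 else 0) else 0)"
      unfolding mat_trace_def by (auto simp: A_def intro!: sum.cong)
    then show ?thesis using assms by simp
  qed
  finally show ?thesis by auto
qed

lemma character_norm:
  "(\<Sum>g\<in>carrier G. tr (\<rho> g) * tr (\<rho> (inv g))) = of_nat (card (carrier G))"
proof -
  have dim: "dim_row (\<rho> g) = d" if "g \<in> carrier G" for g using carrier_matD[OF rho(1)[OF that]] by auto
  have "(\<Sum>g\<in>carrier G. tr (\<rho> g) * tr (\<rho> (inv g))) =
      (\<Sum>g\<in>carrier G. \<Sum>i<d. \<Sum>j<d. \<rho> g $$ (i, i) * \<rho> (inv g) $$ (j, j))"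
    by (intro sum.cong refl) (simp add: mat_trace_def dim sum_product)
  also have "\<dots> = (\<Sum>i<d. \<Sum>g\<in>carrier G. \<Sum>j<d. \<rho> g $$ (i, i) * \<rho> (inv g) $$ (j, j))"
    by (rule sum.swap)
  also have "\<dots> = (\<Sum>i<d. \<Sum>j<d. \<Sum>g\<in>carrier G. \<rho> g $$ (i, i) * \<rho> (inv g) $$ (j, j))"
    by (intro sum.cong refl sum.swap)
  also have "\<dots> = (\<Sum>i<d. \<Sum>j<d. if i = j then of_nat (card (carrier G)) / of_nat d else 0)"
    by (intro sum.cong refl) (simp add: schur_orthogonality)
  also have "\<dots> = of_nat (card (carrier G))" using dpos by simp
  finally show ?thesis .
qed

text \<open>The form in which orthogonality yields surjectivity over a subfield: the coefficients
  are traces, so up to a rational factor they stay in any field containing the entries of A and of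
  the matrices \<open>\<rho> g\<close>.\<close>

lemma fourier_inversion:
  assumes A: "A \<in> M"
  shows "A = msum d (\<lambda>g. (of_nat d / of_nat (card (carrier G)) * tr (A * \<rho> (inv g))) \<cdot>\<^sub>m \<rho> g) (carrier G)"
proof (rule eq_matI)
  let ?R = "msum d (\<lambda>g. (of_nat d / of_nat (card (carrier G)) * tr (A * \<rho> (inv g))) \<cdot>\<^sub>m \<rho> g) (carrier G)"
  fix i j assume "i < dim_row ?R" "j < dim_col ?R"
  then have ij: "i < d" "j < d" by (auto simp: msum_def)
  let ?c = "of_nat d / of_nat (card (carrier G)) :: complex"
  have dims: "dim_row (\<rho> g) = d" "dim_col (\<rho> g) = d" if "g \<in> carrier G" for g
    using carrier_matD[OF rho(1)[OF that]] by auto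
  have "?R $$ (i, j) = (\<Sum>g\<in>carrier G. ?c * tr (A * \<rho> (inv g)) * \<rho> g $$ (i, j))"
    using ij dims by (simp add: msum_def)
  also have "\<dots> = (\<Sum>g\<in>carrier G. \<Sum>a<d. \<Sum>b<d. ?c * A $$ (a, b) * (\<rho> g $$ (i, j) * \<rho> (inv g) $$ (b, a)))"
  proof (intro sum.cong refl)
    fix g assume g: "g \<in> carrier G"
    have "tr (A * \<rho> (inv g)) = (\<Sum>a<d. \<Sum>b<d. A $$ (a, b) * \<rho> (inv g) $$ (b, a))"
      using A dims[of "inv g"] g by (auto simp: mat_trace_def scalar_prod_def lessThan_atLeast0 intro!: sum.cong)
    then show "?c * tr (A * \<rho> (inv g)) * \<rho> g $$ (i, j) =
        (\<Sum>a<d. \<Sum>b<d. ?c * A $$ (a, b) * (\<rho> g $$ (i, j) * \<rho> (inv g) $$ (b, a)))"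
      by (simp add: sum_distrib_left sum_distrib_right mult_ac)
  qed
  also have "\<dots> = (\<Sum>a<d. \<Sum>g\<in>carrier G. \<Sum>b<d. ?c * A $$ (a, b) * (\<rho> g $$ (i, j) * \<rho> (inv g) $$ (b, a)))"
    by (rule sum.swap)
  also have "\<dots> = (\<Sum>a<d. \<Sum>b<d. \<Sum>g\<in>carrier G. ?c * A $$ (a, b) * (\<rho> g $$ (i, j) * \<rho> (inv g) $$ (b, a)))"
    by (intro sum.cong refl sum.swap)
  also have "\<dots> = (\<Sum>a<d. \<Sum>b<d. ?c * A $$ (a, b) * (if i = a \<and> j = b then of_nat (card (carrier G)) / of_nat d else 0))"
    using ij by (intro sum.cong refl, unfold sum_distrib_left[symmetric]) (subst schur_orthogonality; simp)
  also have "\<dots> = (\<Sum>a<d. \<Sum>b<d. if a = i then (if b = j then A $$ (i, j) else 0) else 0)"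
    using dpos card_pos by (intro sum.cong refl) auto
  also have "\<dots> = A $$ (i, j)"
  proof -
    have "(\<Sum>b<d. if a = i then (if b = j then A $$ (i, j) else 0) else 0) = (if a = i then A $$ (i, j) else 0)" for a
      using ij by simp
    then show ?thesis using ij by simp
  qed
  finally show "A $$ (i, j) = ?R $$ (i, j)" by simp
qed (use A in \<open>auto simp: msum_def\<close>)

lemma rho_power: "g \<in> carrier G \<Longrightarrow> \<rho> (g [^] Suc n) = \<rho> g * \<rho> (g [^] n)"
  by (subst nat_pow_Suc2) simp_all

lemma trace_modulus_scalar:
  assumes "g \<in> carrier G" "cmod (tr (\<rho> g)) = real d"
  shows "\<exists>c. \<rho> g = c \<cdot>\<^sub>m I"
proof (rule finite_order_trace_bound_scalar[of _ "\<lambda>i. \<rho> (g [^] i)" "card (carrier G)"])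
  show "\<rho> (g [^] card (carrier G)) = I"
    using pow_order_eq_1[OF assms(1)] by (simp add: Coset.order_def)
qed (use assms dpos card_pos rho_power in auto)

end

lemma irreducible_rep_schur:
  assumes G: "group G" "finite (carrier G)" and irr: "irreducible_rep G d \<rho>"
  shows "schur_rep G d \<rho>"
proof -
  interpret group G by (rule G(1))
  interpret square_mats d .
  have rep: "is_rep G d \<rho>" and d: "d > 0" using irr by (auto simp: irreducible_rep_def)
  have "\<exists>c. A = c \<cdot>\<^sub>m I" if A: "A \<in> M" and com: "\<And>g. g \<in> carrier G \<Longrightarrow> \<rho> g * A = A * \<rho> g" for A
  proof -
    obtain es where es: "char_poly A = (\<Prod>e\<leftarrow>es. [:- e, 1:])" "length es = d"
      using char_poly_factorized[OF A] by blast
    then obtain c where c: "c \<in> set es" using d by (metis length_greater_0_conv list.set_sel(1))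
    have "poly (char_poly A) c = 0" unfolding es(1) using c by (simp add: poly_prod_list prod_list_zero_iff)
    then have "eigenvalue A c" using eigenvalue_root_char_poly[OF A] by simp
    then obtain v where v: "v \<in> carrier_vec d" "v \<noteq> 0\<^sub>v d" "A *\<^sub>v v = c \<cdot>\<^sub>v v"
      using A unfolding eigenvalue_def eigenvector_def by auto
    define W where "W = {v \<in> carrier_vec d. A *\<^sub>v v = c \<cdot>\<^sub>v v}"
    have "is_subspace d W"
      unfolding is_subspace_def W_def using A
      by (auto simp: mult_add_distrib_mat_vec smult_add_distrib_vec mult_mat_vec smult_smult_assoc mult.commute)
    moreover have "\<rho> g *\<^sub>v w \<in> W" if g: "g \<in> carrier G" and w: "w \<in> W" for g w
    proof -
      have rg: "\<rho> g \<in> M" using rep g by (simp add: is_rep_def)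
      have "A *\<^sub>v (\<rho> g *\<^sub>v w) = (A * \<rho> g) *\<^sub>v w" using A rg w by (simp add: W_def)
      also have "\<dots> = \<rho> g *\<^sub>v (A *\<^sub>v w)" using A rg w by (simp add: W_def flip: com[OF g])
      also have "\<dots> = c \<cdot>\<^sub>v (\<rho> g *\<^sub>v w)" using rg w by (simp add: W_def mult_mat_vec)
      finally show ?thesis using rg w by (simp add: W_def)
    qed
    ultimately have "W = {0\<^sub>v d} \<or> W = carrier_vec d" using irr by (auto simp: irreducible_rep_def)
    moreover have "v \<in> W" using v by (simp add: W_def)
    ultimately have W: "W = carrier_vec d" using v(2) by auto
    have "A = c \<cdot>\<^sub>m I"
    proof (rule eq_matI)
      fix i j assume "i < dim_row (c \<cdot>\<^sub>m I)" "j < dim_col (c \<cdot>\<^sub>m I)"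
      then have ij: "i < d" "j < d" by auto
      have "unit_vec d j \<in> W" unfolding W by simp
      then have "A *\<^sub>v unit_vec d j = c \<cdot>\<^sub>v unit_vec d j" by (simp add: W_def)
      then have "(A *\<^sub>v unit_vec d j) $ i = (c \<cdot>\<^sub>v unit_vec d j) $ i" by simp
      moreover have "(A *\<^sub>v unit_vec d j) $ i = A $$ (i, j)"
        using A ij by (auto simp: scalar_prod_right_unit)
      ultimately show "A $$ (i, j) = (c \<cdot>\<^sub>m I) $$ (i, j)" using ij by (auto simp: unit_vec_def)
    qed (use A in auto)
    then show ?thesis by blast
  qed
  then show ?thesis using G rep d by unfold_locales auto
qed

text \<open>Multiplication by an element c permutes C; comparing the product over C before and after
  shows that c to the power |C| is 1, and counting gives equality.\<close>

lemma finite_mult_closed_roots_unity: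
  fixes C :: "complex set"
  assumes "finite C" "C \<noteq> {}" "0 \<notin> C" "\<And>a b. a \<in> C \<Longrightarrow> b \<in> C \<Longrightarrow> a * b \<in> C"
  shows "C = {z. z ^ card C = 1}"
proof (rule card_subset_eq)
  have pos: "card C > 0" using assms(1,2) by (simp add: card_gt_0_iff)
  show "finite {z::complex. z ^ card C = 1}" by (rule finite_roots_unity'[OF pos])
  show "C \<subseteq> {z. z ^ card C = 1}"
  proof
    fix c assume c: "c \<in> C"
    have inj: "inj_on ((*) c) C" using c assms(3) by (auto intro!: inj_onI)
    have "(*) c ` C = C" using c assms(1,4) inj by (intro card_subset_eq) (auto simp: card_image)
    then have "(\<Prod>x\<in>C. x) = (\<Prod>x\<in>C. c * x)" using inj by (metis prod.reindex_cong)
    also have "\<dots> = c ^ card C * (\<Prod>x\<in>C. x)" by (simp add: prod.distrib)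
    finally have "(c ^ card C - 1) * (\<Prod>x\<in>C. x) = 0" by (simp add: left_diff_distrib)
    moreover have "(\<Prod>x\<in>C. x) \<noteq> 0" using assms(1,3) by (auto simp: prod_zero_iff)
    ultimately show "c \<in> {z. z ^ card C = 1}" by simp
  qed
  show "card C = card {z::complex. z ^ card C = 1}" using pos by (simp add: card_roots_unity_eq)
qed

lemma finite_mult_closed_cyclic:
  fixes C :: "complex set"
  assumes "finite C" "C \<noteq> {}" "0 \<notin> C" "\<And>a b. a \<in> C \<Longrightarrow> b \<in> C \<Longrightarrow> a * b \<in> C"
  shows "\<exists>c\<in>C. \<forall>z\<in>C. \<exists>i::nat. z = c ^ i"
proof -
  define m where "m = card C"
  have m: "m > 0" using assms(1,2) by (simp add: card_gt_0_iff m_def)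
  have C: "C = {z. z ^ m = 1}" using finite_mult_closed_roots_unity[OF assms] by (simp add: m_def)
  show ?thesis
  proof (intro bexI ballI)
    show "cis (2 * pi / real m) \<in> C" using m by (simp add: C DeMoivre)
    fix z assume "z \<in> C"
    then have "z \<in> (\<lambda>k. cis (2 * pi * real k / real m)) ` {..<m}"
      using bij_betw_roots_unity[OF m] by (simp add: C bij_betw_def)
    then obtain k :: nat where "z = cis (2 * pi * real k / real m)" by blast
    then show "\<exists>i. z = cis (2 * pi / real m) ^ i" by (auto simp: DeMoivre mult_ac)
  qed
qed

section \<open>Realisation over the character field\<close>

text \<open>K is a parameter because the locale serves twice: with the cyclotomic field for the
  realisation, and with all complex numbers where only the matrix group attached to a corner
  matters.\<close>

locale p_schur_rep = schur_rep G d \<rho> for G (structure) and d and \<rho> :: "'a \<Rightarrow> complex mat" +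
  fixes p n :: nat and K :: "complex set"
  assumes p: "prime p" "odd p" and card_G: "card (carrier G) = p ^ n"
    and K: "is_subfield_C K" "\<And>w. w ^ p = 1 \<Longrightarrow> w \<in> K"
    and char_K: "\<And>g. g \<in> carrier G \<Longrightarrow> tr (\<rho> g) \<in> K"
begin

text \<open>The image of E carries an irreducible representation of T with character values in K from which
  \<rho> is induced; irreducibility is expressed by the commutant, inducedness by the trace of E.\<close>
definition corner :: "'a set \<Rightarrow> complex mat \<Rightarrow> bool" where
  "corner T E \<longleftrightarrow> subgroup T G \<and> E \<in> M \<and> E * E = E \<and> E \<noteq> Om \<and> (\<forall>t\<in>T. \<rho> t * E = E * \<rho> t) \<and>
    (\<forall>A\<in>M. E * A = A \<longrightarrow> A * E = A \<longrightarrow> (\<forall>t\<in>T. \<rho> t * A = A * \<rho> t) \<longrightarrow> (\<exists>c. A = c \<cdot>\<^sub>m E)) \<and>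
    (\<forall>t\<in>T. tr (E * \<rho> t) \<in> K) \<and> tr E * of_nat (card (carrier G)) = of_nat d * of_nat (card T)"

lemma cornerD:
  assumes "corner T E"
  shows "subgroup T G" "E \<in> M" "E * E = E" "E \<noteq> Om" "\<And>t. t \<in> T \<Longrightarrow> \<rho> t * E = E * \<rho> t"
    "\<And>A. A \<in> M \<Longrightarrow> E * A = A \<Longrightarrow> A * E = A \<Longrightarrow> (\<And>t. t \<in> T \<Longrightarrow> \<rho> t * A = A * \<rho> t) \<Longrightarrow> \<exists>c. A = c \<cdot>\<^sub>m E"
    "\<And>t. t \<in> T \<Longrightarrow> tr (E * \<rho> t) \<in> K" "tr E * of_nat (card (carrier G)) = of_nat d * of_nat (card T)"
    "\<And>t. t \<in> T \<Longrightarrow> t \<in> carrier G"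
    "\<And>A. A \<in> M \<Longrightarrow> E * (E * A) = E * A" "\<And>t A. t \<in> T \<Longrightarrow> A \<in> M \<Longrightarrow> \<rho> t * (E * A) = E * (\<rho> t * A)"
proof -
  note D = assms[unfolded corner_def]
  show 1: "subgroup T G" "E \<in> M" "E * E = E" "E \<noteq> Om" "\<And>t. t \<in> T \<Longrightarrow> \<rho> t * E = E * \<rho> t"
    "\<And>A. A \<in> M \<Longrightarrow> E * A = A \<Longrightarrow> A * E = A \<Longrightarrow> (\<And>t. t \<in> T \<Longrightarrow> \<rho> t * A = A * \<rho> t) \<Longrightarrow> \<exists>c. A = c \<cdot>\<^sub>m E"
    "\<And>t. t \<in> T \<Longrightarrow> tr (E * \<rho> t) \<in> K" "tr E * of_nat (card (carrier G)) = of_nat d * of_nat (card T)"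
    using D by blast+
  show 2: "t \<in> carrier G" if "t \<in> T" for t using subgroup.mem_carrier[OF 1(1) that] .
  show "E * (E * A) = E * A" if "A \<in> M" for A using 1 that mat_assoc[of E E A] by simp
  show "\<rho> t * (E * A) = E * (\<rho> t * A)" if "t \<in> T" "A \<in> M" for t A
    using 1(2) 1(5)[OF that(1)] that(2) 2[OF that(1)] mat_assoc[of "\<rho> t" E A] mat_assoc[of E "\<rho> t" A] by simp
qed

text \<open>The image of T in its action on the range of E, as a group of d x d matrices whose
  identity is E instead of the unit matrix.\<close>

definition corner_group :: "'a set \<Rightarrow> complex mat \<Rightarrow> complex mat monoid" where
  "corner_group T E = \<lparr>carrier = (\<lambda>t. \<rho> t * E) ` T, monoid.mult = (*), one = E\<rparr>"

lemma corner_group_simps [simp]: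
  "carrier (corner_group T E) = (\<lambda>t. \<rho> t * E) ` T" "monoid.mult (corner_group T E) = (*)" "one (corner_group T E) = E"
  by (simp_all add: corner_group_def)

lemma corner_group_hom:
  assumes "corner T E"
  shows "group (corner_group T E)" "(\<lambda>t. \<rho> t * E) \<in> hom (G\<lparr>carrier := T\<rparr>) (corner_group T E)"
proof -
  note C = cornerD[OF assms]
  have mult: "(\<rho> s * E) * (\<rho> t * E) = \<rho> (s \<otimes> t) * E" if "s \<in> T" "t \<in> T" for s t
  proof -
    have "E * (\<rho> t * E) = \<rho> t * E" using C(5)[OF that(2)] C(10)[of "\<rho> t"] C(9)[OF that(2)] by simp
    then show ?thesis using C(2) C(9)[OF that(1)] C(9)[OF that(2)] by (simp add: mat_assoc)
  qed
  have ME: "\<rho> s * E \<in> M" if "s \<in> T" for s using that C by simp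
  show "group (corner_group T E)"
  proof (rule groupI, unfold corner_group_simps)
    fix x y z assume x: "x \<in> (\<lambda>t. \<rho> t * E) ` T" and y: "y \<in> (\<lambda>t. \<rho> t * E) ` T" and z: "z \<in> (\<lambda>t. \<rho> t * E) ` T"
    obtain s t where st: "x = \<rho> s * E" "s \<in> T" "y = \<rho> t * E" "t \<in> T" using x y by blast
    then show "x * y \<in> (\<lambda>t. \<rho> t * E) ` T" using mult[OF st(2,4)] subgroup.m_closed[OF C(1) st(2,4)] by auto
    show "x * y * z = x * (y * z)" using x y z ME by (auto intro: mat_assoc)
  next
    show "E \<in> (\<lambda>t. \<rho> t * E) ` T" using C(2) subgroup.one_closed[OF C(1)] by (intro image_eqI[of _ _ \<one>]) auto
  next
    fix x assume "x \<in> (\<lambda>t. \<rho> t * E) ` T"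
    then obtain s where s: "x = \<rho> s * E" "s \<in> T" by blast
    show "E * x = x" using s C by simp
    have "\<rho> (inv s) * E * x = E" unfolding s(1)
      using mult[OF subgroup.m_inv_closed[OF C(1) s(2)] s(2)] s(2) C(2,9) by simp
    then show "\<exists>y\<in>(\<lambda>t. \<rho> t * E) ` T. y * x = E" using subgroup.m_inv_closed[OF C(1) s(2)] by blast
  qed
  show "(\<lambda>t. \<rho> t * E) \<in> hom (G\<lparr>carrier := T\<rparr>) (corner_group T E)"
    using mult by (auto simp: hom_def)
qed

lemma order_corner_group:
  assumes "corner T E"
  shows "\<exists>j. Coset.order (corner_group T E) = p ^ j"
proof -
  note C = cornerD[OF assms]
  let ?f = "\<lambda>t. \<rho> t * E"
  interpret h: group_hom "G\<lparr>carrier := T\<rparr>" "corner_group T E" ?f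
    using corner_group_hom[OF assms] subgroup_imp_group[OF C(1)]
    by (simp add: group_hom_def group_hom_axioms_def)
  let ?k = "kernel (G\<lparr>carrier := T\<rparr>) (corner_group T E) ?f"
  have "(\<lambda>X. the_elem (?f ` X)) \<in> iso (G\<lparr>carrier := T\<rparr> Mod ?k) (corner_group T E)"
    by (rule h.FactGroup_iso_set) simp
  then have "card (carrier (G\<lparr>carrier := T\<rparr> Mod ?k)) = card (carrier (corner_group T E))"
    by (auto simp: iso_def intro: bij_betw_same_card)
  moreover have "card (carrier (G\<lparr>carrier := T\<rparr> Mod ?k)) dvd card T"
    using h.G.lagrange[OF h.subgroup_kernel] by (simp add: FactGroup_def Coset.order_def) (metis dvd_triv_left)
  moreover have "card T dvd p ^ n"
    using lagrange[OF C(1)] card_G by (metis Coset.order_def dvd_triv_right)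
  ultimately have "Coset.order (corner_group T E) dvd p ^ n" by (simp add: Coset.order_def) (metis dvd_trans)
  then show ?thesis using divides_primepow_nat[OF p(1)] by blast
qed

lemma corner_nonzero: "corner T E \<Longrightarrow> t \<in> T \<Longrightarrow> \<rho> t * E \<noteq> Om"
proof
  assume a: "corner T E" "t \<in> T" "\<rho> t * E = Om"
  note C = cornerD[OF a(1)]
  have "E = \<rho> (inv t) * (\<rho> t * E)" using C(2) C(9)[OF a(2)] by simp
  then show False using a(3) C(4) C(9)[OF a(2)] by simp
qed

text \<open>The p-group lemma is applied to the finite group of matrices \<rho>(t) E; by the commutant condition
  its centre consists of multiples of E, hence is cyclic.\<close>
lemma corner_noncentral_order_p:
  assumes cor: "corner T E" and nonscalar: "t \<in> T" "\<And>c. \<rho> t * E \<noteq> c \<cdot>\<^sub>m E"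
  shows "\<exists>s\<in>T. \<rho> (s [^] p) * E = E \<and> (\<forall>c. \<rho> s * E \<noteq> c \<cdot>\<^sub>m E) \<and>
    (\<forall>g\<in>T. \<exists>c. \<rho> g * (\<rho> s * E) = c \<cdot>\<^sub>m ((\<rho> s * E) * \<rho> g))"
proof -
  note C = cornerD[OF cor]
  let ?P = "corner_group T E"
  interpret P: group ?P by (rule corner_group_hom(1)[OF cor])
  obtain j where j: "Coset.order ?P = p ^ j" using order_corner_group[OF cor] by blast
  have finT: "finite T" using fin C(1) by (meson finite_subset subgroup.subset)
  have PM: "x \<in> M" "E * x = x" "x * E = x" if "x \<in> carrier ?P" for x
    using that P.l_one[OF that] P.r_one[OF that] C by auto
  have comm: "\<rho> s * x = (\<rho> s * E) * x" "x * \<rho> s = x * (\<rho> s * E)" if "x \<in> carrier ?P" "s \<in> T" for x s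
  proof -
    show "\<rho> s * x = (\<rho> s * E) * x" using PM[OF that(1)] C(2) C(9)[OF that(2)] by (simp add: mat_assoc)
    have "x * \<rho> s = (x * E) * \<rho> s" using PM[OF that(1)] by simp
    then show "x * \<rho> s = x * (\<rho> s * E)" using PM(1)[OF that(1)] C(2) C(5,9)[OF that(2)] by (simp add: mat_assoc)
  qed
  have scal: "\<exists>c. x = c \<cdot>\<^sub>m E" if x: "x \<in> carrier ?P" and cx: "\<And>y. y \<in> carrier ?P \<Longrightarrow> y * x = x * y" for x
  proof (rule C(6))
    show "x \<in> M" "E * x = x" "x * E = x" using PM[OF x] by auto
    fix s assume s: "s \<in> T"
    then show "\<rho> s * x = x * \<rho> s" unfolding comm[OF x s] by (intro cx) auto
  qed
  have nonab: "\<exists>x\<in>carrier ?P. \<exists>y\<in>carrier ?P. x \<otimes>\<^bsub>?P\<^esub> y \<noteq> y \<otimes>\<^bsub>?P\<^esub> x"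
  proof (rule ccontr)
    assume "\<not> ?thesis"
    then have "\<exists>c. \<rho> t * E = c \<cdot>\<^sub>m E" using nonscalar(1) by (intro scal) auto
    then show False using nonscalar(2) by blast
  qed
  \<comment> \<open>The scalars c for which c E belongs to the group: a finite multiplicatively
    closed set of nonzero complex numbers, hence cyclic. A generator of it gives a generator of the
    centre.\<close>
  define S where "S = {c. c \<cdot>\<^sub>m E \<in> carrier ?P}"
  have S: "\<exists>c\<in>S. \<forall>z\<in>S. \<exists>i::nat. z = c ^ i"
  proof (rule finite_mult_closed_cyclic)
    have "inj_on (\<lambda>c. c \<cdot>\<^sub>m E) S" using smult_cancel_mat[OF C(2,4)] by (auto intro: inj_onI)
    moreover have "finite ((\<lambda>c. c \<cdot>\<^sub>m E) ` S)"
      by (rule finite_subset[of _ "carrier ?P"]) (use finT in \<open>auto simp: S_def\<close>)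
    ultimately show "finite S" by (rule finite_imageD[rotated])
    show "S \<noteq> {}" using P.one_closed by (auto simp: S_def intro!: exI[of _ 1])
    show "0 \<notin> S"
    proof
      assume "0 \<in> S"
      then obtain u where u: "0 \<cdot>\<^sub>m E = \<rho> u * E" "u \<in> T" by (auto simp: S_def)
      then show False using corner_nonzero[OF cor u(2)] C(2) by simp
    qed
    show "a * b \<in> S" if "a \<in> S" "b \<in> S" for a b
    proof -
      have "(a \<cdot>\<^sub>m E) \<otimes>\<^bsub>?P\<^esub> (b \<cdot>\<^sub>m E) \<in> carrier ?P"
        using that unfolding S_def by (intro P.m_closed) auto
      moreover have "(a \<cdot>\<^sub>m E) * (b \<cdot>\<^sub>m E) = (a * b) \<cdot>\<^sub>m E" using C(2,3) by (simp add: mult.commute)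
      ultimately show ?thesis unfolding S_def by (simp only: corner_group_simps mem_Collect_eq)
    qed
  qed
  then obtain c0 where c0: "c0 \<in> S" "\<And>z. z \<in> S \<Longrightarrow> \<exists>i::nat. z = c0 ^ i" by blast
  have center_cyclic: "\<exists>c\<in>carrier ?P. (\<forall>g\<in>carrier ?P. g \<otimes>\<^bsub>?P\<^esub> c = c \<otimes>\<^bsub>?P\<^esub> g) \<and>
      (\<forall>z\<in>carrier ?P. (\<forall>g\<in>carrier ?P. g \<otimes>\<^bsub>?P\<^esub> z = z \<otimes>\<^bsub>?P\<^esub> g) \<longrightarrow> (\<exists>i::nat. z = c [^]\<^bsub>?P\<^esub> i))"
  proof (rule bexI[of _ "c0 \<cdot>\<^sub>m E"], intro conjI ballI impI)
    show "c0 \<cdot>\<^sub>m E \<in> carrier ?P" using c0(1) by (simp only: S_def mem_Collect_eq)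
    fix g assume g: "g \<in> carrier ?P"
    show "g \<otimes>\<^bsub>?P\<^esub> (c0 \<cdot>\<^sub>m E) = (c0 \<cdot>\<^sub>m E) \<otimes>\<^bsub>?P\<^esub> g" using PM[OF g] C(2) by simp
  next
    fix z assume z: "z \<in> carrier ?P" "\<forall>g\<in>carrier ?P. g \<otimes>\<^bsub>?P\<^esub> z = z \<otimes>\<^bsub>?P\<^esub> g"
    then obtain c where c: "z = c \<cdot>\<^sub>m E" using scal[of z] by auto
    then obtain i :: nat where i: "c = c0 ^ i" using z(1) c0(2)[of c] by (auto simp only: S_def mem_Collect_eq)
    have "(c0 \<cdot>\<^sub>m E) [^]\<^bsub>?P\<^esub> k = c0 ^ k \<cdot>\<^sub>m E" for k :: nat
      by (induction k) (use C(2,3) in \<open>simp_all add: mult.commute\<close>)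
    then show "\<exists>i::nat. z = (c0 \<cdot>\<^sub>m E) [^]\<^bsub>?P\<^esub> i" using c i by metis
  qed
  obtain x where x: "x \<in> carrier ?P" "x [^]\<^bsub>?P\<^esub> p = E" "\<exists>g\<in>carrier ?P. g * x \<noteq> x * g"
      "\<And>g. g \<in> carrier ?P \<Longrightarrow> \<exists>c\<in>carrier ?P. (\<forall>h\<in>carrier ?P. h * c = c * h) \<and> g * x = c * (x * g)"
    using P.p_group_noncentral_order_p[OF p j nonab center_cyclic] by auto
  obtain s where s: "s \<in> T" "x = \<rho> s * E" using x(1) by auto
  have pows: "x [^]\<^bsub>?P\<^esub> k = \<rho> (s [^] k) * E" for k :: nat
  proof (induction k)
    case (Suc k)
    have "x [^]\<^bsub>?P\<^esub> Suc k = \<rho> (s [^] k) * (E * (\<rho> s * E))"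
      using Suc s C(2,9) by (simp add: mat_assoc)
    also have "E * (\<rho> s * E) = \<rho> s * E" using PM(2)[OF x(1)] s by simp
    finally show ?case using s C(2,9) by (simp add: mat_assoc)
  qed (use C(2) in simp)
  show ?thesis
  proof (rule bexI[OF _ s(1)], intro conjI allI ballI)
    show "\<rho> (s [^] p) * E = E" using x(2) pows by simp
    show "\<rho> s * E \<noteq> c \<cdot>\<^sub>m E" for c
    proof
      assume "\<rho> s * E = c \<cdot>\<^sub>m E"
      then have "g * x = x * g" if "g \<in> carrier ?P" for g using s(2) PM[OF that] C(2) by simp
      then show False using x(3) by blast
    qed
    fix g assume g: "g \<in> T"
    then obtain c where c: "c \<in> carrier ?P" "\<forall>h\<in>carrier ?P. h * c = c * h" "(\<rho> g * E) * x = c * (x * (\<rho> g * E))"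
      using x(4)[of "\<rho> g * E"] by auto
    obtain e where e: "c = e \<cdot>\<^sub>m E" using scal[OF c(1)] c(2) by blast
    have xg: "x * (\<rho> g * E) \<in> carrier ?P" using P.m_closed[OF x(1), of "\<rho> g * E"] g by simp
    have "\<rho> g * x = e \<cdot>\<^sub>m (x * \<rho> g)"
      unfolding comm[OF x(1) g] c(3) e using PM(1,2)[OF xg] C(2) by simp
    then show "\<exists>c. \<rho> g * (\<rho> s * E) = c \<cdot>\<^sub>m ((\<rho> s * E) * \<rho> g)" unfolding s(2) by blast
  qed
qed

text \<open>One step of the descent: E is replaced by a spectral projection of the element found above and T
  by the stabiliser of that projection. The average of the projection over T is scalar on the corner,
  which gives both its trace and the irreducibility of the smaller corner.\<close>
lemma corner_step:
  assumes cor: "corner T E" and nonscalar: "t \<in> T" "\<And>c. \<rho> t * E \<noteq> c \<cdot>\<^sub>m E"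
  shows "\<exists>T' E'. corner T' E' \<and> T' \<subset> T"
proof -
  note C = cornerD[OF cor]
  have p0: "p > 0" using p(1) by (rule prime_gt_0_nat)
  obtain t0 where t0: "t0 \<in> T" "\<rho> (t0 [^] p) * E = E" "\<And>c. \<rho> t0 * E \<noteq> c \<cdot>\<^sub>m E"
      "\<And>g. g \<in> T \<Longrightarrow> \<exists>c. \<rho> g * (\<rho> t0 * E) = c \<cdot>\<^sub>m ((\<rho> t0 * E) * \<rho> g)"
    using corner_noncentral_order_p[OF cor nonscalar] by blast
  have t0c: "t0 \<in> carrier G" using C(9)[OF t0(1)] .
  have finT: "finite T" using fin C(1) by (meson finite_subset subgroup.subset)
  have t0pow: "t0 [^] i \<in> T" for i :: nat
    by (induction i) (use t0(1) subgroup.m_closed[OF C(1)] subgroup.one_closed[OF C(1)] in auto)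
  define X where "X = \<rho> t0"
  define Y where "Y = (\<lambda>i::nat. \<rho> (t0 [^] i) * E)"
  have Er: "E * (\<rho> s * E) = \<rho> s * E" "\<rho> s * E * E = \<rho> s * E" if "s \<in> T" for s
  proof -
    show "E * (\<rho> s * E) = \<rho> s * E" using C(5)[OF that] C(10)[of "\<rho> s"] C(9)[OF that] by simp
    show "\<rho> s * E * E = \<rho> s * E" using C(2,3) C(9)[OF that] by (simp add: mat_assoc)
  qed
  have Yi: "Y i = \<rho> (t0 [^] i) * E" for i by (simp add: Y_def)
  have X: "X \<in> M" using t0c by (simp add: X_def)
  have Y: "\<And>i. Y i \<in> M" "Y 0 = E" "\<And>i. X * Y i = Y (Suc i)" "Y p = E"
    using C(2) t0c t0(2) rho_power[OF t0c] by (simp_all add: Y_def X_def mat_assoc del: nat_pow_Suc)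
  have YE: "\<And>i. Y i * E = Y i" "\<And>i. E * Y i = Y i" using Er t0pow by (simp_all add: Y_def)
  define P where "P = (\<lambda>w. msum d (\<lambda>i. (w ^ (p - i) / of_nat p) \<cdot>\<^sub>m Y i) {..<p})"
  have Pw: "P w = msum d (\<lambda>i. (w ^ (p - i) / of_nat p) \<cdot>\<^sub>m Y i) {..<p}" for w by (simp add: P_def)
  note S = spectral_projections[OF X Y p0 YE, folded P_def, folded Pw]
  obtain w where w: "w ^ p = 1" "P w \<noteq> Om"
  proof (rule ccontr)
    assume "\<not> thesis"
    then have "\<And>w. w ^ p = 1 \<Longrightarrow> P w = Om" using that by blast
    then have "msum d P {w. w ^ p = 1} = Om" by (intro msum_zero) auto
    then show False using S(5) C(4) by simp
  qed
  define E' where "E' = P w"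
  have E': "E' \<in> M" "E' * E = E'" "E * E' = E'" "E' * E' = E'" "E' \<noteq> Om"
    using S(1,3,4) S(6)[OF w(1) w(1)] w(2) by (simp_all add: E'_def)
  \<comment> \<open>Moving \<open>\<rho> s\<close> past \<open>Y 1\<close> costs a scalar om, and
    comparing at the exponent p, where \<open>Y p = E\<close>, gives om^p = 1. So
    \<open>\<rho> s\<close> carries the spectral projection for w to the one for w / om.\<close>
  have move: "\<exists>v. v ^ p = 1 \<and> \<rho> s * E' = P v * \<rho> s" if s: "s \<in> T" for s
  proof -
    have sc: "\<rho> s \<in> M" using C(9)[OF s] by simp
    obtain om where om: "\<rho> s * Y 1 = om \<cdot>\<^sub>m (Y 1 * \<rho> s)" using t0(4)[OF s] t0c by (auto simp: Y_def)
    have YS: "Y (Suc i) = Y 1 * Y i" for i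
      using Y(1)[of i] YE(2)[of i] Y(3)[of i] t0c C(2) by (simp add: Yi[of 1] Yi[of "Suc 0"] X_def mat_assoc)
    have YY: "\<rho> s * Y i = (om ^ i) \<cdot>\<^sub>m (Y i * \<rho> s)" for i
    proof (induction i)
      case 0
      show ?case using C(5)[OF s] C(2) sc by (simp add: Y(2))
    next
      case (Suc i)
      have "\<rho> s * Y (Suc i) = (\<rho> s * Y 1) * Y i" unfolding YS using sc Y(1) by (simp add: mat_assoc)
      also have "\<dots> = om \<cdot>\<^sub>m (Y 1 * (\<rho> s * Y i))" unfolding om using sc Y(1) by (simp add: mat_assoc)
      also have "\<dots> = (om ^ Suc i) \<cdot>\<^sub>m (Y (Suc i) * \<rho> s)" unfolding Suc YS[of i] using sc Y(1) by (simp add: mat_assoc)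
      finally show ?case .
    qed
    have "1 \<cdot>\<^sub>m (\<rho> s * E) = (om ^ p) \<cdot>\<^sub>m (\<rho> s * E)"
      using YY[of p] C(2) sc C(5)[OF s] by (simp add: Y(4))
    then have omp: "om ^ p = 1"
      using smult_cancel_mat[of "\<rho> s * E" 1 "om ^ p"] corner_nonzero[OF cor s] sc C(2) by simp
    then have om0: "om \<noteq> 0" using p0 by (auto simp: zero_power)
    define v where "v = w * inverse om"
    have "v ^ p = 1" using w(1) omp by (simp add: v_def power_mult_distrib power_inverse)
    moreover have "\<rho> s * E' = P v * \<rho> s"
    proof -
      have "\<rho> s * E' = msum d (\<lambda>i. \<rho> s * ((w ^ (p - i) / of_nat p) \<cdot>\<^sub>m Y i)) {..<p}"
        unfolding E'_def Pw using sc Y(1) by (intro msum_mult_left) auto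
      also have "\<dots> = msum d (\<lambda>i. ((v ^ (p - i) / of_nat p) \<cdot>\<^sub>m Y i) * \<rho> s) {..<p}"
      proof (rule msum_cong[OF refl])
        fix i assume "i \<in> {..<p}"
        then have "om ^ (p - i) * om ^ i = 1" using omp by (simp flip: power_add)
        then have "inverse om ^ (p - i) = om ^ i"
          using om0 by (simp add: power_inverse) (metis inverse_unique)
        then have "w ^ (p - i) * om ^ i = v ^ (p - i)" by (simp add: v_def power_mult_distrib)
        then show "\<rho> s * ((w ^ (p - i) / of_nat p) \<cdot>\<^sub>m Y i) = ((v ^ (p - i) / of_nat p) \<cdot>\<^sub>m Y i) * \<rho> s"
          using sc Y(1) by (simp add: YY)
      qed
      also have "\<dots> = P v * \<rho> s"
        unfolding Pw using sc Y(1) by (intro msum_mult_right[symmetric]) auto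
      finally show ?thesis .
    qed
    ultimately show ?thesis by blast
  qed
  define T' where "T' = {s \<in> T. \<rho> s * E' = E' * \<rho> s}"
  have T'D: "s \<in> T" "\<rho> s * E' = E' * \<rho> s" "s \<in> carrier G" if "s \<in> T'" for s
    using that C(9) by (auto simp: T'_def)
  have T'sub: "subgroup T' G"
  proof (rule subgroupI)
    show "T' \<subseteq> carrier G" using T'D by blast
    have "\<one> \<in> T'" using subgroup.one_closed[OF C(1)] E'(1) by (simp add: T'_def)
    then show "T' \<noteq> {}" by blast
    fix s assume s: "s \<in> T'"
    have "\<rho> (inv s) * E' = \<rho> (inv s) * ((E' * \<rho> s) * \<rho> (inv s))"
      using T'D[OF s] E'(1) by (simp add: mat_assoc)
    also have "\<dots> = E' * \<rho> (inv s)" unfolding T'D(2)[OF s, symmetric] using T'D(3)[OF s] E'(1) by (simp add: mat_assoc)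
    finally show "inv s \<in> T'" using subgroup.m_inv_closed[OF C(1) T'D(1)[OF s]] by (simp add: T'_def)
    fix u assume u: "u \<in> T'"
    have "\<rho> (s \<otimes> u) * E' = \<rho> s * (E' * \<rho> u)"
      using T'D[OF s] T'D[OF u] E'(1) by (simp add: mat_assoc)
    also have "\<dots> = (\<rho> s * E') * \<rho> u" using T'D(3)[OF s] T'D(3)[OF u] E'(1) by (simp add: mat_assoc)
    also have "\<dots> = E' * \<rho> (s \<otimes> u)" unfolding T'D(2)[OF s] using T'D(3)[OF s] T'D(3)[OF u] E'(1) by (simp add: mat_assoc)
    finally show "s \<otimes> u \<in> T'" using subgroup.m_closed[OF C(1) T'D(1)[OF s] T'D(1)[OF u]] by (simp add: T'_def)
  qed
  \<comment> \<open>Outside the stabiliser the projection is moved to one for a different root of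
    unity, and distinct spectral projections annihilate each other.\<close>
  have orth: "E' * (\<rho> s * E') = Om" if s: "s \<in> T" "s \<notin> T'" for s
  proof -
    obtain v where v: "v ^ p = 1" "\<rho> s * E' = P v * \<rho> s" using move[OF s(1)] by blast
    have "v \<noteq> w" using v(2) s by (auto simp: T'_def E'_def)
    then have "E' * P v = Om" using S(6)[OF w(1) v(1)] by (simp add: E'_def)
    moreover have "\<rho> s \<in> M" using C(9)[OF s(1)] by simp
    ultimately show ?thesis unfolding v(2) using E'(1) S(1)[of v] by (simp flip: mat_assoc)
  qed
  \<comment> \<open>If all of T commuted with \<open>E'\<close>, then \<open>E'\<close> would be a
    multiple of E by the commutant condition, and \<open>t0\<close> would act on the range of E as
    the scalar w.\<close>
  have "T' \<noteq> T"
  proof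
    assume "T' = T"
    then obtain c where c: "E' = c \<cdot>\<^sub>m E" using C(6)[OF E'(1,3,2)] T'D(2) by blast
    have "c \<noteq> 0" using c E'(5) C(2) by auto
    have "X * E' = w \<cdot>\<^sub>m E'" unfolding E'_def by (rule S(2)[OF w(1)])
    then have "c \<cdot>\<^sub>m (X * E) = c \<cdot>\<^sub>m (w \<cdot>\<^sub>m E)" using c X C(2) by (simp add: mult.commute)
    then have "inverse c \<cdot>\<^sub>m (c \<cdot>\<^sub>m (X * E)) = inverse c \<cdot>\<^sub>m (c \<cdot>\<^sub>m (w \<cdot>\<^sub>m E))" by simp
    then have "X * E = w \<cdot>\<^sub>m E" unfolding smult_smult_mat mult.assoc[symmetric] using \<open>c \<noteq> 0\<close> by simp
    then show False using t0(3) by (simp add: X_def)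
  qed
  then have psub: "T' \<subset> T" by (auto simp: T'_def)
  have finT': "finite T'" using psub finT by (auto intro: finite_subset)
  have cardT': "card T' > 0" using finT' subgroup.one_closed[OF T'sub] by (auto simp: card_gt_0_iff)
  \<comment> \<open>The average commutes with T and so equals c E. Multiplying it by
    \<open>E'\<close> on both sides kills the terms outside \<open>T'\<close> by orthogonality,
    while each term from \<open>T'\<close> gives back A; hence |T'| A = c E'. The choice A =
    \<open>E'\<close> gives the trace, a general A the commutant condition.\<close>
  have avg: "\<exists>c. msum d (\<lambda>g. \<rho> g * A * \<rho> (inv g)) T = c \<cdot>\<^sub>m E \<and> of_nat (card T') \<cdot>\<^sub>m A = c \<cdot>\<^sub>m E'"
    if A: "A \<in> M" "E' * A = A" "A * E' = A" and com: "\<And>s. s \<in> T' \<Longrightarrow> \<rho> s * A = A * \<rho> s" for A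
  proof -
    define U where "U = msum d (\<lambda>g. \<rho> g * A * \<rho> (inv g)) T"
    have inner: "\<rho> g * A * \<rho> (inv g) \<in> M" if "g \<in> T" for g using A(1) C(9)[OF that] by simp
    have EA: "E * A = A" "A * E = A"
      using A C(2) E' mat_assoc[of E E' A] mat_assoc[of A E' E] by simp_all
    have "E * U = msum d (\<lambda>g. E * (\<rho> g * A * \<rho> (inv g))) T"
      unfolding U_def using C(2) inner by (rule msum_mult_left)
    also have "\<dots> = U" unfolding U_def
    proof (rule msum_cong[OF refl])
      fix g assume g: "g \<in> T"
      have "E * (\<rho> g * A * \<rho> (inv g)) = \<rho> g * ((E * A) * \<rho> (inv g))"
        using A(1) C(2) C(9)[OF g] C(11)[OF g, of "A * \<rho> (inv g)"] by (simp add: mat_assoc)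
      then show "E * (\<rho> g * A * \<rho> (inv g)) = \<rho> g * A * \<rho> (inv g)"
        unfolding EA using A(1) C(9)[OF g] by (simp add: mat_assoc)
    qed
    finally have EU: "E * U = U" .
    have "U * E = msum d (\<lambda>g. (\<rho> g * A * \<rho> (inv g)) * E) T"
      unfolding U_def using C(2) inner by (rule msum_mult_right)
    also have "\<dots> = U" unfolding U_def
    proof (rule msum_cong[OF refl])
      fix g assume g: "g \<in> T"
      have "(\<rho> g * A * \<rho> (inv g)) * E = \<rho> g * ((A * E) * \<rho> (inv g))"
        using A(1) C(2) C(9)[OF g] C(5)[OF subgroup.m_inv_closed[OF C(1) g]] by (simp add: mat_assoc)
      then show "(\<rho> g * A * \<rho> (inv g)) * E = \<rho> g * A * \<rho> (inv g)"
        unfolding EA using A(1) C(9)[OF g] by (simp add: mat_assoc)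
    qed
    finally have UE: "U * E = U" .
    have "\<exists>c. U = c \<cdot>\<^sub>m E"
    proof (rule C(6))
      show "U \<in> M" by (simp add: U_def)
      show "\<rho> s * U = U * \<rho> s" if "s \<in> T" for s
        unfolding U_def by (rule average_commutes[OF C(1) A(1) that])
    qed (fact EU UE)+
    then obtain c where c: "U = c \<cdot>\<^sub>m E" by blast
    have "c \<cdot>\<^sub>m E' = E' * (U * E')" unfolding c using C(2) E' by simp
    also have "U * E' = msum d (\<lambda>g. (\<rho> g * A * \<rho> (inv g)) * E') T"
      unfolding U_def using E'(1) inner by (rule msum_mult_right)
    also have "E' * \<dots> = msum d (\<lambda>g. E' * ((\<rho> g * A * \<rho> (inv g)) * E')) T"
      using E'(1) inner by (intro msum_mult_left) auto
    also have "\<dots> = msum d (\<lambda>g. E' * ((\<rho> g * A * \<rho> (inv g)) * E')) T'"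
    proof (rule msum_restrict[OF finT])
      show "T' \<subseteq> T" using psub by blast
      fix g assume "g \<in> T - T'"
      then have g: "g \<in> T" "g \<notin> T'" by auto
      have "E' * ((\<rho> g * A * \<rho> (inv g)) * E') = E' * ((\<rho> g * (E' * A) * \<rho> (inv g)) * E')"
        unfolding A(2) ..
      also have "\<dots> = (E' * (\<rho> g * E')) * (A * (\<rho> (inv g) * E'))"
        using A(1) E'(1) C(9)[OF g(1)] by (simp add: mat_assoc)
      finally show "E' * ((\<rho> g * A * \<rho> (inv g)) * E') = Om"
        unfolding orth[OF g] using A(1) E'(1) C(9)[OF g(1)] by simp
    qed
    also have "\<dots> = msum d (\<lambda>g. 1 \<cdot>\<^sub>m A) T'"
    proof (rule msum_cong[OF refl])
      fix g assume g: "g \<in> T'"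
      have "\<rho> g * A * \<rho> (inv g) = A"
        unfolding com[OF g] using A(1) T'D(3)[OF g] by (simp add: mat_assoc)
      then show "E' * ((\<rho> g * A * \<rho> (inv g)) * E') = 1 \<cdot>\<^sub>m A" using A by simp
    qed
    also have "\<dots> = of_nat (card T') \<cdot>\<^sub>m A" using msum_const_mat[OF A(1), of "\<lambda>_. 1" T'] by simp
    finally show ?thesis using c unfolding U_def by metis
  qed
  have "corner T' E'"
    unfolding corner_def
  proof (intro conjI ballI impI)
    show "subgroup T' G" by (rule T'sub)
    show "E' \<in> M" "E' * E' = E'" "E' \<noteq> Om" by (fact E')+
    show "\<rho> s * E' = E' * \<rho> s" if "s \<in> T'" for s using T'D(2)[OF that] .
    show "\<exists>c. A = c \<cdot>\<^sub>m E'" if A: "A \<in> M" "E' * A = A" "A * E' = A" "\<forall>t\<in>T'. \<rho> t * A = A * \<rho> t" for A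
    proof -
      obtain c where c: "of_nat (card T') \<cdot>\<^sub>m A = c \<cdot>\<^sub>m E'" using avg[OF A(1-3)] A(4) by blast
      have "inverse (of_nat (card T')) \<cdot>\<^sub>m (of_nat (card T') \<cdot>\<^sub>m A) = (inverse (of_nat (card T')) * c) \<cdot>\<^sub>m E'"
        unfolding c by simp
      then show ?thesis using cardT' by auto
    qed
    \<comment> \<open>Expanding \<open>E'\<close> expresses this trace by traces of
      \<open>E * \<rho> (t0 [^] i \<otimes> s)\<close>, which lie in K by the old corner, with
      coefficients w^(p-i) / p.\<close>
    show "tr (E' * \<rho> s) \<in> K" if s: "s \<in> T'" for s
    proof -
      have sT: "s \<in> T" "s \<in> carrier G" using T'D[OF s] by auto
      have "tr (E' * \<rho> s) = tr (msum d (\<lambda>i. ((w ^ (p - i) / of_nat p) \<cdot>\<^sub>m Y i) * \<rho> s) {..<p})"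
        unfolding E'_def Pw using sT Y(1) by (subst msum_mult_right) auto
      also have "\<dots> = (\<Sum>i<p. w ^ (p - i) / of_nat p * tr (Y i * \<rho> s))"
        using sT Y(1) by (simp add: tr_msum)
      also have "\<dots> \<in> K"
      proof (rule subfield_sum[OF K(1)])
        fix i :: nat
        have "Y i * \<rho> s = E * (\<rho> (t0 [^] i) * \<rho> s)"
          unfolding Y_def C(5)[OF t0pow] using C(2) C(9)[OF t0pow[of i]] sT by (simp add: mat_assoc)
        also have "\<dots> = E * \<rho> (t0 [^] i \<otimes> s)" using t0c sT by simp
        finally have "tr (Y i * \<rho> s) \<in> K" using C(7)[OF subgroup.m_closed[OF C(1) t0pow sT(1)]] by simp
        moreover have "w ^ (p - i) \<in> K" by (rule subfield_power[OF K(1) K(2)[OF w(1)]])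
        ultimately show "w ^ (p - i) / of_nat p * tr (Y i * \<rho> s) \<in> K"
          using is_subfield_CD(4,7)[OF K(1)] subfield_of_nat[OF K(1)] by blast
      qed
      finally show ?thesis .
    qed
    show "tr E' * of_nat (card (carrier G)) = of_nat d * of_nat (card T')"
    proof -
      obtain c where c: "msum d (\<lambda>g. \<rho> g * E' * \<rho> (inv g)) T = c \<cdot>\<^sub>m E" "of_nat (card T') \<cdot>\<^sub>m E' = c \<cdot>\<^sub>m E'"
        using avg[OF E'(1,4,4) T'D(2)] by blast
      have "c = of_nat (card T')" using smult_cancel_mat[OF E'(1,5) c(2)] by simp
      moreover have "tr (msum d (\<lambda>g. \<rho> g * E' * \<rho> (inv g)) T) = of_nat (card T) * tr E'"
        using E'(1) C(9) by (simp add: tr_msum tr_conj mat_assoc)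
      ultimately have e: "of_nat (card T) * tr E' = of_nat (card T') * tr E"
        using c(1) C(2) by simp
      have "of_nat (card T) * (tr E' * of_nat (card (carrier G))) = (of_nat (card T) * tr E') * of_nat (card (carrier G))"
        by simp
      also have "\<dots> = of_nat (card T') * (tr E * of_nat (card (carrier G)))" unfolding e by simp
      also have "\<dots> = of_nat (card T) * (of_nat d * of_nat (card T'))" unfolding C(8) by simp
      finally have "of_nat (card T) * (tr E' * of_nat (card (carrier G))) = of_nat (card T) * (of_nat d * of_nat (card T') :: complex)" .
      moreover have "card T \<noteq> 0" using finT subgroup.one_closed[OF C(1)] by auto
      ultimately show ?thesis by simp
    qed
  qed
  then show ?thesis using psub by blast
qed

lemma corner_scalar_exists:
  "\<exists>H E. corner H E \<and> (\<forall>h\<in>H. \<exists>c. \<rho> h * E = c \<cdot>\<^sub>m E)"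
proof -
  have "corner T E \<Longrightarrow> \<exists>H E. corner H E \<and> (\<forall>h\<in>H. \<exists>c. \<rho> h * E = c \<cdot>\<^sub>m E)" for T E
  proof (induction "card T" arbitrary: T E rule: less_induct)
    case less
    have "finite T" using fin cornerD(1)[OF less.prems] by (meson finite_subset subgroup.subset)
    then show ?case using less corner_step[OF less.prems] by (metis psubset_card_mono)
  qed
  moreover have "corner (carrier G) I"
    unfolding corner_def using schur char_K dpos
  proof (intro conjI ballI impI)
    show "I \<noteq> Om"
    proof
      assume "I = Om"
      then have "I $$ (0, 0) = Om $$ (0, 0)" by simp
      then show False using dpos by simp
    qed
  qed (auto simp: subgroup_self)
  ultimately show ?thesis by blast
qed

text \<open>On a corner where everything acts by scalars, E A E is a multiple of E for every matrix A;
  taking elementary matrices A shows that E has trace 1 or -1.\<close>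
lemma monomial_vector:
  "\<exists>H v \<mu>. subgroup H G \<and> d * card H = card (carrier G) \<and> v \<in> carrier_vec d \<and> v \<noteq> 0\<^sub>v d \<and>
    (\<forall>h\<in>H. \<rho> h *\<^sub>v v = \<mu> h \<cdot>\<^sub>v v \<and> \<mu> h \<in> K)"
proof -
  obtain H E where cor: "corner H E" and scal: "\<And>h. h \<in> H \<Longrightarrow> \<exists>c. \<rho> h * E = c \<cdot>\<^sub>m E"
    using corner_scalar_exists by blast
  note C = cornerD[OF cor]
  have EAE: "\<exists>c. E * (A * E) = c \<cdot>\<^sub>m E" if A: "A \<in> M" for A
  proof (rule C(6))
    show "E * (A * E) \<in> M" using A C(2) by simp
    show "E * (E * (A * E)) = E * (A * E)" using A C(2) C(10) by simp
    show "E * (A * E) * E = E * (A * E)" using A C(2,3) by (simp add: mat_assoc)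
    fix h assume h: "h \<in> H"
    obtain c where c: "\<rho> h * E = c \<cdot>\<^sub>m E" using scal[OF h] by blast
    have "\<rho> h * (E * (A * E)) = (\<rho> h * E) * (A * E)" using A C(2) C(9)[OF h] by (simp add: mat_assoc)
    also have "\<dots> = c \<cdot>\<^sub>m (E * (A * E))" unfolding c using A C(2) by simp
    also have "\<dots> = E * (A * (c \<cdot>\<^sub>m E))" using A C(2) by simp
    also have "\<dots> = E * (A * (E * \<rho> h))" unfolding c[symmetric] C(5)[OF h] ..
    also have "\<dots> = E * (A * E) * \<rho> h" using A C(2) C(9)[OF h] by (simp add: mat_assoc)
    finally show "\<rho> h * (E * (A * E)) = E * (A * E) * \<rho> h" .
  qed
  have EE: "(\<Sum>a<d. E $$ (j, a) * E $$ (a, b)) = E $$ (j, b)" if "j < d" "b < d" for j b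
    using arg_cong[OF C(3), of "\<lambda>A. A $$ (j, b)"] C(2) that
    by (auto simp: scalar_prod_def lessThan_atLeast0)
  \<comment> \<open>For the elementary matrix A at (i, j), entry (x, y) of E A E is E_xi E_jy, which
    must equal c E_xy. Setting x = y in the reversed order and summing gives E_ji = c tr E, and this
    eliminates c.\<close>
  have rank1: "E $$ (a, i) * E $$ (j, b) * tr E = E $$ (j, i) * E $$ (a, b)"
    if ij: "i < d" "j < d" "a < d" "b < d" for i j a b
  proof -
    define A where "A = mat d d (\<lambda>(a, b). if a = i \<and> b = j then 1 else (0::complex))"
    have A: "A \<in> M" by (simp add: A_def)
    obtain c where c: "E * (A * E) = c \<cdot>\<^sub>m E" using EAE[OF A] by blast
    have "(A * E) $$ (x, y) = (if x = i then E $$ (j, y) else 0)" if "x < d" "y < d" for x y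
      using C(2) that ij by (auto simp: A_def scalar_prod_def lessThan_atLeast0[symmetric] if_distrib[of "\<lambda>x. x * _"] cong: if_cong)
    then have "(E * (A * E)) $$ (x, y) = (\<Sum>z<d. E $$ (x, z) * (if z = i then E $$ (j, y) else 0))" if "x < d" "y < d" for x y
      using C(2) A that by (auto simp: scalar_prod_def lessThan_atLeast0 intro!: sum.cong)
    also have "(\<Sum>z<d. E $$ (x, z) * (if z = i then E $$ (j, y) else 0)) = E $$ (x, i) * E $$ (j, y)" for x y
      using ij by (simp add: if_distrib[of "\<lambda>x. _ * x"] cong: if_cong)
    finally have EE': "E $$ (x, i) * E $$ (j, y) = c * E $$ (x, y)" if "x < d" "y < d" for x y
      using that c C(2) by simp
    have "E $$ (j, i) = (\<Sum>x<d. E $$ (j, x) * E $$ (x, i))" using EE ij by simp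
    also have "\<dots> = (\<Sum>x<d. c * E $$ (x, x))" by (intro sum.cong refl) (metis EE' lessThan_iff mult.commute)
    also have "\<dots> = c * tr E" using C(2) by (auto simp: mat_trace_def sum_distrib_left)
    finally have "E $$ (j, i) = c * tr E" .
    then show ?thesis using EE'[OF ij(3,4)] by simp
  qed
  obtain j b where jb: "j < d" "b < d" "E $$ (j, b) \<noteq> 0"
  proof (rule ccontr)
    assume "\<not> thesis"
    then have "\<And>j b. j < d \<Longrightarrow> b < d \<Longrightarrow> E $$ (j, b) = 0" using that by blast
    then have "E = Om" using C(2) by (intro eq_matI) auto
    then show False using C(4) by simp
  qed
  have "tr E * E $$ (j, b) * tr E = (\<Sum>a<d. E $$ (a, a) * E $$ (j, b) * tr E)"
    using C(2) by (auto simp: mat_trace_def[of E] sum_distrib_right)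
  also have "\<dots> = (\<Sum>a<d. E $$ (j, a) * E $$ (a, b))" using jb by (intro sum.cong refl) (simp add: rank1)
  also have "\<dots> = E $$ (j, b)" using EE jb by simp
  finally have "tr E * tr E = 1" using jb(3) by simp
  then have tr2: "(tr E)\<^sup>2 = 1" by (simp add: power2_eq_square)
  \<comment> \<open>The index formula for corners makes the trace a nonnegative real number, which
    rules out -1.\<close>
  define r where "r = real d * real (card H) / real (card (carrier G))"
  have r: "tr E = of_real r" using C(8) card_pos by (simp add: r_def field_simps)
  have "(of_real (r\<^sup>2) :: complex) = of_real 1" using tr2 unfolding r by simp
  then have "r\<^sup>2 = 1" by (simp only: of_real_eq_iff)
  moreover have "r \<ge> 0" by (simp add: r_def)
  ultimately have "r = 1" by (simp add: power2_eq_1_iff)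
  then have trE: "tr E = 1" using r by simp
  have "d * card H = card (carrier G)"
  proof -
    have "(of_nat (d * card H) :: complex) = of_nat (card (carrier G))" using C(8) trE by simp
    then show ?thesis by (simp only: of_nat_eq_iff)
  qed
  moreover have "col E b \<in> carrier_vec d" using carrier_matD(1)[OF C(2)] unfolding carrier_vec_def by simp
  moreover have "col E b \<noteq> 0\<^sub>v d"
  proof
    assume "col E b = 0\<^sub>v d"
    then have "col E b $ j = 0\<^sub>v d $ j" by simp
    then show False using jb C(2) by simp
  qed
  \<comment> \<open>Any nonzero column of E is a common eigenvector. As tr E = 1, the eigenvalue of
    h is the trace of \<open>E * \<rho> h\<close>, which the corner keeps in K.\<close>
  moreover have "\<rho> h *\<^sub>v col E b = tr (E * \<rho> h) \<cdot>\<^sub>v col E b \<and> tr (E * \<rho> h) \<in> K" if h: "h \<in> H" for h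
  proof -
    obtain c where c: "\<rho> h * E = c \<cdot>\<^sub>m E" using scal[OF h] by blast
    then have "tr (E * \<rho> h) = c" using C(2) trE by (simp flip: C(5)[OF h])
    moreover have "\<rho> h *\<^sub>v col E b = col (\<rho> h * E) b" using C(2) C(9)[OF h] jb by (intro col_mult2[symmetric, of _ d d _ d]) auto
    moreover have "col (c \<cdot>\<^sub>m E) b = c \<cdot>\<^sub>v col E b" using C(2) jb by (intro eq_vecI) auto
    ultimately show ?thesis using c C(7)[OF h] by simp
  qed
  ultimately show ?thesis using C(1) by (intro exI[of _ H] exI[of _ "col E b"] exI[of _ "\<lambda>h. tr (E * \<rho> h)"]) auto
qed

lemma realized_over_K:
  assumes irr: "irreducible_rep G d \<rho>"
  shows "\<exists>\<rho>'. schur_rep G d \<rho>' \<and> (\<forall>g\<in>carrier G. tr (\<rho>' g) = tr (\<rho> g) \<and> \<rho>' g \<in> mat_over d K)"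
proof -
  obtain H v \<mu> where H: "subgroup H G" "d * card H = card (carrier G)" and v: "v \<in> carrier_vec d" "v \<noteq> 0\<^sub>v d"
    and \<mu>: "\<And>h. h \<in> H \<Longrightarrow> \<rho> h *\<^sub>v v = \<mu> h \<cdot>\<^sub>v v" "\<And>h. h \<in> H \<Longrightarrow> \<mu> h \<in> K"
    using monomial_vector by blast
  have Hc: "h \<in> carrier G" if "h \<in> H" for h using subgroup.mem_carrier[OF H(1) that] .
  have finH: "finite H" using fin H(1) by (meson finite_subset subgroup.subset)
  have "card H > 0" using finH subgroup.one_closed[OF H(1)] by (auto simp: card_gt_0_iff)
  moreover have "card (rcosets H) * card H = d * card H" using lagrange[OF H(1)] H(2) by (simp add: Coset.order_def)
  ultimately have "card (rcosets H) = d" by simp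
  moreover have "finite (rcosets H)" using fin by (auto simp: RCOSETS_def)
  ultimately obtain e where e: "bij_betw e {0..<d} (rcosets H)" using ex_bij_betw_nat_finite by blast
  have "\<exists>r\<in>carrier G. e i = H #> r" if "i < d" for i
  proof -
    have "e i \<in> rcosets H" using e that by (auto simp: bij_betw_def)
    then show ?thesis by (auto simp: RCOSETS_def)
  qed
  then obtain r where r: "\<And>i. i < d \<Longrightarrow> r i \<in> carrier G" "\<And>i. i < d \<Longrightarrow> e i = H #> r i" by metis
  \<comment> \<open>Inverses of right coset representatives represent the left cosets, so each
    product g t_i factors as t_j h with h in H and the eigenvector absorbs h.\<close>
  define t where "t = (\<lambda>i. inv (r i))"
  have t: "t i \<in> carrier G" if "i < d" for i using r(1)[OF that] by (simp add: t_def)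
  have dec: "\<exists>j h. j < d \<and> h \<in> H \<and> g = t j \<otimes> h" if g: "g \<in> carrier G" for g
  proof -
    have "H #> inv g \<in> e ` {0..<d}" using g e by (auto simp: RCOSETS_def bij_betw_def)
    then obtain j where j: "j < d" "e j = H #> inv g" by auto
    have "inv g \<in> H #> inv g" using rcos_self[OF inv_closed[OF g] H(1)] .
    then obtain h where h: "h \<in> H" "inv g = h \<otimes> r j" using j r(2)[OF j(1)] by (auto simp: r_coset_def)
    have "g = inv (h \<otimes> r j)" using h(2) g by (metis inv_inv)
    also have "\<dots> = t j \<otimes> inv h" using Hc[OF h(1)] r(1)[OF j(1)] by (simp add: t_def inv_mult_group)
    finally show ?thesis using j(1) subgroup.m_inv_closed[OF H(1) h(1)] by blast
  qed
  define Q where "Q = (\<lambda>g i. SOME q. fst q < d \<and> snd q \<in> H \<and> g \<otimes> t i = t (fst q) \<otimes> snd q)"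
  define J where "J = (\<lambda>g i. fst (Q g i))"
  define h where "h = (\<lambda>g i. snd (Q g i))"
  have Jh: "J g i < d \<and> h g i \<in> H \<and> g \<otimes> t i = t (J g i) \<otimes> h g i" if i: "i < d" and g: "g \<in> carrier G" for g i
  proof -
    have "\<exists>j k. j < d \<and> k \<in> H \<and> g \<otimes> t i = t j \<otimes> k" using dec[of "g \<otimes> t i"] t[OF i] g by simp
    then have "\<exists>q. fst q < d \<and> snd q \<in> H \<and> g \<otimes> t i = t (fst q) \<otimes> snd q" by auto
    then show ?thesis unfolding J_def h_def Q_def by (rule someI_ex)
  qed
  define B where "B = mat d d (\<lambda>(a, i). (\<rho> (t i) *\<^sub>v v) $ a)"
  have B: "B \<in> M" by (simp add: B_def)
  have colB: "col B i = \<rho> (t i) *\<^sub>v v" if "i < d" for i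
    using that rho(1)[OF t[OF that]] by (intro eq_vecI) (auto simp: B_def)
  define N where "N = (\<lambda>g. mat d d (\<lambda>(a, i). if a = J g i then \<mu> (h g i) else 0))"
  have N: "N g \<in> M" for g by (simp add: N_def)
  have NK: "N g \<in> mat_over d K" if g: "g \<in> carrier G" for g
    using Jh[OF _ g] \<mu>(2) is_subfield_CD(1)[OF K(1)] by (auto simp: mat_over_def N_def)
  have act: "\<rho> g *\<^sub>v (\<rho> (t i) *\<^sub>v v) = \<mu> (h g i) \<cdot>\<^sub>v (\<rho> (t (J g i)) *\<^sub>v v)" if g: "g \<in> carrier G" and i: "i < d" for g i
  proof -
    note j = Jh[OF i g]
    have "\<rho> g *\<^sub>v (\<rho> (t i) *\<^sub>v v) = \<rho> (g \<otimes> t i) *\<^sub>v v"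
      using rho(1)[OF g] rho(1)[OF t[OF i]] g t[OF i] v(1) by (simp add: assoc_mult_mat_vec[of _ d d _ d])
    also have "\<dots> = \<rho> (t (J g i)) *\<^sub>v (\<rho> (h g i) *\<^sub>v v)"
      using j Hc[of "h g i"] t[of "J g i"] rho(1)[of "t (J g i)"] rho(1)[of "h g i"] v(1)
      by (simp add: assoc_mult_mat_vec[of _ d d _ d])
    also have "\<dots> = \<mu> (h g i) \<cdot>\<^sub>v (\<rho> (t (J g i)) *\<^sub>v v)"
      using j \<mu>(1)[of "h g i"] rho(1)[OF t[of "J g i"]] v(1) by (simp add: mult_mat_vec[of _ d d])
    finally show ?thesis .
  qed
  have BN: "\<rho> g * B = B * N g" if g: "g \<in> carrier G" for g
  proof (rule eq_matI)
    fix a i assume "a < dim_row (B * N g)" "i < dim_col (B * N g)"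
    then have ai: "a < d" "i < d" using B N[of g] by auto
    have "(\<rho> g * B) $$ (a, i) = (\<rho> g *\<^sub>v col B i) $ a"
      using B carrier_matD[OF rho(1)[OF g]] ai by simp
    also have "\<dots> = \<mu> (h g i) * B $$ (a, J g i)"
      unfolding colB[OF ai(2)] act[OF g ai(2)] using Jh[OF ai(2) g] ai rho(1)[OF t[of "J g i"]] by (simp add: B_def)
    also have "\<dots> = (\<Sum>k<d. B $$ (a, k) * (if k = J g i then \<mu> (h g i) else 0))"
      using Jh[OF ai(2) g] by (simp add: if_distrib[of "\<lambda>x. _ * x"] mult.commute cong: if_cong)
    also have "\<dots> = (B * N g) $$ (a, i)"
      using ai B by (auto simp: N_def scalar_prod_def lessThan_atLeast0 intro!: sum.cong)
    finally show "(\<rho> g * B) $$ (a, i) = (B * N g) $$ (a, i)" .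
  qed (use B N[of g] rho(1)[OF g] in auto)
  \<comment> \<open>The span of the d translates is invariant and contains v, so irreducibility
    makes it the whole space. Thus the square matrix \<open>B\<close> is invertible and conjugates
    \<open>\<rho>\<close> into the monomial matrices \<open>N g\<close>.\<close>
  define W where "W = {B *\<^sub>v x |x. x \<in> carrier_vec d}"
  have "is_subspace d W"
    unfolding is_subspace_def
  proof (intro conjI ballI allI)
    show "W \<subseteq> carrier_vec d" using B by (auto simp: W_def)
    show "0\<^sub>v d \<in> W" using B by (auto simp: W_def intro!: exI[of _ "0\<^sub>v d"])
    show "x + y \<in> W" if xy: "x \<in> W" "y \<in> W" for x y
    proof -
      obtain x' y' where "x = B *\<^sub>v x'" "x' \<in> carrier_vec d" "y = B *\<^sub>v y'" "y' \<in> carrier_vec d"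
        using xy by (auto simp: W_def)
      then show ?thesis using B by (auto simp: W_def mult_add_distrib_mat_vec[symmetric] intro!: exI[of _ "x' + y'"])
    qed
    show "c \<cdot>\<^sub>v x \<in> W" if x: "x \<in> W" for c x
    proof -
      obtain x' where "x = B *\<^sub>v x'" "x' \<in> carrier_vec d" using x by (auto simp: W_def)
      then show ?thesis using B by (auto simp: W_def mult_mat_vec[symmetric] intro!: exI[of _ "c \<cdot>\<^sub>v x'"])
    qed
  qed
  moreover have "\<rho> g *\<^sub>v w \<in> W" if g: "g \<in> carrier G" and w: "w \<in> W" for g w
  proof -
    obtain x where x: "w = B *\<^sub>v x" "x \<in> carrier_vec d" using w by (auto simp: W_def)
    have "\<rho> g *\<^sub>v w = (\<rho> g * B) *\<^sub>v x" using x B rho(1)[OF g] by (simp add: assoc_mult_mat_vec[of _ d d _ d])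
    also have "\<dots> = B *\<^sub>v (N g *\<^sub>v x)" unfolding BN[OF g] using x B N[of g] by (simp add: assoc_mult_mat_vec[of _ d d _ d])
    finally show ?thesis using x N[of g] by (auto simp: W_def)
  qed
  ultimately have "W = {0\<^sub>v d} \<or> W = carrier_vec d" using irr by (auto simp: irreducible_rep_def)
  moreover have "v \<in> W"
  proof -
    obtain j k where jk: "j < d" "k \<in> H" "\<one> = t j \<otimes> k" using dec[OF one_closed] by blast
    have "v = \<rho> \<one> *\<^sub>v v" using v(1) by simp
    also have "\<dots> = \<rho> (t j) *\<^sub>v (\<rho> k *\<^sub>v v)"
      unfolding jk(3) using Hc[OF jk(2)] t[OF jk(1)] rho(1)[OF t[OF jk(1)]] rho(1)[OF Hc[OF jk(2)]] v(1)
      by (simp add: assoc_mult_mat_vec[of _ d d _ d])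
    also have "\<dots> = \<mu> k \<cdot>\<^sub>v col B j"
      unfolding colB[OF jk(1)] \<mu>(1)[OF jk(2)] using rho(1)[OF t[OF jk(1)]] v(1) by (simp add: mult_mat_vec[of _ d d])
    also have "col B j = B *\<^sub>v unit_vec d j" using B jk(1) by (intro eq_vecI) auto
    also have "\<mu> k \<cdot>\<^sub>v (B *\<^sub>v unit_vec d j) = B *\<^sub>v (\<mu> k \<cdot>\<^sub>v unit_vec d j)"
      using B by (simp add: mult_mat_vec[of _ d d])
    finally show ?thesis by (auto simp: W_def)
  qed
  ultimately have W: "W = carrier_vec d" using v(2) by auto
  have "\<exists>x. i < d \<longrightarrow> x \<in> carrier_vec d \<and> B *\<^sub>v x = unit_vec d i" for i
  proof -
    have "unit_vec d i \<in> W" unfolding W by simp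
    then show ?thesis by (auto simp: W_def)
  qed
  then obtain x where x: "\<And>i. i < d \<Longrightarrow> x i \<in> carrier_vec d" "\<And>i. i < d \<Longrightarrow> B *\<^sub>v x i = unit_vec d i" by metis
  define C where "C = mat d d (\<lambda>(a, i). x i $ a)"
  have C: "C \<in> M" by (simp add: C_def)
  have colC: "col C i = x i" if "i < d" for i using that x(1)[OF that] by (intro eq_vecI) (auto simp: C_def)
  have BC: "B * C = I"
  proof (rule eq_matI)
    fix a i assume "a < dim_row I" "i < dim_col I"
    then have ai: "a < d" "i < d" by auto
    have "(B * C) $$ (a, i) = (B *\<^sub>v col C i) $ a" using B C ai by simp
    then show "(B * C) $$ (a, i) = I $$ (a, i)" using ai x(2)[OF ai(2)] colC[OF ai(2)] by (auto simp: unit_vec_def)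
  qed (use B C in auto)
  then have CB: "C * B = I" using mat_mult_left_right_inverse[OF B C] by simp
  have CBA: "C * (B * A) = A" "B * (C * A) = A" if "A \<in> M" for A
    using that B C BC CB mat_assoc[of C B A] mat_assoc[of B C A] by simp_all
  define \<rho>' where "\<rho>' = (\<lambda>g. C * (\<rho> g * B))"
  have eq: "\<rho>' g = N g" if "g \<in> carrier G" for g
    unfolding \<rho>'_def BN[OF that] using N CBA by simp
  have rep': "is_rep G d \<rho>'"
    unfolding is_rep_def
  proof (intro conjI ballI)
    show "\<rho>' g \<in> M" if "g \<in> carrier G" for g using that B C by (simp add: \<rho>'_def)
    show "\<rho>' \<one> = I" using B CB by (simp add: \<rho>'_def)
    show "\<rho>' (g \<otimes> k) = \<rho>' g * \<rho>' k" if "g \<in> carrier G" "k \<in> carrier G" for g k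
      using that B C CBA by (simp add: \<rho>'_def mat_assoc)
  qed
  have "schur_rep G d \<rho>'"
  proof (unfold_locales)
    show "finite (carrier G)" "is_rep G d \<rho>'" "d > 0" by (fact fin rep' dpos)+
    fix A assume A: "A \<in> M" "\<And>g. g \<in> carrier G \<Longrightarrow> \<rho>' g * A = A * \<rho>' g"
    have "\<rho> g * (B * (A * C)) = B * (A * C) * \<rho> g" if g: "g \<in> carrier G" for g
    proof -
      have "\<rho> g * (B * (A * C)) = B * (\<rho>' g * A) * C" using g A(1) B C CBA by (simp add: \<rho>'_def mat_assoc)
      also have "\<dots> = B * (A * C) * (\<rho> g * (B * C))" unfolding A(2)[OF g] using g A(1) B C by (simp add: \<rho>'_def mat_assoc)
      finally show ?thesis using g A(1) B C BC by simp
    qed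
    then obtain c where c: "B * (A * C) = c \<cdot>\<^sub>m I" using schur[of "B * (A * C)"] A(1) B C by auto
    have "A = C * ((B * (A * C)) * B)" using A(1) B C CB CBA by (simp add: mat_assoc)
    also have "\<dots> = c \<cdot>\<^sub>m I" unfolding c using B C CB by simp
    finally show "\<exists>c. A = c \<cdot>\<^sub>m I" by blast
  qed
  moreover have "tr (\<rho>' g) = tr (\<rho> g)" if "g \<in> carrier G" for g
    using that B C BC by (simp add: \<rho>'_def tr_conj)
  ultimately show ?thesis using NK eq by (metis (no_types, lifting))
qed

end

lemma is_subfield_C_UNIV: "is_subfield_C UNIV"
  by (simp add: is_subfield_C_def)

section \<open>Fully ramified characters\<close>

locale gvz_rep = schur_rep G d \<rho> for G (structure) and d and \<rho> :: "'a \<Rightarrow> complex mat" +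
  fixes p n :: nat
  assumes p: "prime p" "odd p" and card_G: "card (carrier G) = p ^ n" and d1: "d \<noteq> 1"
    and irr: "irreducible_rep G d \<rho>"
    and gvz: "\<And>g. g \<in> carrier G \<Longrightarrow> cmod (tr (\<rho> g)) \<noteq> real d \<Longrightarrow> tr (\<rho> g) = 0"
begin

definition Z where "Z = {g \<in> carrier G. \<exists>c. \<rho> g = c \<cdot>\<^sub>m I}"
text \<open>On \<open>Z\<close> this is the scalar by which the element acts, read off from one
  diagonal entry. Outside \<open>Z\<close> the value carries no meaning.\<close>

definition lam where "lam g = \<rho> g $$ (0, 0)"
definition N where "N = {g \<in> Z. lam g = 1}"
definition C where "C = lam ` Z"

lemma p_pos: "p > 0" using p(1) by (rule prime_gt_0_nat)

lemma I_nonzero: "I \<noteq> Om"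
proof
  assume "I = Om"
  then have "I $$ (0, 0) = Om $$ (0, 0)" by simp
  then show False using dpos by simp
qed

lemma rho_Z: "z \<in> Z \<Longrightarrow> \<rho> z = lam z \<cdot>\<^sub>m I"
  using dpos by (auto simp: Z_def lam_def)

lemma Z_carrier [simp]: "z \<in> Z \<Longrightarrow> z \<in> carrier G"
  by (simp add: Z_def)

lemma Z_memI: "g \<in> carrier G \<Longrightarrow> \<rho> g = c \<cdot>\<^sub>m I \<Longrightarrow> g \<in> Z \<and> lam g = c"
proof
  assume g: "g \<in> carrier G" "\<rho> g = c \<cdot>\<^sub>m I"
  show "g \<in> Z" unfolding Z_def using g by blast
  show "lam g = c" unfolding lam_def g(2) using dpos by simp
qed

lemma lam_mult: "y \<in> Z \<Longrightarrow> z \<in> Z \<Longrightarrow> y \<otimes> z \<in> Z \<and> lam (y \<otimes> z) = lam y * lam z"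
  by (rule Z_memI) (simp_all add: rho_Z mult.commute)

lemma lam_one [simp]: "\<one> \<in> Z" "lam \<one> = 1"
  using Z_memI[of \<one> 1] by simp_all

lemma lam_nonzero: "z \<in> Z \<Longrightarrow> lam z \<noteq> 0"
proof
  assume z: "z \<in> Z" "lam z = 0"
  have "I = \<rho> z * \<rho> (inv z)" using z by simp
  also have "\<dots> = Om" unfolding rho_Z[OF z(1)] using z by simp
  finally show False using I_nonzero by simp
qed

lemma lam_inv: "z \<in> Z \<Longrightarrow> inv z \<in> Z \<and> lam (inv z) = inverse (lam z)"
proof (rule Z_memI)
  assume z: "z \<in> Z"
  show "inv z \<in> carrier G" using z by simp
  have "\<rho> (inv z) = inverse (lam z) \<cdot>\<^sub>m (\<rho> (inv z) * (lam z \<cdot>\<^sub>m I))" using z lam_nonzero[OF z] by simp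
  also have "\<rho> (inv z) * (lam z \<cdot>\<^sub>m I) = I" unfolding rho_Z[OF z, symmetric] using z by simp
  finally show "\<rho> (inv z) = inverse (lam z) \<cdot>\<^sub>m I" .
qed

lemma inv_in_Z_iff: "g \<in> carrier G \<Longrightarrow> inv g \<in> Z \<longleftrightarrow> g \<in> Z"
  using lam_inv[of g] lam_inv[of "inv g"] by auto

lemma lam_pow: "z \<in> Z \<Longrightarrow> z [^] (i::nat) \<in> Z \<and> lam (z [^] i) = lam z ^ i"
  by (induction i) (auto simp: lam_mult mult.commute)

lemma subgroup_Z: "subgroup Z G"
  by (rule subgroupI) (use lam_mult lam_inv in \<open>auto intro: lam_one(1)\<close>)

lemma finite_Z: "finite Z" by (rule finite_subset[OF _ fin]) auto

lemma subgroup_lam_preimage: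
  assumes "1 \<in> R" "\<And>a b. a \<in> R \<Longrightarrow> b \<in> R \<Longrightarrow> a * b \<in> R" "\<And>a. a \<in> R \<Longrightarrow> inverse a \<in> R"
  shows "subgroup {z \<in> Z. lam z \<in> R} G"
  by (rule subgroupI) (use lam_mult lam_inv assms in \<open>auto intro!: exI[of _ \<one>]\<close>)

lemma subgroup_N: "subgroup N G"
  using subgroup_lam_preimage[of "{1}"] by (simp add: N_def)

lemma finite_N: "finite N" by (rule finite_subset[OF _ finite_Z]) (auto simp: N_def)

lemma card_N_pos: "card N > 0"
  using finite_N subgroup.one_closed[OF subgroup_N] by (auto simp: card_gt_0_iff)

lemma lam_fiber:
  assumes "c \<in> C"
  shows "card {z \<in> Z. lam z = c} = card N"
proof -
  obtain z0 where z0: "z0 \<in> Z" "lam z0 = c" using assms by (auto simp: C_def)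
  have "bij_betw (\<lambda>x. z0 \<otimes> x) N {z \<in> Z. lam z = c}"
  proof (rule bij_betwI[of _ _ _ "\<lambda>x. inv z0 \<otimes> x"])
    show "(\<lambda>x. z0 \<otimes> x) \<in> N \<rightarrow> {z \<in> Z. lam z = c}" using z0 lam_mult by (auto simp: N_def)
    show "(\<lambda>x. inv z0 \<otimes> x) \<in> {z \<in> Z. lam z = c} \<rightarrow> N"
      using z0 lam_mult[of "inv z0"] lam_inv[OF z0(1)] lam_nonzero[OF z0(1)] by (auto simp: N_def)
    show "inv z0 \<otimes> (z0 \<otimes> x) = x" if "x \<in> N" for x using that z0 by (simp add: N_def m_assoc[symmetric])
    show "z0 \<otimes> (inv z0 \<otimes> x) = x" if "x \<in> {z \<in> Z. lam z = c}" for x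
      using that z0 by (auto simp: m_assoc[symmetric])
  qed
  then show ?thesis by (simp add: bij_betw_same_card)
qed

lemma finite_C: "finite C" unfolding C_def using finite_Z by simp

lemma sum_lam:
  fixes \<phi> :: "complex \<Rightarrow> complex"
  shows "(\<Sum>z\<in>Z. \<phi> (lam z)) = of_nat (card N) * (\<Sum>c\<in>C. \<phi> c)"
proof -
  have "(\<Sum>z\<in>Z. \<phi> (lam z)) = (\<Sum>c\<in>C. \<Sum>z | z \<in> Z \<and> lam z = c. \<phi> (lam z))"
    by (rule sum.group[symmetric]) (use finite_Z finite_C in \<open>auto simp: C_def\<close>)
  also have "\<dots> = (\<Sum>c\<in>C. of_nat (card N) * \<phi> c)"
    by (intro sum.cong refl) (simp flip: lam_fiber)
  finally show ?thesis by (simp add: sum_distrib_left)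
qed

lemma card_lam_preimage:
  assumes "R \<subseteq> C"
  shows "card {z \<in> Z. lam z \<in> R} = card R * card N"
proof -
  have "(of_nat (card {z \<in> Z. lam z \<in> R}) :: complex) = (\<Sum>z\<in>Z. if lam z \<in> R then 1 else 0)"
    using finite_Z by (simp add: sum.If_cases Int_def)
  also have "\<dots> = of_nat (card N) * (\<Sum>c\<in>C. if c \<in> R then 1 else 0)"
    by (rule sum_lam[of "\<lambda>c. if c \<in> R then 1 else 0"])
  also have "(\<Sum>c\<in>C. if c \<in> R then 1 else 0) = (of_nat (card R) :: complex)"
    using finite_C assms by (simp add: sum.If_cases Int_absorb1)
  finally have "(of_nat (card {z \<in> Z. lam z \<in> R}) :: complex) = of_nat (card R * card N)" by simp
  then show ?thesis by (simp only: of_nat_eq_iff)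
qed

text \<open>The order of Z/N, counted as the number of values of \<open>lam\<close>.\<close>

definition m where "m = card C"

lemma C_roots: "C = {z. z ^ m = 1}"
  unfolding m_def
proof (rule finite_mult_closed_roots_unity[OF finite_C])
  show "C \<noteq> {}" using lam_one(1) unfolding C_def by blast
  show "0 \<notin> C" using lam_nonzero by (auto simp: C_def)
  show "a * b \<in> C" if ab: "a \<in> C" "b \<in> C" for a b
  proof -
    obtain y z where yz: "y \<in> Z" "a = lam y" "z \<in> Z" "b = lam z" using ab by (auto simp: C_def)
    then have "a * b = lam (y \<otimes> z)" "y \<otimes> z \<in> Z" using lam_mult[of y z] by auto
    then show ?thesis by (simp add: C_def)
  qed
qed

lemma card_Z: "card Z = m * card N"
proof -
  have "{z \<in> Z. lam z \<in> C} = Z" by (auto simp: C_def)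
  then show ?thesis using card_lam_preimage[of C] by (simp add: m_def)
qed

lemma card_Z_div: "card Z div card N = m"
  using card_Z card_N_pos by simp

text \<open>The image of G is a nonabelian p-group, and its centre consists of scalars.\<close>
lemma noncentral_scalar_exists: "\<exists>z\<in>Z. lam z \<noteq> 1"
proof -
  interpret U: p_schur_rep G d \<rho> p n UNIV
    by unfold_locales (use p card_G is_subfield_C_UNIV in auto)
  have cor: "U.corner (carrier G) I"
    unfolding U.corner_def using schur I_nonzero by (auto simp: subgroup_self)
  let ?P = "U.corner_group (carrier G) I"
  interpret P: group ?P by (rule U.corner_group_hom(1)[OF cor])
  obtain j where j: "Coset.order ?P = p ^ j" using U.order_corner_group[OF cor] by blast
  have "j > 0"
  proof (rule ccontr)
    assume "\<not> j > 0"
    then have "card (carrier ?P) = 1" using j by (simp add: Coset.order_def)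
    then have "carrier ?P = {\<one>\<^bsub>?P\<^esub>}" using P.one_closed by (metis card_1_singletonE singletonD)
    then have triv: "\<rho> g = I" if "g \<in> carrier G" for g using that by auto
    \<comment> \<open>If every \<open>\<rho> g\<close> were the identity, every matrix would commute
      with the image and be scalar; for d > 1 an elementary diagonal matrix is a
      counterexample.\<close>
    define A where "A = mat d d (\<lambda>(a, b). if a = 0 \<and> b = 0 then 1 else (0::complex))"
    have A: "A \<in> M" by (simp add: A_def)
    obtain c where c: "A = c \<cdot>\<^sub>m I" using schur[OF A] triv A by auto
    have "A $$ (0, 0) = c" "A $$ (1, 1) = c" unfolding c using dpos d1 by auto
    then show False using dpos d1 by (auto simp: A_def)
  qed
  then obtain x where x: "x \<in> carrier ?P" "x \<noteq> I" "\<And>g. g \<in> carrier ?P \<Longrightarrow> g * x = x * g"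
    using P.p_group_center_nontrivial[OF p(1) j] by auto
  obtain z where z: "z \<in> carrier G" "x = \<rho> z" using x(1) by auto
  have "\<exists>c. \<rho> z = c \<cdot>\<^sub>m I"
  proof (rule schur)
    show "\<rho> z \<in> M" using z by simp
    show "\<rho> g * \<rho> z = \<rho> z * \<rho> g" if "g \<in> carrier G" for g using x(3)[of "\<rho> g"] that z by (auto intro!: image_eqI[of _ _ g])
  qed
  with z(1) have zZ: "z \<in> Z" unfolding Z_def by blast
  moreover have "lam z \<noteq> 1"
  proof
    assume "lam z = 1"
    then have "\<rho> z = I" unfolding rho_Z[OF zZ] by (simp only: smult_one_mat)
    then show False using x(2) z(2) by simp
  qed
  ultimately show ?thesis by blast
qed

lemma m_prime_power: "\<exists>k>0. m = p ^ k"
proof -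
  have "card Z dvd p ^ n" using lagrange[OF subgroup_Z] card_G by (metis Coset.order_def dvd_triv_right)
  then have "m dvd p ^ n" using card_Z by (metis dvd_mult_left)
  then obtain k where k: "m = p ^ k" using divides_primepow_nat[OF p(1)] by blast
  have "k \<noteq> 0"
  proof
    assume "k = 0"
    then have "C = {1}" using C_roots k by simp
    then show False using noncentral_scalar_exists by (auto simp: C_def)
  qed
  then show ?thesis using k by auto
qed

definition k where "k = (SOME k. k > 0 \<and> m = p ^ k)"

lemma k_m: "k > 0" "m = p ^ k"
  using someI_ex[OF m_prime_power] unfolding k_def by auto

lemma m_pos: "m > 0" using k_m(2) p_pos by simp

lemma pk: "p ^ k = p ^ (k - 1) * p" using power_minus_mult[OF k_m(1), of p] by simp

definition \<zeta> where "\<zeta> = cis (2 * pi / real m)"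
definition K where "K = gen_subfield {\<zeta>}"

lemma zeta: "\<zeta> \<in> prim_roots p k" "\<zeta> ^ m = 1" "\<zeta> \<in> C"
  using cis_prim_root[OF p(1) k_m(1)] by (auto simp: \<zeta>_def k_m(2) prim_roots_def C_roots)

lemma K_subfield: "is_subfield_C K" unfolding K_def by (rule is_subfield_C_gen_subfield)

lemma zeta_K: "\<zeta> \<in> K" unfolding K_def using gen_subfield_superset by blast

lemma C_K: "c \<in> C \<Longrightarrow> c \<in> K"
  using roots_unity_generated[OF p(1) zeta(1)] subfield_power[OF K_subfield zeta_K] by (auto simp: C_roots k_m(2))

lemma lam_root: "z \<in> Z \<Longrightarrow> lam z ^ (p ^ k) = 1"
  using C_roots k_m(2) by (auto simp: C_def)

text \<open>Positivity of \<open>k\<close> enters here, through the divisibility of m by p. These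
  roots determine the size of \<open>D\<close> and are the coefficients that the spectral
  projections bring into K.\<close>

lemma p_roots_C: "w ^ p = 1 \<Longrightarrow> w \<in> C"
  unfolding C_roots k_m(2) pk mult.commute[of "p ^ (k - 1)"] power_mult by simp

lemma tr_Z: "z \<in> Z \<Longrightarrow> tr (\<rho> z) = of_nat d * lam z"
  by (simp add: rho_Z mult.commute)

lemma cmod_lam: "z \<in> Z \<Longrightarrow> cmod (lam z) = 1"
  using lam_root[of z] p_pos by (metis norm_ge_zero norm_one norm_power power_eq_1_iff zero_less_power less_irrefl)

lemma Z_iff: "g \<in> carrier G \<Longrightarrow> g \<in> Z \<longleftrightarrow> cmod (tr (\<rho> g)) = real d"
proof
  assume "g \<in> Z"
  then show "cmod (tr (\<rho> g)) = real d" using cmod_lam[of g] by (simp add: tr_Z norm_mult)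
next
  assume "g \<in> carrier G" "cmod (tr (\<rho> g)) = real d"
  then show "g \<in> Z" using trace_modulus_scalar[of g] unfolding Z_def by blast
qed

lemma tr_not_Z: "g \<in> carrier G \<Longrightarrow> g \<notin> Z \<Longrightarrow> tr (\<rho> g) = 0"
  using Z_iff gvz by blast

lemma card_G_eq: "card (carrier G) = d ^ 2 * card Z"
proof -
  have "(of_nat (card (carrier G)) :: complex) = (\<Sum>g\<in>carrier G. tr (\<rho> g) * tr (\<rho> (inv g)))"
    by (rule character_norm[symmetric])
  also have "\<dots> = (\<Sum>g\<in>Z. tr (\<rho> g) * tr (\<rho> (inv g)))"
    by (rule sum.mono_neutral_right[OF fin]) (auto simp: tr_not_Z)
  also have "\<dots> = (\<Sum>g\<in>Z. of_nat (d ^ 2))"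
    by (intro sum.cong refl) (use lam_nonzero lam_inv in \<open>simp add: tr_Z power2_eq_square\<close>)
  finally have "(of_nat (card (carrier G)) :: complex) = of_nat (d ^ 2 * card Z)" by (simp add: mult.commute)
  then show ?thesis by (simp only: of_nat_eq_iff)
qed

lemma card_Z_pos: "card Z > 0" using card_Z m_pos card_N_pos by simp

lemma tr_K: "g \<in> carrier G \<Longrightarrow> tr (\<rho> g) \<in> K"
  using tr_Z[of g] tr_not_Z[of g] C_K[of "lam g"] K_subfield
  by (cases "g \<in> Z") (auto simp: C_def intro: is_subfield_CD subfield_of_nat)

text \<open>As a function of c = \<open>lam g\<close>, this is the coefficient of g in
  \<open>hat N - hat D\<close>, since |D| = p |N|. For c in \<open>C\<close> it is also the trace of
  c from K to the rationals divided by |Z|, which is the link between the two descriptions of the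
  idempotent.\<close>

definition e_coeff :: "complex \<Rightarrow> complex" where
  "e_coeff c = (if c = 1 then 1 / of_nat (card N) else 0) - (if c ^ p = 1 then 1 / of_nat (p * card N) else (0::complex))"

definition e where "e g = (if g \<in> Z then e_coeff (lam g) else 0)"

lemma e_coeff_inverse: "e_coeff (inverse c) = e_coeff c"
  by (simp add: e_coeff_def power_inverse)

lemma e_coeff_trace:
  assumes "c ^ (p ^ k) = 1"
  shows "(\<Sum>\<sigma>\<in>field_auts K. \<sigma> c) = of_nat (card Z) * e_coeff c"
proof -
  have "of_nat (p ^ k) / of_nat (card Z) = (1 / of_nat (card N) :: complex)"
    using m_pos card_N_pos by (simp add: card_Z k_m(2) field_simps)
  moreover have "of_nat (p ^ (k - 1)) / of_nat (card Z) = (1 / of_nat (p * card N) :: complex)"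
    using p_pos card_N_pos by (simp add: card_Z k_m(2) pk field_simps)
  ultimately have "e_coeff c = ((if c = 1 then of_nat (p ^ k) else 0) - (if c ^ p = 1 then of_nat (p ^ (k - 1)) else 0)) / of_nat (card Z)"
    by (simp add: e_coeff_def diff_divide_distrib)
  then show ?thesis
    using sum_field_auts_root_of_unity[OF p(1) zeta(1) assms] card_Z_pos by (simp add: K_def)
qed

text \<open>Used twice: for the formula for \<open>e_Q\<close>, and to show that a rational element
  acting as zero is annihilated by \<open>e\<close>. Off \<open>Z\<close> both sides vanish; on
  \<open>Z\<close> the factor d^2 / |G| is 1 / |Z| and the rest is a trace of a root of
  unity.\<close>

lemma e_galois:
  assumes g: "g \<in> carrier G"
  shows "e g = (\<Sum>\<sigma>\<in>field_auts K. of_nat d / of_nat (card (carrier G)) * \<sigma> (tr (\<rho> (inv g))))"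
proof (cases "g \<in> Z")
  case False
  then have "tr (\<rho> (inv g)) = 0" using inv_in_Z_iff[OF g] tr_not_Z g by simp
  then show ?thesis using False by (simp add: e_def field_aut_basic(1)[OF _ K_subfield])
next
  case True
  have iz: "inv g \<in> Z" "lam (inv g) = inverse (lam g)" using lam_inv[OF True] by auto
  have iK: "lam (inv g) \<in> K" using C_K iz(1) unfolding C_def by blast
  have "(\<Sum>\<sigma>\<in>field_auts K. of_nat d / of_nat (card (carrier G)) * \<sigma> (tr (\<rho> (inv g)))) =
     (\<Sum>\<sigma>\<in>field_auts K. of_nat d / of_nat (card (carrier G)) * (of_nat d * \<sigma> (lam (inv g))))"
  proof (intro sum.cong refl)
    fix \<sigma> assume s: "\<sigma> \<in> field_auts K"
    have "\<sigma> (of_nat d * lam (inv g)) = \<sigma> (of_nat d) * \<sigma> (lam (inv g))"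
      using iK by (intro field_autsD(5)[OF s] subfield_of_nat K_subfield)
    moreover have "\<sigma> (of_nat d) = of_nat d" using field_aut_basic(2)[OF s K_subfield, of "of_nat d"] by simp
    ultimately show "of_nat d / of_nat (card (carrier G)) * \<sigma> (tr (\<rho> (inv g))) =
        of_nat d / of_nat (card (carrier G)) * (of_nat d * \<sigma> (lam (inv g)))" by (simp add: tr_Z[OF iz(1)])
  qed
  also have "\<dots> = of_nat d / of_nat (card (carrier G)) * of_nat d * (\<Sum>\<sigma>\<in>field_auts K. \<sigma> (lam (inv g)))"
    by (simp add: sum_distrib_left mult.assoc)
  also have "\<dots> = e_coeff (lam (inv g))"
    unfolding e_coeff_trace[OF lam_root[OF iz(1)]] using dpos card_Z_pos
    by (simp add: card_G_eq power2_eq_square)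
  finally show ?thesis using True by (simp add: e_def iz e_coeff_inverse)
qed

definition D where "D = {z \<in> Z. lam z ^ p = 1}"

lemma card_D: "card D = p * card N"
proof -
  have "D = {z \<in> Z. lam z \<in> {w. w ^ p = 1}}" by (simp add: D_def)
  moreover have "{w. w ^ p = 1} \<subseteq> C" using p_roots_C by blast
  ultimately show ?thesis using card_lam_preimage[of "{w. w ^ p = 1}"] p_pos by (simp add: card_roots_unity_eq)
qed

lemma e_hat: "e g = hat N g - hat D g"
proof -
  have "g \<in> N \<longleftrightarrow> g \<in> Z \<and> lam g = 1" "g \<in> D \<longleftrightarrow> g \<in> Z \<and> lam g ^ p = 1" by (auto simp: N_def D_def)
  then show ?thesis unfolding e_def e_coeff_def hat_def card_D by simp
qed

lemma subgroup_D: "subgroup D G"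
  using subgroup_lam_preimage[of "{w. w ^ p = 1}"] by (simp add: D_def power_mult_distrib power_inverse)

text \<open>Commutators of elements of \<open>Z\<close> have \<open>lam\<close> value 1 and so lie
  in N. Hence Z/N is abelian and every subgroup between N and Z is normal in Z.\<close>

lemma normal_in_Z:
  assumes "subgroup A G" "A \<subseteq> Z" "N \<subseteq> A"
  shows "A \<lhd> (G\<lparr>carrier := Z\<rparr>)"
proof -
  interpret Zg: group "G\<lparr>carrier := Z\<rparr>" by (rule subgroup_imp_group[OF subgroup_Z])
  have "subgroup A (G\<lparr>carrier := Z\<rparr>)" using subgroup_incl[OF assms(1) subgroup_Z assms(2)] .
  then show ?thesis
  proof (rule Zg.normal_invI)
    fix x h assume x: "x \<in> carrier (G\<lparr>carrier := Z\<rparr>)" and h: "h \<in> A"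
    have xZ: "x \<in> Z" and hZ: "h \<in> Z" using x h assms(2) by auto
    have ix: "inv\<^bsub>G\<lparr>carrier := Z\<rparr>\<^esub> x = inv x" using m_inv_consistent[OF subgroup_Z xZ] .
    let ?y = "x \<otimes> h \<otimes> inv x"
    have y: "?y \<in> Z" "lam ?y = lam h"
      using lam_mult[OF xZ hZ] lam_mult[of "x \<otimes> h" "inv x"] lam_inv[OF xZ] lam_nonzero[OF xZ] by auto
    have "?y \<otimes> inv h \<in> N"
      using lam_mult[OF y(1), of "inv h"] lam_inv[OF hZ] lam_nonzero[OF hZ] y by (auto simp: N_def)
    then have "(?y \<otimes> inv h) \<otimes> h \<in> A" using assms(3) h subgroup.m_closed[OF assms(1)] by blast
    moreover have "(?y \<otimes> inv h) \<otimes> h = ?y" using xZ hZ by (simp add: m_assoc)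
    ultimately show "x \<otimes>\<^bsub>G\<lparr>carrier := Z\<rparr>\<^esub> h \<otimes>\<^bsub>G\<lparr>carrier := Z\<rparr>\<^esub> inv\<^bsub>G\<lparr>carrier := Z\<rparr>\<^esub> x \<in> A"
      by (simp add: ix)
  qed
qed

lemma subgroup_of_normal_Z: "A \<lhd> (G\<lparr>carrier := Z\<rparr>) \<Longrightarrow> subgroup A G"
  by (rule incl_subgroup[OF subgroup_Z normal_imp_subgroup])

text \<open>Since lam is injective modulo N with cyclic p-power image, D / N is the unique minimal subgroup of Z / N.\<close>
lemma D_minimal:
  assumes A: "subgroup A G" "A \<subseteq> Z" "N \<subset> A"
  shows "D \<subseteq> A"
proof -
  obtain a where a: "a \<in> A" "a \<notin> N" using A(3) by blast
  have aZ: "a \<in> Z" using a A(2) by blast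
  define i where "i = (LEAST i. lam a ^ (p ^ i) = 1)"
  have i: "lam a ^ (p ^ i) = 1" unfolding i_def using lam_root[OF aZ] by (rule LeastI)
  have i0: "i \<noteq> 0"
  proof
    assume "i = 0"
    then show False using i a aZ by (simp add: N_def)
  qed
  have apow: "a [^] (j::nat) \<in> A" for j
    by (induction j) (use a(1) subgroup.m_closed[OF A(1)] subgroup.one_closed[OF A(1)] in auto)
  \<comment> \<open>The last power in the chain a, a^p, a^(p^2), ... with nontrivial
    \<open>lam\<close> value. That value has order p, so its powers give all p-th roots of unity,
    and every element of \<open>D\<close> differs from a power of b by an element of N.\<close>
  define b where "b = a [^] (p ^ (i - 1))"
  have b: "b \<in> A" "b \<in> Z" "lam b = lam a ^ (p ^ (i - 1))" using apow lam_pow[OF aZ] by (auto simp: b_def)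
  have "lam b \<noteq> 1" unfolding b(3) using not_less_Least[of "i - 1" "\<lambda>i. lam a ^ (p ^ i) = 1"] i0 by (simp add: i_def)
  moreover have "lam b ^ p = 1" using i i0 power_minus_mult[of i p] by (simp add: b(3) flip: power_mult)
  ultimately have lb: "lam b \<in> prim_roots p 1" by (simp add: prim_roots_def)
  show "D \<subseteq> A"
  proof
    fix x assume x: "x \<in> D"
    then have xZ: "x \<in> Z" "lam x ^ (p ^ 1) = 1" by (auto simp: D_def)
    obtain j where j: "lam x = lam b ^ j" using roots_unity_generated[OF p(1) lb xZ(2)] by blast
    have bj: "b [^] j \<in> A" "b [^] j \<in> Z" "lam (b [^] j) = lam x"
    proof -
      show "b [^] j \<in> A" by (induction j) (use b(1) subgroup.m_closed[OF A(1)] subgroup.one_closed[OF A(1)] in auto)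
      show "b [^] j \<in> Z" "lam (b [^] j) = lam x" using lam_pow[OF b(2)] j by auto
    qed
    have "inv (b [^] j) \<otimes> x \<in> N"
      using lam_mult[of "inv (b [^] j)" x] lam_inv[OF bj(2)] bj(3) xZ lam_nonzero[OF xZ(1)] by (auto simp: N_def)
    then have "b [^] j \<otimes> (inv (b [^] j) \<otimes> x) \<in> A"
      using A(3) subgroup.m_closed[OF A(1) bj(1)] by blast
    moreover have "b [^] j \<otimes> (inv (b [^] j) \<otimes> x) = x" using b(2) xZ by (simp add: m_assoc[symmetric])
    ultimately show "x \<in> A" by simp
  qed
qed

lemma N_psubset_D: "N \<subset> D"
proof
  show "N \<subseteq> D" by (auto simp: N_def D_def)
  have "card N < card D" using card_D card_N_pos prime_gt_1_nat[OF p(1)] by simp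
  then show "N \<noteq> D" by auto
qed

lemma min_normal_over_eq: "min_normal_over G Z N = {D}"
proof
  have DZ: "D \<subseteq> Z" by (auto simp: D_def)
  have D: "N \<subset> D" "D \<subseteq> Z" "D \<lhd> (G\<lparr>carrier := Z\<rparr>)"
    using N_psubset_D DZ normal_in_Z[OF subgroup_D DZ] by auto
  show "min_normal_over G Z N \<subseteq> {D}"
  proof
    fix A assume "A \<in> min_normal_over G Z N"
    then have A: "N \<subset> A" "A \<subseteq> Z" "A \<lhd> (G\<lparr>carrier := Z\<rparr>)"
        "\<not> (\<exists>B. N \<subset> B \<and> B \<subset> A \<and> B \<lhd> (G\<lparr>carrier := Z\<rparr>))"
      by (auto simp: min_normal_over_def)
    have "D \<subseteq> A" using D_minimal[OF subgroup_of_normal_Z[OF A(3)] A(2,1)] .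
    then show "A \<in> {D}" using A(4) D by blast
  qed
  have "\<not> (\<exists>B. N \<subset> B \<and> B \<subset> D \<and> B \<lhd> (G\<lparr>carrier := Z\<rparr>))"
    using D_minimal subgroup_of_normal_Z D(2) by blast
  then show "{D} \<subseteq> min_normal_over G Z N" using D by (auto simp: min_normal_over_def)
qed

section \<open>The two descriptions of the rational idempotent\<close>

lemma grp_alg_mult_one_left:
  assumes "\<And>g. g \<notin> carrier G \<Longrightarrow> x g = 0"
  shows "grp_alg_mult G (grp_alg_one G) x = x"
proof
  fix g
  show "grp_alg_mult G (grp_alg_one G) x g = x g"
  proof (cases "g \<in> carrier G")
    case True
    have "(\<Sum>h\<in>carrier G. (if h = \<one> then 1 else 0) * x (inv h \<otimes> g)) = (\<Sum>h\<in>carrier G. if h = \<one> then x g else 0)"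
      using True by (intro sum.cong) auto
    then show ?thesis using True fin by (simp add: grp_alg_mult_def grp_alg_one_def)
  qed (simp add: grp_alg_mult_def assms)
qed

lemma eps_eq: "eps G Z N = e"
proof -
  have "N \<noteq> Z" using N_psubset_D by (auto simp: D_def)
  moreover have "grp_alg_prod G (\<lambda>D g. hat N g - hat D g) {D} = (\<lambda>g. hat N g - hat D g)"
  proof -
    \<comment> \<open>Only one minimal subgroup occurs, so the commutation condition for the fold is
      that of a single factor with itself.\<close>
    interpret F: Finite_Set.comp_fun_commute_on "{D}" "\<lambda>D acc. grp_alg_mult G acc (\<lambda>g. hat N g - hat D g)"
      by unfold_locales auto
    have "grp_alg_prod G (\<lambda>D g. hat N g - hat D g) {D} = grp_alg_mult G (grp_alg_one G) (\<lambda>g. hat N g - hat D g)"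
      unfolding grp_alg_prod_def by (subst F.fold_insert) auto
    also have "\<dots> = (\<lambda>g. hat N g - hat D g)"
      by (rule grp_alg_mult_one_left) (auto simp: hat_def N_def D_def)
    finally show ?thesis .
  qed
  ultimately show ?thesis by (auto simp: eps_def min_normal_over_eq e_hat)
qed

lemma e_Q_eq:
  assumes \<chi>: "\<And>g. g \<in> carrier G \<Longrightarrow> \<chi> g = tr (\<rho> g)"
  shows "e_Q G \<chi> = e"
proof -
  have field: "char_field G \<chi> = K"
  proof
    have "\<chi> ` carrier G \<subseteq> K" using \<chi> tr_K by auto
    then show "char_field G \<chi> \<subseteq> K" unfolding char_field_def by (rule gen_subfield_least[OF K_subfield])
    have sub: "is_subfield_C (char_field G \<chi>)" unfolding char_field_def by (rule is_subfield_C_gen_subfield)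
    \<comment> \<open>The values of \<open>lam\<close> are all m-th roots of unity, so \<zeta> is
      attained on \<open>Z\<close>; dividing the value of \<chi> there by the degree d recovers it
      inside the character field.\<close>
    have "\<zeta> \<in> lam ` Z" using zeta(3) by (simp add: C_def)
    then obtain z where z: "z \<in> Z" "\<zeta> = lam z" by (rule imageE)
    have "\<chi> z \<in> char_field G \<chi>" unfolding char_field_def
      using z(1) by (intro subsetD[OF gen_subfield_superset] imageI) simp
    then have "\<chi> z / of_nat d \<in> char_field G \<chi>" using is_subfield_CD(7)[OF sub] subfield_of_nat[OF sub] by blast
    moreover have "\<chi> z / of_nat d = \<zeta>" using z(2) tr_Z[OF z(1)] dpos \<chi>[OF Z_carrier[OF z(1)]] by simp
    ultimately show "K \<subseteq> char_field G \<chi>" unfolding K_def by (intro gen_subfield_least[OF sub]) auto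
  qed
  show ?thesis
  proof
    fix g
    show "e_Q G \<chi> g = e g"
    proof (cases "g \<in> carrier G")
      case True
      have "e_Q G \<chi> g = (\<Sum>\<sigma>\<in>field_auts K. \<sigma> (\<chi> \<one>) / of_nat (card (carrier G)) * \<sigma> (\<chi> (inv g)))"
        using True by (simp add: e_Q_def e_idem_def field)
      also have "\<dots> = (\<Sum>\<sigma>\<in>field_auts K. of_nat d / of_nat (card (carrier G)) * \<sigma> (tr (\<rho> (inv g))))"
      proof (intro sum.cong refl)
        fix \<sigma> assume s: "\<sigma> \<in> field_auts K"
        show "\<sigma> (\<chi> \<one>) / of_nat (card (carrier G)) * \<sigma> (\<chi> (inv g)) =
            of_nat d / of_nat (card (carrier G)) * \<sigma> (tr (\<rho> (inv g)))"
          using True field_aut_basic(2)[OF s K_subfield, of "of_nat d"] by (simp add: \<chi>)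
      qed
      finally show ?thesis using e_galois[OF True] by simp
    qed (auto simp: e_Q_def e_idem_def e_def)
  qed
qed

end

section \<open>The group algebra acting by matrices, and the isomorphism onto matrices over the
  cyclotomic field\<close>

context schur_rep
begin

definition alg_rep :: "('a \<Rightarrow> complex) \<Rightarrow> complex mat" where
  "alg_rep x = msum d (\<lambda>g. x g \<cdot>\<^sub>m \<rho> g) (carrier G)"

lemma alg_rep_closed [simp]: "alg_rep x \<in> M" by (simp add: alg_rep_def)

lemma alg_rep_add: "alg_rep (\<lambda>g. x g + y g) = alg_rep x + alg_rep y"
proof (rule eq_matI)
  fix i j assume "i < dim_row (alg_rep x + alg_rep y)" "j < dim_col (alg_rep x + alg_rep y)"
  then have "i < d" "j < d" by (auto simp: alg_rep_def msum_def)
  moreover have "dim_row (\<rho> g) = d" "dim_col (\<rho> g) = d" if "g \<in> carrier G" for g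
    using carrier_matD[OF rho(1)[OF that]] by auto
  ultimately show "alg_rep (\<lambda>g. x g + y g) $$ (i, j) = (alg_rep x + alg_rep y) $$ (i, j)"
    by (simp add: alg_rep_def msum_def sum.distrib distrib_right)
qed (auto simp: alg_rep_def msum_def)

lemma alg_rep_diff: "alg_rep (\<lambda>g. x g - y g) = alg_rep x - alg_rep y"
proof (rule eq_matI)
  fix i j assume "i < dim_row (alg_rep x - alg_rep y)" "j < dim_col (alg_rep x - alg_rep y)"
  then have "i < d" "j < d" by (auto simp: alg_rep_def msum_def)
  moreover have "dim_row (\<rho> g) = d" "dim_col (\<rho> g) = d" if "g \<in> carrier G" for g
    using carrier_matD[OF rho(1)[OF that]] by auto
  ultimately show "alg_rep (\<lambda>g. x g - y g) $$ (i, j) = (alg_rep x - alg_rep y) $$ (i, j)"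
    by (simp add: alg_rep_def msum_def sum_subtractf left_diff_distrib)
qed (auto simp: alg_rep_def msum_def)

lemma left_translation_bij: "h \<in> carrier G \<Longrightarrow> bij_betw (\<lambda>g. h \<otimes> g) (carrier G) (carrier G)"
  by (rule bij_betwI[of _ _ _ "\<lambda>g. inv h \<otimes> g"]) (auto simp: m_assoc[symmetric])

lemma alg_rep_mult: "alg_rep (grp_alg_mult G x y) = alg_rep x * alg_rep y"
proof -
  have "alg_rep (grp_alg_mult G x y) =
      msum d (\<lambda>g. msum d (\<lambda>h. (x h * y (inv h \<otimes> g)) \<cdot>\<^sub>m \<rho> g) (carrier G)) (carrier G)"
    unfolding alg_rep_def by (intro msum_cong refl) (simp add: grp_alg_mult_def msum_const_mat)
  also have "\<dots> = msum d (\<lambda>h. msum d (\<lambda>g. (x h * y (inv h \<otimes> g)) \<cdot>\<^sub>m \<rho> g) (carrier G)) (carrier G)"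
    by (rule msum_swap)
  also have "\<dots> = msum d (\<lambda>h. (x h \<cdot>\<^sub>m \<rho> h) * alg_rep y) (carrier G)"
  proof (rule msum_cong[OF refl])
    fix h assume h: "h \<in> carrier G"
    have "msum d (\<lambda>g. (x h * y (inv h \<otimes> g)) \<cdot>\<^sub>m \<rho> g) (carrier G) =
        msum d (\<lambda>g. (x h * y (inv h \<otimes> (h \<otimes> g))) \<cdot>\<^sub>m \<rho> (h \<otimes> g)) (carrier G)"
      using msum_reindex[OF left_translation_bij[OF h], of "\<lambda>g. (x h * y (inv h \<otimes> g)) \<cdot>\<^sub>m \<rho> g"] by simp
    also have "\<dots> = msum d (\<lambda>g. (x h \<cdot>\<^sub>m \<rho> h) * (y g \<cdot>\<^sub>m \<rho> g)) (carrier G)"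
      using h by (intro msum_cong refl) (simp add: m_assoc[symmetric] mult.commute)
    also have "\<dots> = (x h \<cdot>\<^sub>m \<rho> h) * alg_rep y"
      unfolding alg_rep_def using h by (intro msum_mult_left[symmetric]) auto
    finally show "msum d (\<lambda>g. (x h * y (inv h \<otimes> g)) \<cdot>\<^sub>m \<rho> g) (carrier G) = (x h \<cdot>\<^sub>m \<rho> h) * alg_rep y" .
  qed
  also have "\<dots> = alg_rep x * alg_rep y"
    unfolding alg_rep_def[of x] by (intro msum_mult_right[symmetric]) auto
  finally show ?thesis .
qed

lemma alg_rep_delta:
  assumes "g \<in> carrier G"
  shows "alg_rep (\<lambda>h. if h = g then q else 0) = q \<cdot>\<^sub>m \<rho> g"
proof -
  have "alg_rep (\<lambda>h. if h = g then q else 0) = msum d (\<lambda>h. (if h = g then q else 0) \<cdot>\<^sub>m \<rho> g) (carrier G)"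
    unfolding alg_rep_def using assms by (intro msum_cong refl) auto
  also have "\<dots> = q \<cdot>\<^sub>m \<rho> g" using assms fin by (subst msum_const_mat) auto
  finally show ?thesis .
qed

end

lemma rat_grp_alg_grp_alg_mult:
  assumes "x \<in> rat_grp_alg G" "y \<in> rat_grp_alg G"
  shows "grp_alg_mult G x y \<in> rat_grp_alg G"
proof -
  have "(\<Sum>h\<in>carrier G. x h * y (inv\<^bsub>G\<^esub> h \<otimes>\<^bsub>G\<^esub> g)) \<in> \<rat>" for g
    using assms by (intro Rats_sum Rats_mult) (auto simp: rat_grp_alg_def)
  then show ?thesis by (auto simp: rat_grp_alg_def grp_alg_mult_def)
qed

context gvz_rep
begin

lemma d_squared: "d ^ 2 = card (carrier G) div card Z"
  using card_G_eq card_Z_pos by simp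

lemma realized_over_cyclotomic:
  "\<exists>\<rho>'. schur_rep G d \<rho>' \<and> (\<forall>g\<in>carrier G. tr (\<rho>' g) = tr (\<rho> g) \<and> \<rho>' g \<in> mat_over d K)"
proof -
  interpret P: p_schur_rep G d \<rho> p n K
    by unfold_locales (use p card_G K_subfield tr_K C_K[OF p_roots_C] in auto)
  show ?thesis by (rule P.realized_over_K[OF irr])
qed

lemma rational_combination_K:
  assumes "c \<in> K"
  shows "\<exists>q (I::nat set). finite I \<and> c = (\<Sum>i\<in>I. of_rat (q i) * \<zeta> ^ i)"
proof -
  have "K = range (\<lambda>f. rpoly f \<zeta>)"
    unfolding K_def by (rule gen_subfield_root_of_unity[OF zeta(2) m_pos])
  then obtain f where "c = rpoly f \<zeta>" using assms by auto
  then have "c = (\<Sum>i\<le>Polynomial.degree f. of_rat (Polynomial.coeff f i) * \<zeta> ^ i)"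
    by (simp add: poly_altdef)
  then show ?thesis by (intro exI[of _ "Polynomial.coeff f"] exI[of _ "{..Polynomial.degree f}"]) simp
qed

text \<open>The isomorphism is \<open>alg_rep\<close> for the model over K. Since \<open>e\<close>
  acts as the identity, x and x e have the same image; so surjectivity can be tested on the whole
  rational group algebra, and injectivity means that a rational element acting as zero is
  annihilated by \<open>e\<close>.\<close>

lemma algebra_iso: "alg_iso_mat G e d K"
proof -
  obtain \<rho>' where S': "schur_rep G d \<rho>'"
    and tr': "\<And>g. g \<in> carrier G \<Longrightarrow> tr (\<rho>' g) = tr (\<rho> g)"
    and K': "\<And>g. g \<in> carrier G \<Longrightarrow> \<rho>' g \<in> mat_over d K"
    using realized_over_cyclotomic by blast
  interpret S: schur_rep G d \<rho>' by (rule S')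
  note Kc = is_subfield_CD[OF K_subfield]
  \<comment> \<open>The model has the same traces as the original representation, so the modulus
    criterion makes it scalar on \<open>Z\<close> with the same scalars.\<close>
  have KZ: "\<rho>' z = lam z \<cdot>\<^sub>m I" if z: "z \<in> Z" for z
  proof -
    have "cmod (tr (\<rho>' z)) = real d" using z Z_iff[of z] by (simp add: tr')
    then obtain c where c: "\<rho>' z = c \<cdot>\<^sub>m I" using S.trace_modulus_scalar[of z] z by auto
    have "c * of_nat d = of_nat d * lam z" using tr'[of z] z c tr_Z[OF z] by simp
    then show ?thesis using c dpos by simp
  qed
  \<comment> \<open>The part coming from \<open>hat N\<close> contributes 1; the part coming from
    \<open>hat D\<close> is a multiple of the sum of all p-th roots of unity, which is 0.\<close>
  have Fe: "S.alg_rep e = I"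
  proof -
    have "S.alg_rep e = msum d (\<lambda>g. (e g * lam g) \<cdot>\<^sub>m I) (carrier G)"
      unfolding S.alg_rep_def by (intro msum_cong refl) (auto simp: e_def KZ)
    also have "\<dots> = (\<Sum>g\<in>carrier G. e g * lam g) \<cdot>\<^sub>m I" by (rule msum_const_mat) simp
    also have "(\<Sum>g\<in>carrier G. e g * lam g) = (\<Sum>g\<in>Z. e_coeff (lam g) * lam g)"
      by (rule sum.mono_neutral_cong_right[OF fin]) (auto simp: e_def)
    also have "\<dots> = of_nat (card N) * (\<Sum>c\<in>C. e_coeff c * c)" by (rule sum_lam)
    also have "(\<Sum>c\<in>C. e_coeff c * c) = (\<Sum>c\<in>C. if c = 1 then 1 / of_nat (card N) else 0) -
        (\<Sum>c\<in>C. if c ^ p = 1 then c / of_nat (p * card N) else 0)"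
      unfolding sum_subtractf[symmetric] by (intro sum.cong refl) (auto simp: e_coeff_def)
    also have "(\<Sum>c\<in>C. if c ^ p = 1 then c / of_nat (p * card N) else 0) = (\<Sum>c | c ^ p = 1. c / of_nat (p * card N))"
    proof -
      have "C \<inter> {c. c ^ p = 1} = {c. c ^ p = 1}" using p_roots_C by auto
      then show ?thesis using finite_C by (simp add: sum.If_cases)
    qed
    also have "\<dots> = 0"
      using sum_roots_unity_power[OF p_pos, of 1] prime_gt_1_nat[OF p(1)] by (simp flip: sum_divide_distrib)
    also have "(\<Sum>c\<in>C. if c = 1 then 1 / of_nat (card N) else 0) = (1 / of_nat (card N) :: complex)"
      using finite_C by (simp add: C_roots)
    finally show ?thesis using card_N_pos by simp
  qed
  text \<open>If x maps to 0 then the coefficients of x e(\<chi>) vanish, and those of x e are sums of Galois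
    conjugates of them because x is rational.\<close>
  have ker: "grp_alg_mult G x e = (\<lambda>_. 0)" if x: "x \<in> rat_grp_alg G" "S.alg_rep x = Om" for x
  proof
    fix g
    show "grp_alg_mult G x e g = 0"
    proof (cases "g \<in> carrier G")
      case True
      define t where "t = (\<lambda>h. tr (\<rho> (inv g \<otimes> h)))"
      have xr: "x h \<in> \<rat>" for h using x(1) by (simp add: rat_grp_alg_def)
      have "(\<Sum>h\<in>carrier G. x h * t h) = tr (\<rho>' (inv g) * S.alg_rep x)"
      proof -
        have "\<rho>' (inv g) * S.alg_rep x = msum d (\<lambda>h. x h \<cdot>\<^sub>m \<rho>' (inv g \<otimes> h)) (carrier G)"
          unfolding S.alg_rep_def using True by (subst msum_mult_left) (auto intro!: msum_cong)
        then show ?thesis using True by (simp add: tr_msum t_def tr' del: rho(3) S.rho(3))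
      qed
      then have zero: "(\<Sum>h\<in>carrier G. x h * t h) = 0" using x(2) True by simp
      have "grp_alg_mult G x e g = (\<Sum>h\<in>carrier G. x h * e (inv h \<otimes> g))"
        using True by (simp add: grp_alg_mult_def)
      also have "\<dots> = (\<Sum>h\<in>carrier G. \<Sum>\<sigma>\<in>field_auts K. of_nat d / of_nat (card (carrier G)) * \<sigma> (x h * t h))"
      proof (intro sum.cong refl)
        fix h assume h: "h \<in> carrier G"
        have "x h * e (inv h \<otimes> g) = (\<Sum>\<sigma>\<in>field_auts K. of_nat d / of_nat (card (carrier G)) * (x h * \<sigma> (t h)))"
          using True h by (simp add: e_galois t_def sum_distrib_left inv_mult_group mult.left_commute del: rho)
        also have "\<dots> = (\<Sum>\<sigma>\<in>field_auts K. of_nat d / of_nat (card (carrier G)) * \<sigma> (x h * t h))"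
        proof (intro sum.cong refl arg_cong2[where f = "(*)"])
          fix \<sigma> assume s: "\<sigma> \<in> field_auts K"
          obtain q where q: "x h = of_rat q" using xr by (auto elim: Rats_cases)
          have "t h \<in> K" using True h by (simp add: t_def tr_K del: rho)
          then show "x h * \<sigma> (t h) = \<sigma> (x h * t h)"
            using field_autsD(5)[OF s subfield_of_rat[OF K_subfield]] field_aut_basic(2)[OF s K_subfield]
            by (simp add: q)
        qed
        finally show "x h * e (inv h \<otimes> g) = (\<Sum>\<sigma>\<in>field_auts K. of_nat d / of_nat (card (carrier G)) * \<sigma> (x h * t h))" .
      qed
      also have "\<dots> = (\<Sum>\<sigma>\<in>field_auts K. of_nat d / of_nat (card (carrier G)) * (\<Sum>h\<in>carrier G. \<sigma> (x h * t h)))"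
        by (subst sum.swap) (simp add: sum_distrib_left)
      also have "\<dots> = (\<Sum>\<sigma>\<in>field_auts K. 0)"
      proof (intro sum.cong refl)
        fix \<sigma> assume s: "\<sigma> \<in> field_auts K"
        have "x h * t h \<in> K" if h: "h \<in> carrier G" for h
        proof -
          obtain q where q: "x h = of_rat q" using xr by (auto elim: Rats_cases)
          show ?thesis unfolding q t_def using True h by (intro Kc subfield_of_rat K_subfield tr_K) auto
        qed
        then have "(\<Sum>h\<in>carrier G. \<sigma> (x h * t h)) = \<sigma> (\<Sum>h\<in>carrier G. x h * t h)"
          by (rule field_aut_basic(4)[OF s K_subfield, symmetric])
        then show "of_nat d / of_nat (card (carrier G)) * (\<Sum>h\<in>carrier G. \<sigma> (x h * t h)) = 0"
          unfolding zero by (simp add: field_aut_basic(1)[OF s K_subfield])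
      qed
      finally show ?thesis by simp
    qed (simp add: grp_alg_mult_def)
  qed
  have FK: "S.alg_rep x \<in> mat_over d K" if x: "x \<in> rat_grp_alg G" for x
  proof -
    have "(\<Sum>g\<in>carrier G. (x g \<cdot>\<^sub>m \<rho>' g) $$ (i, j)) \<in> K" if ij: "i < d" "j < d" for i j
    proof (rule subfield_sum[OF K_subfield])
      fix g assume g: "g \<in> carrier G"
      have "x g \<in> \<rat>" using x by (simp add: rat_grp_alg_def)
      then obtain q where q: "x g = of_rat q" by (rule Rats_cases)
      have "\<rho>' g $$ (i, j) \<in> K" using K'[OF g] ij by (simp add: mat_over_def)
      then have "x g * \<rho>' g $$ (i, j) \<in> K" unfolding q by (intro Kc(4) subfield_of_rat[OF K_subfield])
      then show "(x g \<cdot>\<^sub>m \<rho>' g) $$ (i, j) \<in> K" using carrier_matD[OF S.rho(1)[OF g]] ij by simp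
    qed
    then show ?thesis by (simp add: mat_over_def S.alg_rep_def msum_def)
  qed
  \<comment> \<open>The image is closed under products and finite sums. By Fourier inversion it
    contains all matrices over K once it contains the scalars from K and the matrices
    \<open>\<rho>' g\<close>.\<close>
  define L where "L = S.alg_rep ` rat_grp_alg G"
  have L_mult: "A * B \<in> L" if AB: "A \<in> L" "B \<in> L" for A B
  proof -
    obtain x y where "x \<in> rat_grp_alg G" "A = S.alg_rep x" "y \<in> rat_grp_alg G" "B = S.alg_rep y" using AB by (auto simp: L_def)
    then show ?thesis unfolding L_def by (intro image_eqI[of _ _ "grp_alg_mult G x y"]) (simp_all add: S.alg_rep_mult rat_grp_alg_grp_alg_mult)
  qed
  have L_rho: "of_rat q \<cdot>\<^sub>m \<rho>' g \<in> L" if g: "g \<in> carrier G" for q g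
    unfolding L_def using S.alg_rep_delta[OF g, of "of_rat q"] g
    by (intro image_eqI[of _ _ "\<lambda>h. if h = g then of_rat q else 0"]) (auto simp: rat_grp_alg_def)
  have L_msum: "msum d f T \<in> L" if T: "finite T" "\<And>s. s \<in> T \<Longrightarrow> f s \<in> L" for f :: "'i \<Rightarrow> complex mat" and T
  proof -
    have "\<exists>x. s \<in> T \<longrightarrow> x \<in> rat_grp_alg G \<and> f s = S.alg_rep x" for s using T(2)[of s] by (auto simp: L_def)
    then obtain x where x: "\<And>s. s \<in> T \<Longrightarrow> x s \<in> rat_grp_alg G" "\<And>s. s \<in> T \<Longrightarrow> f s = S.alg_rep (x s)" by metis
    define y where "y = (\<lambda>g. \<Sum>s\<in>T. x s g)"
    have "msum d f T = msum d (\<lambda>s. msum d (\<lambda>g. x s g \<cdot>\<^sub>m \<rho>' g) (carrier G)) T"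
      by (intro msum_cong refl) (simp add: x(2) S.alg_rep_def)
    also have "\<dots> = msum d (\<lambda>g. msum d (\<lambda>s. x s g \<cdot>\<^sub>m \<rho>' g) T) (carrier G)" by (rule msum_swap)
    also have "\<dots> = S.alg_rep y" unfolding S.alg_rep_def by (intro msum_cong refl) (simp add: msum_const_mat y_def)
    finally have "msum d f T = S.alg_rep y" .
    moreover have "y \<in> rat_grp_alg G" using x(1) by (auto simp: rat_grp_alg_def y_def intro!: Rats_sum)
    ultimately show ?thesis by (auto simp: L_def)
  qed
  have "\<zeta> \<in> lam ` Z" using zeta(3) by (simp add: C_def)
  then obtain z0 where z0: "z0 \<in> Z" "\<zeta> = lam z0" by (rule imageE)
  \<comment> \<open>Scalars from K are already in the image of the rational span of
    \<open>Z\<close>: they are rational combinations of powers of \<zeta>, and some element of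
    \<open>Z\<close> acts as \<zeta>.\<close>
  have L_scalar: "c \<cdot>\<^sub>m I \<in> L" if c: "c \<in> K" for c
  proof -
    obtain q and J :: "nat set" where q: "finite J" "c = (\<Sum>i\<in>J. of_rat (q i) * \<zeta> ^ i)"
      using rational_combination_K[OF c] by blast
    have "c \<cdot>\<^sub>m I = msum d (\<lambda>i. (of_rat (q i) * \<zeta> ^ i) \<cdot>\<^sub>m I) J"
      unfolding q(2) by (rule msum_const_mat[symmetric]) simp
    also have "\<dots> = msum d (\<lambda>i. of_rat (q i) \<cdot>\<^sub>m \<rho>' (z0 [^] i)) J"
    proof (intro msum_cong refl)
      fix i
      have "z0 [^] i \<in> Z" "lam (z0 [^] i) = \<zeta> ^ i" using lam_pow[OF z0(1), of i] z0(2) by auto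
      then show "(of_rat (q i) * \<zeta> ^ i) \<cdot>\<^sub>m I = of_rat (q i) \<cdot>\<^sub>m \<rho>' (z0 [^] i)" by (simp add: KZ)
    qed
    also have "\<dots> \<in> L" using q(1) z0(1) by (intro L_msum L_rho) auto
    finally show ?thesis .
  qed
  have surj: "A \<in> L" if A: "A \<in> mat_over d K" for A
  proof -
    have AM: "A \<in> M" using A by (simp add: mat_over_def)
    have "(of_nat d / of_nat (card (carrier G)) * tr (A * \<rho>' (inv g))) \<cdot>\<^sub>m \<rho>' g \<in> L" if g: "g \<in> carrier G" for g
    proof -
      define c where "c = of_nat d / of_nat (card (carrier G)) * tr (A * \<rho>' (inv g))"
      have "tr (A * \<rho>' (inv g)) = (\<Sum>i<d. \<Sum>j<d. A $$ (i, j) * \<rho>' (inv g) $$ (j, i))"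
        using AM carrier_matD[OF S.rho(1)[OF inv_closed[OF g]]]
        by (auto simp: mat_trace_def scalar_prod_def lessThan_atLeast0 intro!: sum.cong)
      also have "\<dots> \<in> K"
        using A K'[OF inv_closed[OF g]] by (intro subfield_sum[OF K_subfield] Kc(4)) (auto simp: mat_over_def)
      finally have "c \<in> K" unfolding c_def by (intro Kc(4,7) subfield_of_nat[OF K_subfield])
      then have "(c \<cdot>\<^sub>m I) * (of_rat 1 \<cdot>\<^sub>m \<rho>' g) \<in> L" by (intro L_mult L_scalar L_rho g)
      then show ?thesis using g by (simp add: c_def)
    qed
    then show ?thesis by (subst S.fourier_inversion[OF AM]) (rule L_msum[OF fin])
  qed
  show ?thesis
    unfolding alg_iso_mat_def
  proof (intro exI[of _ S.alg_rep] conjI ballI)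
    show "S.alg_rep (\<lambda>g. x g + y g) = S.alg_rep x + S.alg_rep y" "S.alg_rep (grp_alg_mult G x y) = S.alg_rep x * S.alg_rep y" for x y
      by (rule S.alg_rep_add, rule S.alg_rep_mult)
    have FFe: "S.alg_rep (grp_alg_mult G x e) = S.alg_rep x" for x by (simp add: S.alg_rep_mult Fe)
    show "bij_betw S.alg_rep (grp_alg_ideal G e) (mat_over d K)"
      unfolding bij_betw_def
    proof
      show "inj_on S.alg_rep (grp_alg_ideal G e)"
      proof (rule inj_onI)
        fix a b assume ab: "a \<in> grp_alg_ideal G e" "b \<in> grp_alg_ideal G e" "S.alg_rep a = S.alg_rep b"
        obtain x y where xy: "a = grp_alg_mult G x e" "x \<in> rat_grp_alg G" "b = grp_alg_mult G y e" "y \<in> rat_grp_alg G"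
          using ab(1,2) by (auto simp: grp_alg_ideal_def)
        have "S.alg_rep x = S.alg_rep y" using ab(3) by (simp add: xy FFe)
        then have "S.alg_rep (\<lambda>g. x g - y g) = Om" by (simp add: S.alg_rep_diff minus_r_inv_mat[OF S.alg_rep_closed])
        moreover have "(\<lambda>g. x g - y g) \<in> rat_grp_alg G" using xy by (auto simp: rat_grp_alg_def)
        ultimately have z: "grp_alg_mult G (\<lambda>g. x g - y g) e = (\<lambda>_. 0)" by (intro ker)
        show "a = b"
        proof
          fix g
          have "a g - b g = grp_alg_mult G (\<lambda>g. x g - y g) e g"
            by (simp add: xy grp_alg_mult_def sum_subtractf left_diff_distrib)
          then show "a g = b g" by (simp add: z)
        qed
      qed
      show "S.alg_rep ` grp_alg_ideal G e = mat_over d K"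
      proof
        show "S.alg_rep ` grp_alg_ideal G e \<subseteq> mat_over d K" using FK FFe by (auto simp: grp_alg_ideal_def)
        show "mat_over d K \<subseteq> S.alg_rep ` grp_alg_ideal G e"
        proof
          fix A assume "A \<in> mat_over d K"
          then obtain x where x: "x \<in> rat_grp_alg G" "A = S.alg_rep x" using surj by (auto simp: L_def)
          then show "A \<in> S.alg_rep ` grp_alg_ideal G e"
            by (intro image_eqI[of _ _ "grp_alg_mult G x e"]) (auto simp: FFe grp_alg_ideal_def)
        qed
      qed
    qed
  qed
qed

end

theorem theorem1p6:
  fixes G :: "('a, 'b) monoid_scheme" and p :: nat and \<chi> :: "'a \<Rightarrow> complex"
  assumes "prime p" and "odd p"
    and "group G" and "finite (carrier G)" and "p_group p G"
    and "GVZ_group G" and "nested_group G"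
    and "\<chi> \<in> Irr G" and "\<chi> \<one>\<^bsub>G\<^esub> \<noteq> 1"
  defines "N \<equiv> char_ker G \<chi>" and "Z \<equiv> char_center G \<chi>"
  shows "e_Q G \<chi> = eps G Z N \<and>
         (\<exists>k. k ^ 2 = card (carrier G) div card Z \<and>
           alg_iso_mat G (eps G Z N) k
             (gen_subfield {cis (2 * pi / real (card Z div card N))}))"
proof -
  interpret group G by (rule assms(3))
  obtain d \<rho> where irr: "irreducible_rep G d \<rho>"
    and \<chi>: "\<chi> = (\<lambda>g. if g \<in> carrier G then mat_trace (\<rho> g) else 0)"
    using assms(8) by (auto simp: Irr_def)
  obtain n where n: "card (carrier G) = p ^ n" using assms(5) by (auto simp: p_group_def)
  interpret S: schur_rep G d \<rho> by (rule irreducible_rep_schur[OF assms(3,4) irr])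
  have \<chi>1: "\<chi> \<one>\<^bsub>G\<^esub> = of_nat d" by (simp add: \<chi>)
  interpret R: gvz_rep G d \<rho> p n
  proof unfold_locales
    show "prime p" "odd p" "card (carrier G) = p ^ n" "irreducible_rep G d \<rho>" by (fact assms(1,2) n irr)+
    show "d \<noteq> 1" using assms(9) \<chi>1 by auto
    fix g assume g: "g \<in> carrier G" "cmod (mat_trace (\<rho> g)) \<noteq> real d"
    have "complex_of_real (cmod (\<chi> g)) \<noteq> \<chi> \<one>\<^bsub>G\<^esub>"
    proof
      assume "complex_of_real (cmod (\<chi> g)) = \<chi> \<one>\<^bsub>G\<^esub>"
      then have "complex_of_real (cmod (\<chi> g)) = complex_of_real (real d)" by (simp add: \<chi>1)
      then have "cmod (\<chi> g) = real d" by (simp only: of_real_eq_iff)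
      then show False using g by (simp add: \<chi>)
    qed
    then have "g \<in> carrier G - char_center G \<chi>" using g(1) by (simp add: char_center_def)
    then have "\<chi> g = 0" using assms(6,8) unfolding GVZ_group_def by blast
    then show "mat_trace (\<rho> g) = 0" using g(1) by (simp add: \<chi>)
  qed
  have tr: "\<chi> g = mat_trace (\<rho> g)" if "g \<in> carrier G" for g using that by (simp add: \<chi>)
  have center: "g \<in> Z \<longleftrightarrow> g \<in> R.Z" for g
  proof (cases "g \<in> carrier G")
    case True
    have "complex_of_real (cmod (\<chi> g)) = of_nat d \<longleftrightarrow> complex_of_real (cmod (\<chi> g)) = complex_of_real (real d)" by simp
    also have "\<dots> \<longleftrightarrow> cmod (\<chi> g) = real d" by (simp only: of_real_eq_iff)
    finally show ?thesis using True R.Z_iff[OF True] by (simp add: Z_def char_center_def \<chi>1 tr)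
  qed (auto simp: Z_def char_center_def)
  then have Z: "Z = R.Z" by blast
  \<comment> \<open>If \<chi> takes the value d at g, then its modulus there is d, so g already lies
    in \<open>R.Z\<close>, where \<chi> is d times \<open>R.lam\<close>.\<close>
  have kernel: "g \<in> N \<longleftrightarrow> g \<in> R.N" for g
  proof
    assume "g \<in> N"
    then have g: "g \<in> carrier G" "mat_trace (\<rho> g) = of_nat d" by (auto simp: N_def char_ker_def \<chi>1 tr)
    then have gZ: "g \<in> R.Z" by (simp add: R.Z_iff)
    then show "g \<in> R.N" using g(2) R.tr_Z[OF gZ] S.dpos by (simp add: R.N_def)
  next
    assume "g \<in> R.N"
    then have "g \<in> R.Z" "R.lam g = 1" by (auto simp: R.N_def)
    then show "g \<in> N" using R.tr_Z[of g] by (simp add: N_def char_ker_def \<chi>1 tr)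
  qed
  then have N: "N = R.N" by blast
  have "e_Q G \<chi> = eps G Z N" unfolding Z N R.eps_eq by (rule R.e_Q_eq) (rule tr)
  moreover have "d ^ 2 = card (carrier G) div card Z" unfolding Z by (rule R.d_squared)
  moreover have "alg_iso_mat G (eps G Z N) d (gen_subfield {cis (2 * pi / real (card Z div card N))})"
    unfolding Z N R.eps_eq R.card_Z_div using R.algebra_iso by (simp add: R.K_def R.\<zeta>_def)
  ultimately show ?thesis by blast
qed

end
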